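(* Let $N\ge2$, $V_\pm>0$, $\rho_\pm>0$, $\gamma\ge0$, and let $\Omega=\Omega(\alpha,\beta,R_\pm)$ be a type I minimizer of the problem $(\mathrm{P})$ $$\min\left\{\mathcal F(\Omega):\ \Omega\subset\mathbb R^N \text{ is of finite perimeter},\ \rho_-|\Omega_-|=V_-,\ \rho_+|\Omega_+|=V_+\right\}.$$ Then $$\rho_-\cos\alpha=\rho_+\cos\beta.$$
   Context: Let $\mathbb R^N_-=\{x_1<0\}$, $\mathbb R^N_+=\{x_1>0\}$, $\Sigma=\{x_1=0\}$, $e_1=(1,0,\dots,0)$. For a set of finite perimeter $\Omega\subset\mathbb R^N$ put $\Omega_\pm=\Omega\cap\mathbb R^N_\pm$, $\Gamma_\pm=\partial\Omega\cap\mathbb R^N_\pm$, $\Gamma_0=\partial\Omega\cap\Sigma$. Here $|\cdot|$ is Lebesgue measure, $P(\Omega,A)$ is the relative perimeter of $\Omega$ in $A$ in the sense of De Giorgi, and $\mathcal H^{N-1}$ is Hausdorff measure. The functional is $$\mathcal F(\Omega)=\rho_-P(\Omega,\mathbb R^N_-)+\rho_+P(\Omega,\mathbb R^N_+)+\gamma\,\mathcal H^{N-1}(\Gamma_0).$$ Convention: sets of finite perimeter are identified when they differ by a Lebesgue-null set, and $\partial\Omega$ denotes the topological boundary of a representative with $\partial\Omega=\{x:0<|\Omega\cap B(x,r)|<|B(x,r)|\ \forall r>0\}$ (the support of the Gauss–Green measure). Candidate sets: for $\alpha\in[0,\pi)$, $\beta\in(0,\pi]$, $R_\pm>0$, let $\Omega(\alpha,\beta,R_\pm)=(B_-\cap\{x_1\le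 0\})\cup(B_+\cap\{x_1\ge 0\})$, where $B_-$ is the closed ball of radius $R_-$ centered at $ae_1$ with $a=-R_-\cos\alpha$ and $B_+$ is the closed ball of radius $R_+$ centered at $be_1$ with $b=-R_+\cos\beta$. A minimizer $\Omega$ is of type I if it is connected, $\Gamma_-$ and $\Gamma_+$ are spherical caps (parts in $\mathbb R^N_\pm$ of spheres crossing $\Sigma$), the boundaries of the manifolds $\Gamma_-$ and $\Gamma_+$ coincide, and $\overline\Omega\cap\Sigma$ is an $(N-1)$-dimensional ball (so $\mathcal H^{N-1}(\Gamma_0)=0$). For $\Omega(\alpha,\beta,R_\pm)$ this means $\alpha,\beta\in(0,\pi)$ and $R_-\sin\alpha=R_+\sin\beta$. *)

theory Defs
  imports "HOL-Analysis.Analysis"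
begin

text \<open>
  Euclidean N-space is a type \<open>'a :: euclidean_space\<close> with \<open>DIM('a) = N\<close>, and the first
  coordinate direction is a basis vector \<open>e\<close>, so that the first coordinate of \<open>x\<close> is \<open>x \<bullet> e\<close>.
\<close>

definition half_neg :: "'a::euclidean_space \<Rightarrow> 'a set"
  where "half_neg e = {x. x \<bullet> e < 0}"

definition half_pos :: "'a::euclidean_space \<Rightarrow> 'a set"
  where "half_pos e = {x. x \<bullet> e > 0}"

definition interface :: "'a::euclidean_space \<Rightarrow> 'a set"
  where "interface e = {x. x \<bullet> e = 0}"

definition divergence :: "('a::euclidean_space \<Rightarrow> 'a) \<Rightarrow> 'a \<Rightarrow> real"
  where "divergence T x = (\<Sum>b\<in>Basis. frechet_derivative T (at x) b \<bullet> b)"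

text \<open>Vector fields in \<open>C\<^sub>c\<^sup>1(A; \<real>\<^sup>N)\<close> with Euclidean norm at most 1, extended by 0 outside \<open>A\<close>.\<close>

definition test_field :: "'a::euclidean_space set \<Rightarrow> ('a \<Rightarrow> 'a) \<Rightarrow> bool"
  where "test_field A T \<longleftrightarrow>
    (\<forall>x. T differentiable (at x)) \<and>
    (\<forall>v. continuous_on UNIV (\<lambda>x. frechet_derivative T (at x) v)) \<and>
    compact (closure {x. T x \<noteq> 0}) \<and> closure {x. T x \<noteq> 0} \<subseteq> A \<and>
    (\<forall>x. norm (T x) \<le> 1)"

text \<open>
  De Giorgi's relative perimeter of \<open>\<Omega>\<close> in the open set \<open>A\<close>. Truncating negative integrals
  by \<open>ennreal\<close> does not change the supremum, because the zero field is a test field.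
\<close>

definition perimeter :: "'a::euclidean_space set \<Rightarrow> 'a set \<Rightarrow> ennreal"
  where "perimeter \<Omega> A =
    (SUP T\<in>{T. test_field A T}. ennreal (LINT x:\<Omega>|lebesgue. divergence T x))"

definition finite_perimeter :: "'a::euclidean_space set \<Rightarrow> bool"
  where "finite_perimeter \<Omega> \<longleftrightarrow> \<Omega> \<in> sets lebesgue \<and> perimeter \<Omega> UNIV < \<infinity>"

text \<open>
  Hausdorff measure of integer dimension \<open>k \<ge> 1\<close>, with the normalisation for which it is
  \<open>k\<close>-dimensional area (\<open>unit_ball_vol k\<close> is the volume of the unit ball in dimension \<open>k\<close>).
  Boundedness is required explicitly since \<open>diameter\<close> is only meaningful for bounded sets.
\<close>

definition hausdorff_content :: "nat \<Rightarrow> real \<Rightarrow> 'a::metric_space set \<Rightarrow> ennreal"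
  where "hausdorff_content k \<delta> A =
    (INF U\<in>{U :: nat \<Rightarrow> 'a set. A \<subseteq> (\<Union>i. U i) \<and> (\<forall>i. bounded (U i) \<and> diameter (U i) \<le> \<delta>)}.
       \<Sum>i. ennreal (unit_ball_vol (real k) * (diameter (U i) / 2) ^ k))"

definition hausdorff_measure :: "nat \<Rightarrow> 'a::metric_space set \<Rightarrow> ennreal"
  where "hausdorff_measure k A = (SUP \<delta>\<in>{0<..}. hausdorff_content k \<delta> A)"

text \<open>
  The boundary of a set of finite perimeter, i.e. the support of its Gauss--Green measure. It
  does not change if \<open>\<Omega>\<close> is modified on a null set, so neither does \<open>energy\<close> below.
\<close>

definition gg_boundary :: "'a::euclidean_space set \<Rightarrow> 'a set"
  where "gg_boundary \<Omega> = {x. \<forall>r>0.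
    0 < emeasure lebesgue (\<Omega> \<inter> ball x r) \<and>
    emeasure lebesgue (\<Omega> \<inter> ball x r) < emeasure lebesgue (ball x r)}"

definition energy :: "'a::euclidean_space \<Rightarrow> real \<Rightarrow> real \<Rightarrow> real \<Rightarrow> 'a set \<Rightarrow> ennreal"
  where "energy e \<rho>m \<rho>p \<gamma> \<Omega> =
    ennreal \<rho>m * perimeter \<Omega> (half_neg e) + ennreal \<rho>p * perimeter \<Omega> (half_pos e)
    + ennreal \<gamma> * hausdorff_measure (DIM('a) - 1) (gg_boundary \<Omega> \<inter> interface e)"

definition admissible ::
    "'a::euclidean_space \<Rightarrow> real \<Rightarrow> real \<Rightarrow> real \<Rightarrow> real \<Rightarrow> 'a set \<Rightarrow> bool"
  where "admissible e \<rho>m \<rho>p Vm Vp \<Omega> \<longleftrightarrow> finite_perimeter \<Omega> \<and>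
    ennreal \<rho>m * emeasure lebesgue (\<Omega> \<inter> half_neg e) = ennreal Vm \<and>
    ennreal \<rho>p * emeasure lebesgue (\<Omega> \<inter> half_pos e) = ennreal Vp"

definition minimizer ::
    "'a::euclidean_space \<Rightarrow> real \<Rightarrow> real \<Rightarrow> real \<Rightarrow> real \<Rightarrow> real \<Rightarrow> 'a set \<Rightarrow> bool"
  where "minimizer e \<rho>m \<rho>p \<gamma> Vm Vp \<Omega> \<longleftrightarrow> admissible e \<rho>m \<rho>p Vm Vp \<Omega> \<and>
    (\<forall>\<Omega>'. admissible e \<rho>m \<rho>p Vm Vp \<Omega>' \<longrightarrow> energy e \<rho>m \<rho>p \<gamma> \<Omega> \<le> energy e \<rho>m \<rho>p \<gamma> \<Omega>')"

definition candidate :: "'a::euclidean_space \<Rightarrow> real \<Rightarrow> real \<Rightarrow> real \<Rightarrow> real \<Rightarrow> 'a set"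
  where "candidate e \<alpha> \<beta> Rm Rp =
    (cball ((- Rm * cos \<alpha>) *\<^sub>R e) Rm \<inter> {x. x \<bullet> e \<le> 0}) \<union>
    (cball ((- Rp * cos \<beta>) *\<^sub>R e) Rp \<inter> {x. x \<bullet> e \<ge> 0})"

text \<open>\<open>\<Gamma>\<close> is the part in \<open>H\<close> of a sphere that crosses the interface (tangency is excluded).\<close>

definition spherical_cap :: "'a::euclidean_space \<Rightarrow> 'a set \<Rightarrow> 'a set \<Rightarrow> bool"
  where "spherical_cap e H \<Gamma> \<longleftrightarrow> (\<exists>c r. r > 0 \<and>
    sphere c r \<inter> half_neg e \<noteq> {} \<and> sphere c r \<inter> half_pos e \<noteq> {} \<and> \<Gamma> = sphere c r \<inter> H)"

text \<open>
  Type I sets. The first conjunct fixes the representative, on which connectedness and the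
  closure depend. The caps lie in open half-spaces, so the boundary of the manifold \<open>\<Gamma>\<close>
  (the sphere in which it meets the interface) is \<open>closure \<Gamma> - \<Gamma>\<close>.
\<close>

definition type_I :: "'a::euclidean_space \<Rightarrow> 'a set \<Rightarrow> bool"
  where "type_I e \<Omega> \<longleftrightarrow>
    frontier \<Omega> = gg_boundary \<Omega> \<and> connected \<Omega> \<and>
    (let \<Gamma>m = gg_boundary \<Omega> \<inter> half_neg e; \<Gamma>p = gg_boundary \<Omega> \<inter> half_pos e in
       spherical_cap e (half_neg e) \<Gamma>m \<and> spherical_cap e (half_pos e) \<Gamma>p \<and>
       closure \<Gamma>m - \<Gamma>m = closure \<Gamma>p - \<Gamma>p) \<and>
    (\<exists>c r. c \<in> interface e \<and> r > 0 \<and> closure \<Omega> \<inter> interface e = cball c r \<inter> interface e)"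

end

theory Submission
  imports Defs
begin

text \<open>
  The competitors are the candidate sets with the same volumes and a slightly different radius \<open>r'\<close> of the
  contact disc. A spherical cap with base radius \<open>r\<close> meeting the hyperplane at angle \<open>\<alpha>\<close> minimises area plus
  \<open>cos \<alpha>\<close> times wetted area at fixed volume, which for caps amounts to the concavity of the \<open>N\<close>-th root of
  the volume of the unit cap as a function of \<open>cos \<alpha>\<close>. Hence passing from \<open>r\<close> to \<open>r'\<close> changes the energy by at most
  a positive multiple of \<open>(\<rho>m cos \<alpha>' - \<rho>p cos \<beta>') (r\<^sup>N\<^sup>-\<^sup>1 - r'\<^sup>N\<^sup>-\<^sup>1)\<close>. Minimality makes this nonnegative
  for \<open>r' < r\<close> and for \<open>r' > r\<close>, and \<open>r' \<rightarrow> r\<close> forces the equality.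

  The De Giorgi perimeter of a cap equals its area: testing with \<open>(x - c) / R\<close> gives the lower bound, and the
  derivative of the volume in the radius, with the centre kept fixed, gives the upper bound.
\<close>

section \<open>Caps of the unit ball\<close>

text \<open>Write w and V for \<open>cap_weight n\<close> and \<open>cap_vol n\<close>, where n = N
  - 1. The quantity (1 - c^2) w(c) + (n+1) c V(c) is positive on (-1,1). It governs both the
  concavity and the monotonicity in c of volume over (base radius)^(n+1), so the volumes and
  \<open>r'\<close> fix the two contact angles of a competitor, close to the old ones. Concavity
  gives a finite inequality, so the energy is never differentiated in the base radius. The two caps
  of a competitor get the same base, so its boundary can meet the hyperplane only in an
  (N-2)-sphere; this has to be proved null for the (N-1)-dimensional Hausdorff measure. The
  corresponding term of the minimizer is nonnegative and is dropped. Test fields for a half-space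
  have compact support in the open half-space, so a field such as (x - c)/R must be cut off near the
  hyperplane. The derivative of the cut-off lives in a thin layer, and its contribution tends to an
  integral over the flat base. Admissibility also asks for finite perimeter in the whole space,
  where fields cross the hyperplane; the same layer controls that flux.\<close>

definition cap_weight :: "nat \<Rightarrow> real \<Rightarrow> real"
  where "cap_weight n t = sqrt (max 0 (1 - t\<^sup>2)) ^ n"

text \<open>Up to the factor \<open>unit_ball_vol n\<close>, \<open>cap_weight n t\<close> is the
  volume of the slice of the unit ball of dimension n + 1 at height t, and
  \<open>cap_vol n c\<close> that of the part below height c. A ball centred at height -R cos
  \<alpha> and rescaled by R meets the negative half-space in heights below cos \<alpha>, so c
  stands for the cosine of the contact angle.\<close>

definition cap_vol :: "nat \<Rightarrow> real \<Rightarrow> real"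
  where "cap_vol n c = integral {-1..c} (cap_weight n)"

lemma continuous_cap_weight: "continuous_on A (cap_weight n)"
  unfolding cap_weight_def by (intro continuous_intros)

lemma cap_weight_nonneg: "0 \<le> cap_weight n t"
  by (simp add: cap_weight_def)

lemma cap_weight_pos: "\<bar>t\<bar> < 1 \<Longrightarrow> 0 < cap_weight n t"
  by (simp add: cap_weight_def abs_square_less_1)

lemma cap_weight_eq: "\<bar>t\<bar> \<le> 1 \<Longrightarrow> cap_weight n t = sqrt (1 - t\<^sup>2) ^ n"
  by (simp add: cap_weight_def abs_square_le_1)

lemma cap_vol_deriv:
  assumes "-1 < c" shows "(cap_vol n has_real_derivative cap_weight n c) (at c)"
proof -
  have "((\<lambda>u. integral {-1..u} (cap_weight n)) has_real_derivative cap_weight n c) (at c within {-1..c+1})"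
    using assms by (intro integral_has_real_derivative continuous_cap_weight) auto
  then show ?thesis
    using assms at_within_Icc_at[of "-1" c "c+1"] by (simp add: cap_vol_def[abs_def])
qed

lemma cap_vol_minus_one [simp]: "cap_vol n (-1) = 0"
  by (simp add: cap_vol_def)

lemma continuous_cap_vol: "continuous_on {-1..b} (cap_vol n)"
  unfolding cap_vol_def
  by (intro indefinite_integral_continuous_1 integrable_continuous_real continuous_cap_weight)

lemma cap_vol_pos:
  assumes "-1 < c" shows "0 < cap_vol n c"
proof -
  \<comment> \<open>\<open>c\<close> may exceed 1, beyond which the weight need not be positive.
    Cutting at 0 keeps the mean-value point in (-1,0), where it is.\<close>
  define d where "d = min c 0"
  have d: "-1 < d" "d \<le> c" "d \<le> 0" using assms by (auto simp: d_def)
  obtain z where z: "-1 < z" "z < d" "cap_vol n d - cap_vol n (-1) = (d - (-1)) * cap_weight n z"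
    using MVT2[of "-1" d "cap_vol n" "cap_weight n"] mvt_simple[of "-1" d "cap_vol n"] d
    by (metis (no_types, opaque_lifting) DERIV_isCont MVT cap_vol_deriv continuous_cap_vol
        DERIV_unique real_differentiable_def)
  have "cap_vol n d > 0" using z d cap_weight_pos[of z n] by simp
  moreover have "cap_vol n d \<le> cap_vol n c" unfolding cap_vol_def
    using d by (intro integral_subset_le integrable_continuous_real continuous_cap_weight)
      (auto simp: cap_weight_nonneg)
  ultimately show ?thesis by simp
qed

lemma cap_weight_deriv:
  assumes "\<bar>c\<bar> < 1"
  shows "(cap_weight n has_real_derivative - real n * c * cap_weight n c / (1 - c\<^sup>2)) (at c)"
proof -
  have c: "0 < 1 - c\<^sup>2" using assms by (simp add: abs_square_less_1)
  have "((\<lambda>t. sqrt (1 - t\<^sup>2) ^ n) has_real_derivative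
      real n * sqrt (1 - c\<^sup>2) ^ (n - 1) * (- (2 * c) * (inverse (sqrt (1 - c\<^sup>2)) / 2))) (at c)"
    using c by (auto intro!: derivative_eq_intros)
  moreover have "real n * sqrt (1 - c\<^sup>2) ^ (n - 1) * (- (2 * c) * (inverse (sqrt (1 - c\<^sup>2)) / 2))
     = - real n * c * sqrt (1 - c\<^sup>2) ^ n / (1 - c\<^sup>2)"
  proof (cases n)
    case (Suc m)
    define s where "s = sqrt (1 - c\<^sup>2)"
    have 1: "1 - c\<^sup>2 = s * s" and 2: "s \<noteq> 0" using c by (simp_all add: s_def)
    have "real (Suc m) * s ^ m * (- (2 * c) * (inverse s / 2)) = - real (Suc m) * c * s ^ Suc m / (s * s)"
      using 2 by (simp add: divide_simps) (simp add: algebra_simps)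
    then show ?thesis unfolding Suc s_def[symmetric] unfolding 1 by simp
  qed simp
  ultimately have "((\<lambda>t. sqrt (1 - t\<^sup>2) ^ n) has_real_derivative - real n * c * cap_weight n c / (1 - c\<^sup>2)) (at c)"
    using assms by (simp add: cap_weight_eq)
  then show ?thesis
    by (rule has_field_derivative_transform_within_open[of _ _ _ "{-1<..<1}"])
       (use assms in \<open>auto simp: cap_weight_eq\<close>)
qed

text \<open>Both terms have a sign when c \<ge> 0. For c < 0 the expression D vanishes at -1, and
  its derivative collapses to (n+1) V(c) - c w(c), which is positive there. The sign of D decides
  both the monotonicity of \<open>cap_ratio\<close> and the concavity of the root of
  \<open>cap_vol\<close>.\<close>

lemma cap_discriminant_pos:
  assumes "\<bar>c\<bar> < 1"
  shows "0 < (1 - c\<^sup>2) * cap_weight n c + real (Suc n) * c * cap_vol n c"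
proof (cases "c \<ge> 0")
  case True
  have "0 < 1 - c\<^sup>2" using assms by (simp add: abs_square_less_1)
  then have "0 < (1 - c\<^sup>2) * cap_weight n c" using cap_weight_pos assms by simp
  moreover have "0 \<le> real (Suc n) * c * cap_vol n c" using True assms cap_vol_pos[of c n] by simp
  ultimately show ?thesis by linarith
next
  case False
  define D where "D = (\<lambda>c. (1 - c\<^sup>2) * cap_weight n c + real (Suc n) * c * cap_vol n c)"
  have der: "(D has_real_derivative real (Suc n) * cap_vol n x - x * cap_weight n x) (at x)"
    if "-1 < x" "x < 0" for x
  proof -
    have x: "\<bar>x\<bar> < 1" "1 - x\<^sup>2 \<noteq> 0" using that by (auto simp: power2_eq_1_iff)
    show ?thesis unfolding D_def
      by (rule derivative_eq_intros cap_weight_deriv cap_vol_deriv x that refl)+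
         (use x in \<open>simp add: field_simps\<close>)
  qed
  have "continuous_on {-1..c} D" unfolding D_def
    by (intro continuous_intros continuous_cap_weight continuous_cap_vol)
  then have "D (-1) < D c"
  proof (rule DERIV_pos_imp_increasing_open[rotated 2])
    fix x assume x: "-1 < x" "x < c"
    have "0 < real (Suc n) * cap_vol n x" using cap_vol_pos[OF x(1)] by simp
    moreover have "x * cap_weight n x \<le> 0"
      using x False cap_weight_nonneg[of n x] by (simp add: mult_nonpos_nonneg)
    ultimately have "0 < real (Suc n) * cap_vol n x - x * cap_weight n x" by linarith
    then show "\<exists>y. (D has_real_derivative y) (at x) \<and> 0 < y" using der[of x] x False by auto
  qed (use assms in auto)
  moreover have "D (-1) = 0" by (simp add: D_def)
  ultimately show ?thesis by (simp add: D_def)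
qed

text \<open>Up to the constant \<open>unit_ball_vol n\<close>, this is the volume of a cap divided by the \<open>Suc n\<close>-th power of the
  radius of its base.\<close>

definition cap_ratio :: "nat \<Rightarrow> real \<Rightarrow> real"
  where "cap_ratio n c = cap_vol n c / sqrt (1 - c\<^sup>2) ^ Suc n"

text \<open>On (-1,1) the denominator is \<open>cap_weight (Suc n)\<close>, so its derivative is
  already known; the numerator left by the quotient rule is a positive multiple of the
  discriminant.\<close>

lemma cap_ratio_deriv:
  assumes "\<bar>c\<bar> < 1"
  obtains d where "(cap_ratio n has_real_derivative d) (at c)" "0 < d"
proof -
  have c: "0 < 1 - c\<^sup>2" using assms by (simp add: abs_square_less_1)
  have s: "0 < cap_weight (Suc n) c" using assms by (rule cap_weight_pos)
  have "((\<lambda>c. cap_vol n c / cap_weight (Suc n) c) has_real_derivative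
     (cap_weight n c * cap_weight (Suc n) c - cap_vol n c * (- real (Suc n) * c * cap_weight (Suc n) c / (1 - c\<^sup>2)))
       / (cap_weight (Suc n) c * cap_weight (Suc n) c)) (at c)"
    using s assms by (intro DERIV_divide cap_vol_deriv cap_weight_deriv) auto
  moreover have "(cap_weight n c * cap_weight (Suc n) c - cap_vol n c * (- real (Suc n) * c * cap_weight (Suc n) c / (1 - c\<^sup>2)))
       / (cap_weight (Suc n) c * cap_weight (Suc n) c)
     = ((1 - c\<^sup>2) * cap_weight n c + real (Suc n) * c * cap_vol n c) / ((1 - c\<^sup>2) * cap_weight (Suc n) c)"
    using s c by (simp add: divide_simps) (simp add: algebra_simps)
  ultimately have "((\<lambda>c. cap_vol n c / cap_weight (Suc n) c) has_real_derivative
     ((1 - c\<^sup>2) * cap_weight n c + real (Suc n) * c * cap_vol n c) / ((1 - c\<^sup>2) * cap_weight (Suc n) c)) (at c)"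
    by simp
  then have "(cap_ratio n has_real_derivative
     ((1 - c\<^sup>2) * cap_weight n c + real (Suc n) * c * cap_vol n c) / ((1 - c\<^sup>2) * cap_weight (Suc n) c)) (at c)"
    by (rule has_field_derivative_transform_within_open[of _ _ _ "{-1<..<1}"])
       (use assms in \<open>auto simp: cap_weight_eq cap_ratio_def\<close>)
  then show ?thesis using that cap_discriminant_pos[OF assms, of n] c s by simp
qed

lemma cap_ratio_less:
  assumes "-1 < c" "c < d" "d < 1" shows "cap_ratio n c < cap_ratio n d"
  by (rule DERIV_pos_imp_increasing[OF assms(2)])
     (metis abs_less_iff assms cap_ratio_deriv linorder_not_le minus_less_iff
        order_less_le_trans)

lemma continuous_cap_ratio:
  assumes "-1 < c" "d < 1" shows "continuous_on {c..d} (cap_ratio n)"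
proof (rule continuous_at_imp_continuous_on, rule ballI)
  fix x assume "x \<in> {c..d}"
  then have "\<bar>x\<bar> < 1" using assms by auto
  then show "isCont (cap_ratio n) x" by (metis cap_ratio_deriv DERIV_isCont)
qed

text \<open>The equation says that the cap with cosine \<open>c'\<close> and base radius \<open>r'\<close> has the volume of the given cap.\<close>

lemma cap_ratio_solve:
  assumes c: "\<bar>c\<bar> < 1" and "0 < \<delta>" and "0 < r"
  obtains \<eta> where "0 < \<eta>" "\<eta> < r"
    "\<And>r'. \<bar>r' - r\<bar> < \<eta> \<Longrightarrow> \<exists>c'. \<bar>c'\<bar> < 1 \<and> \<bar>c' - c\<bar> \<le> \<delta> \<and> cap_ratio n c' * r' ^ Suc n = cap_ratio n c * r ^ Suc n"
proof -
  \<comment> \<open>Half the distance to the endpoints keeps [c - d, c + d] inside (-1,1).\<close>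
  define d where "d = min \<delta> ((1 - \<bar>c\<bar>) / 2)"
  have d: "0 < d" "d \<le> \<delta>" "-1 < c - d" "c + d < 1" using assms by (auto simp: d_def min_def field_simps abs_if split: if_splits)
  define K where "K = cap_ratio n c * r ^ Suc n"
  have lim: "((\<lambda>r'. K / r' ^ Suc n) \<longlongrightarrow> K / r ^ Suc n) (at r)"
    using \<open>0 < r\<close> by (intro tendsto_intros) auto
  have K: "K / r ^ Suc n = cap_ratio n c" using \<open>0 < r\<close> by (simp add: K_def)
  \<comment> \<open>Strict monotonicity puts \<open>cap_ratio n c\<close> strictly between its
    values at c - d and c + d. The required ratio depends continuously on \<open>r'\<close>, so it
    stays between them, and the intermediate value theorem then supplies the new cosine.\<close>
  have "\<forall>\<^sub>F r' in at r. cap_ratio n (c - d) < K / r' ^ Suc n \<and> K / r' ^ Suc n < cap_ratio n (c + d)"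
    using order_tendstoD[OF lim] cap_ratio_less[of "c - d" c n] cap_ratio_less[of c "c + d" n] d c
    unfolding K by (auto intro!: eventually_conj)
  then obtain \<eta>0 where \<eta>0: "\<eta>0 > 0" "\<And>r'. r' \<noteq> r \<Longrightarrow> dist r' r < \<eta>0 \<Longrightarrow>
      cap_ratio n (c - d) < K / r' ^ Suc n \<and> K / r' ^ Suc n < cap_ratio n (c + d)"
    unfolding eventually_at by auto
  show thesis
  proof (rule that[of "min \<eta>0 (r / 2)"])
    fix r' assume r': "\<bar>r' - r\<bar> < min \<eta>0 (r / 2)"
    then have "r' > 0" using \<open>0 < r\<close> by (auto simp: abs_if field_simps split: if_splits)
    have "cap_ratio n (c - d) \<le> K / r' ^ Suc n \<and> K / r' ^ Suc n \<le> cap_ratio n (c + d)"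
      using \<eta>0(2)[of r'] r' cap_ratio_less[of "c - d" c n] cap_ratio_less[of c "c + d" n] d c K
      by (cases "r' = r") (auto simp: dist_real_def)
    then obtain c' where "c - d \<le> c'" "c' \<le> c + d" "cap_ratio n c' = K / r' ^ Suc n"
      using IVT'[of "cap_ratio n" "c - d" "K / r' ^ Suc n" "c + d"] continuous_cap_ratio[of "c - d" "c + d" n] d by auto
    then show "\<exists>c'. \<bar>c'\<bar> < 1 \<and> \<bar>c' - c\<bar> \<le> \<delta> \<and> cap_ratio n c' * r' ^ Suc n = cap_ratio n c * r ^ Suc n"
      using d \<open>r' > 0\<close> by (intro exI[of _ c']) (auto simp: K_def)
  qed (use \<eta>0 \<open>0 < r\<close> in auto)
qed

section \<open>Concavity of the root of the cap volume\<close>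

lemma cap_vol_powr_deriv:
  assumes "\<bar>c\<bar> < 1"
  shows "((\<lambda>c. cap_vol n c powr (1 / real (Suc n))) has_real_derivative
     cap_vol n c powr (1 / real (Suc n) - 1) * cap_weight n c / real (Suc n)) (at c)"
proof -
  have p: "cap_vol n c > 0" using assms by (intro cap_vol_pos) auto
  show ?thesis
    using DERIV_fun_powr[OF cap_vol_deriv p, of "1 / real (Suc n)"] assms by auto
qed

text \<open>Differentiating the first derivative of the (n+1)-st root once more gives a nonpositive
  factor times the discriminant of \<open>cap_discriminant_pos\<close>. This is the concavity,
  stated for the derivative.\<close>

lemma cap_vol_powr_deriv_decreasing:
  assumes "-1 < c" "c \<le> d" "d < 1"
  shows "cap_vol n d powr (1 / real (Suc n) - 1) * cap_weight n d
    \<le> cap_vol n c powr (1 / real (Suc n) - 1) * cap_weight n c"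
proof (rule DERIV_nonpos_imp_nonincreasing[OF assms(2)])
  fix x assume "c \<le> x" "x \<le> d"
  then have x: "\<bar>x\<bar> < 1" "-1 < x" using assms by auto
  define p where "p = 1 / real (Suc n) - 1"
  define V where "V = cap_vol n x"
  have V: "V > 0" using cap_vol_pos[OF x(2)] by (simp add: V_def)
  have s: "0 < 1 - x\<^sup>2" using x by (simp add: abs_square_less_1)
  have der: "((\<lambda>c. cap_vol n c powr p * cap_weight n c) has_real_derivative
      p * V powr (p - 1) * cap_weight n x * cap_weight n x + (- real n * x * cap_weight n x / (1 - x\<^sup>2)) * V powr p) (at x)"
    unfolding V_def using DERIV_mult[OF DERIV_fun_powr[OF cap_vol_deriv[OF x(2)] V[unfolded V_def], of p] cap_weight_deriv[OF x(1)]]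
    by simp
  \<comment> \<open>The factorisation in abstract variables: y is the point, t = 1 - y^2, m = n + 1,
    a = n, b the exponent p = -n/(n+1), v the cap volume, Q and U its powers with exponents p - 1
    and p.\<close>
  have alg: "b * Q * W * W + (- a * y * W / t) * U = - (a * Q * W / (t * m)) * (t * W + m * y * v)"
    if "m \<noteq> 0" "t \<noteq> 0" "b = - a / m" "U = Q * v" for a b m t Q W U v y :: real
    using that(1,2) unfolding that(3,4) by (simp add: divide_simps) (simp add: algebra_simps)
  have p: "p = - real n / real (Suc n)" by (simp add: p_def field_simps)
  have Vp: "V powr p = V powr (p - 1) * V" using V by (simp add: powr_diff)
  have nz: "1 - x\<^sup>2 \<noteq> 0" "real (Suc n) \<noteq> 0" using s by auto
  have "((\<lambda>c. cap_vol n c powr p * cap_weight n c) has_real_derivative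
      - (real n * V powr (p - 1) * cap_weight n x / ((1 - x\<^sup>2) * real (Suc n)))
        * ((1 - x\<^sup>2) * cap_weight n x + real (Suc n) * x * V)) (at x)"
    using der unfolding alg[OF nz(2,1) p Vp, of "cap_weight n x" x] .
  moreover have "0 \<le> real n * V powr (p - 1) * cap_weight n x / ((1 - x\<^sup>2) * real (Suc n))"
    using cap_weight_nonneg[of n x] s by (intro divide_nonneg_nonneg mult_nonneg_nonneg) auto
  then have "- (real n * V powr (p - 1) * cap_weight n x / ((1 - x\<^sup>2) * real (Suc n)))
        * ((1 - x\<^sup>2) * cap_weight n x + real (Suc n) * x * V) \<le> 0"
    using cap_discriminant_pos[OF x(1), of n] unfolding V_def[symmetric]
    by (intro mult_nonpos_nonneg) auto
  ultimately show "\<exists>y. ((\<lambda>a. cap_vol n a powr (1 / real (Suc n) - 1) * cap_weight n a) has_real_derivative y) (at x) \<and> y \<le> 0"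
    unfolding p_def[symmetric] by blast
qed

lemma cap_vol_powr_tangent:
  assumes "\<bar>c\<bar> < 1" "\<bar>d\<bar> < 1"
  shows "cap_vol n d powr (1 / real (Suc n)) - cap_vol n c powr (1 / real (Suc n))
     \<le> (d - c) * (cap_vol n c powr (1 / real (Suc n) - 1) * cap_weight n c / real (Suc n))"
proof -
  define f where "f = (\<lambda>c. cap_vol n c powr (1 / real (Suc n)))"
  define f' where "f' = (\<lambda>c. cap_vol n c powr (1 / real (Suc n) - 1) * cap_weight n c / real (Suc n))"
  have der: "(f has_real_derivative f' x) (at x)" if "\<bar>x\<bar> < 1" for x
    unfolding f_def f'_def using that by (rule cap_vol_powr_deriv)
  have mono: "f' y \<le> f' x" if "-1 < x" "x \<le> y" "y < 1" for x y
    unfolding f'_def using cap_vol_powr_deriv_decreasing[OF that] by (intro divide_right_mono) auto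
  have "f d - f c \<le> (d - c) * f' c"
  proof (cases c d rule: linorder_cases)
    case less
    obtain z where z: "c < z" "z < d" "f d - f c = (d - c) * f' z"
      using MVT2[OF less, of f f'] der assms by (auto simp: abs_if split: if_splits)
    then show ?thesis using mono[of c z] less assms by (auto intro!: mult_left_mono)
  next
    case greater
    obtain z where z: "d < z" "z < c" "f c - f d = (c - d) * f' z"
      using MVT2[OF greater, of f f'] der assms by (auto simp: abs_if split: if_splits)
    then have "(c - d) * f' c \<le> f c - f d" using mono[of z c] greater assms by (auto intro!: mult_left_mono)
    then show ?thesis by (simp add: algebra_simps)
  qed simp
  then show ?thesis by (simp add: f_def f'_def)
qed

text \<open>At common volume V, 1/R is the (n+1)-st root of the unit cap volume divided by the
  (n+1)-st root of V. The inequality is thus the tangent inequality for the concave root, multiplied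
  by (n+1) V; the factor R^n w(c) on the right is the n-th power of the base radius.\<close>

lemma cap_radius_tangent:
  assumes c: "\<bar>c\<bar> < 1" "\<bar>c'\<bar> < 1" and R: "0 < R" "0 < R'"
    and vol: "R ^ Suc n * cap_vol n c = R' ^ Suc n * cap_vol n c'"
  shows "real (Suc n) * (R ^ Suc n * cap_vol n c) * (1 / R' - 1 / R) \<le> (c' - c) * (R ^ n * cap_weight n c)"
proof -
  define V where "V = R ^ Suc n * cap_vol n c"
  define p where "p = 1 / real (Suc n)"
  have pos: "0 < cap_vol n c" "0 < cap_vol n c'" using c by (auto intro!: cap_vol_pos)
  then have V: "V > 0" using R by (simp add: V_def)
  have rt: "(x ^ Suc n * y) powr p = x * y powr p" if "x > 0" "y > 0" for x y :: real
    using that by (simp add: powr_mult p_def powr_powr flip: powr_realpow del: power_Suc of_nat_Suc)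
  have 1: "1 / R = cap_vol n c powr p / V powr p"
    using rt[OF R(1) pos(1)] R V pos by (simp add: V_def divide_simps)
  have 2: "1 / R' = cap_vol n c' powr p / V powr p"
    using rt[OF R(2) pos(2)] R V vol pos by (simp add: V_def divide_simps)
  have "1 / R' - 1 / R \<le> (c' - c) * (cap_vol n c powr (p - 1) * cap_weight n c / real (Suc n)) / V powr p"
    using cap_vol_powr_tangent[OF c] V unfolding 1 2 p_def by (simp add: divide_simps)
  then have "real (Suc n) * V * (1 / R' - 1 / R) \<le> real (Suc n) * V * ((c' - c) * (cap_vol n c powr (p - 1) * cap_weight n c / real (Suc n)) / V powr p)"
    using V by (intro mult_left_mono) auto
  also have "\<dots> = (c' - c) * (R ^ n * cap_weight n c)"
  proof -
    have "V powr p = R * cap_vol n c powr p" using rt[OF R(1) pos(1)] by (simp add: V_def)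
    moreover have "cap_vol n c powr p = cap_vol n c powr (p - 1) * cap_vol n c" using pos by (simp add: powr_diff)
    ultimately show ?thesis using R pos by (simp add: V_def divide_simps)
  qed
  finally show ?thesis by (simp add: V_def)
qed

section \<open>Slicing balls\<close>

definition slice_area :: "nat \<Rightarrow> real \<Rightarrow> real \<Rightarrow> real \<Rightarrow> real"
  where "slice_area n a R s = unit_ball_vol n * sqrt (max 0 (R\<^sup>2 - (s - a)\<^sup>2)) ^ n"

lemma slice_area_nonneg: "0 \<le> slice_area n a R s"
  by (simp add: slice_area_def)

lemma continuous_slice_area: "continuous_on A (slice_area n a R)"
  unfolding slice_area_def by (intro continuous_intros)

lemma slice_area_measurable [measurable]: "slice_area n a R \<in> borel_measurable borel"
  by (intro borel_measurable_continuous_onI continuous_slice_area)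

text \<open>Fubini: Lebesgue measure is the image of the product measure over \<open>Basis\<close>,
  and the coordinate along \<open>e\<close> is split off. The remaining coordinates range over a
  ball of radius sqrt (R^2 - (s - a)^2).\<close>

lemma nn_integral_cball_slices:
  fixes e :: "'a::euclidean_space" and g :: "real \<Rightarrow> ennreal"
  assumes dim: "DIM('a) \<ge> 2" and e: "e \<in> Basis" and R: "R > 0" and g [measurable]: "g \<in> borel_measurable borel"
  shows "(\<integral>\<^sup>+x. g (x \<bullet> e) * indicator (cball (a *\<^sub>R e) R) x \<partial>lborel)
    = (\<integral>\<^sup>+s. g s * ennreal (slice_area (DIM('a) - 1) a R s) \<partial>lborel)"
proof -
  interpret product_sigma_finite "\<lambda>_. lborel :: real measure" by standard
  define A :: "'a set" where "A = Basis - {e}"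
  have A: "finite A" "e \<notin> A" "insert e A = Basis" "card A = DIM('a) - 1"
    using e by (auto simp: A_def)
  let ?P = "\<lambda>A. Pi\<^sub>M A (\<lambda>_. lborel :: real measure)"
  have proj: "(\<Sum>b\<in>Basis. f b *\<^sub>R b) \<bullet> c = f c" if "c \<in> Basis" for f and c :: 'a
    using that by (simp add: inner_sum_left inner_Basis sum.delta if_distrib cong: if_cong)
  have dist: "dist (a *\<^sub>R e) (\<Sum>b\<in>Basis. f b *\<^sub>R b) = sqrt ((f e - a)\<^sup>2 + (\<Sum>b\<in>A. (f b)\<^sup>2))" for f
  proof -
    have "(dist (a *\<^sub>R e) (\<Sum>b\<in>Basis. f b *\<^sub>R b))\<^sup>2 = (\<Sum>c\<in>insert e A. ((a *\<^sub>R e - (\<Sum>b\<in>Basis. f b *\<^sub>R b)) \<bullet> c)\<^sup>2)"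
      unfolding A(3) dist_norm power2_norm_eq_inner by (subst euclidean_inner) (simp only: power2_eq_square)
    also have "\<dots> = (\<Sum>c\<in>insert e A. ((if c = e then a else 0) - f c)\<^sup>2)"
      using e A by (intro sum.cong refl) (simp add: inner_diff_left proj inner_Basis)
    also have "\<dots> = (f e - a)\<^sup>2 + (\<Sum>b\<in>A. (f b)\<^sup>2)"
    proof -
      have "(\<Sum>c\<in>A. ((if c = e then a else 0) - f c)\<^sup>2) = (\<Sum>b\<in>A. (f b)\<^sup>2)"
        using A by (intro sum.cong) auto
      then show ?thesis using A(1,2) by (simp add: power2_commute)
    qed
    finally show ?thesis by (metis real_sqrt_unique zero_le_dist)
  qed
  have mem: "(\<Sum>b\<in>Basis. f b *\<^sub>R b) \<in> cball (a *\<^sub>R e) R \<longleftrightarrow> (f e - a)\<^sup>2 + (\<Sum>b\<in>A. (f b)\<^sup>2) \<le> R\<^sup>2" for f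
    unfolding mem_cball dist using R
    by (metis abs_of_pos real_sqrt_abs real_sqrt_le_iff)
  have [measurable]: "{f. (f e - a)\<^sup>2 + (\<Sum>b\<in>A. (f b)\<^sup>2) \<le> R\<^sup>2} \<inter> space (?P (insert e A)) \<in> sets (?P (insert e A))"
    by measurable
  have "(\<integral>\<^sup>+x. g (x \<bullet> e) * indicator (cball (a *\<^sub>R e) R) x \<partial>lborel)
    = (\<integral>\<^sup>+f. g (f e) * indicator ({f. (f e - a)\<^sup>2 + (\<Sum>b\<in>A. (f b)\<^sup>2) \<le> R\<^sup>2} \<inter> space (?P (insert e A))) f \<partial>?P (insert e A))"
    unfolding lborel_eq[where 'a = 'a] using e
    by (subst nn_integral_distr)
       (auto simp: proj A(3) mem simp del: mem_cball intro!: nn_integral_cong split: split_indicator)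
  also have "\<dots> = (\<integral>\<^sup>+s. \<integral>\<^sup>+f. g s * indicator ({f. (\<Sum>b\<in>A. (f b)\<^sup>2) \<le> R\<^sup>2 - (s - a)\<^sup>2} \<inter> space (?P A)) f \<partial>?P A \<partial>lborel)"
  proof (subst product_nn_integral_insert_rev[OF A(1,2)])
    show "(\<lambda>f. g (f e) * indicator ({f. (f e - a)\<^sup>2 + (\<Sum>b\<in>A. (f b)\<^sup>2) \<le> R\<^sup>2} \<inter> space (?P (insert e A))) f) \<in> borel_measurable (?P (insert e A))"
      by measurable
    have "(\<Sum>b\<in>A. (if b = e then s else f b)\<^sup>2) = (\<Sum>b\<in>A. (f b)\<^sup>2)" for s and f :: "'a \<Rightarrow> real"
      using A(2) by (intro sum.cong) auto
    then show "(\<integral>\<^sup>+s. \<integral>\<^sup>+f. g ((f(e := s)) e) * indicator ({f. (f e - a)\<^sup>2 + (\<Sum>b\<in>A. (f b)\<^sup>2) \<le> R\<^sup>2} \<inter> space (?P (insert e A))) (f(e := s)) \<partial>?P A \<partial>lborel)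
      = (\<integral>\<^sup>+s. \<integral>\<^sup>+f. g s * indicator ({f. (\<Sum>b\<in>A. (f b)\<^sup>2) \<le> R\<^sup>2 - (s - a)\<^sup>2} \<inter> space (?P A)) f \<partial>?P A \<partial>lborel)"
      by (intro nn_integral_cong) (auto simp: indicator_def space_PiM PiE_def algebra_simps)
  qed
  also have "\<dots> = (\<integral>\<^sup>+s. g s * ennreal (slice_area (DIM('a) - 1) a R s) \<partial>lborel)"
  proof (intro nn_integral_cong_AE)
    \<comment> \<open>At these two heights the slice degenerates to a point, while
      \<open>emeasure_cball_aux\<close> is applied with a positive radius.\<close>
    have "AE s in lborel. s \<notin> {a - R, a + R}"
      by (intro AE_not_in countable_imp_null_set_lborel) auto
    then show "AE s in lborel. (\<integral>\<^sup>+f. g s * indicator ({f. (\<Sum>b\<in>A. (f b)\<^sup>2) \<le> R\<^sup>2 - (s - a)\<^sup>2} \<inter> space (?P A)) f \<partial>?P A)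
      = g s * ennreal (slice_area (DIM('a) - 1) a R s)"
    proof eventually_elim
      case (elim s)
      have "emeasure (?P A) ({f. (\<Sum>b\<in>A. (f b)\<^sup>2) \<le> R\<^sup>2 - (s - a)\<^sup>2} \<inter> space (?P A)) = ennreal (slice_area (DIM('a) - 1) a R s)"
        if "(s - a)\<^sup>2 < R\<^sup>2"
      proof -
        define q where "q = sqrt (R\<^sup>2 - (s - a)\<^sup>2)"
        have q: "q > 0" "q\<^sup>2 = R\<^sup>2 - (s - a)\<^sup>2" using that by (auto simp: q_def)
        have "(\<Sum>b\<in>A. (f b)\<^sup>2) \<le> R\<^sup>2 - (s - a)\<^sup>2 \<longleftrightarrow> sqrt (\<Sum>b\<in>A. (f b)\<^sup>2) \<le> q" for f :: "'a \<Rightarrow> real"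
          using q real_sqrt_le_iff'[of "\<Sum>b\<in>A. (f b)\<^sup>2" q] by (simp add: sum_nonneg)
        then show ?thesis
          using emeasure_cball_aux[OF A(1) q(1)] A(4) that by (simp add: slice_area_def q_def)
      qed
      moreover have "{f. (\<Sum>b\<in>A. (f b)\<^sup>2) \<le> R\<^sup>2 - (s - a)\<^sup>2} \<inter> space (?P A) = {}" "slice_area (DIM('a) - 1) a R s = 0"
        if "(s - a)\<^sup>2 > R\<^sup>2"
      proof -
        have "\<not> (\<Sum>b\<in>A. (f b)\<^sup>2) \<le> R\<^sup>2 - (s - a)\<^sup>2" for f :: "'a \<Rightarrow> real"
        proof -
          have "0 \<le> (\<Sum>b\<in>A. (f b)\<^sup>2)" by (simp add: sum_nonneg)
          then show ?thesis using that by linarith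
        qed
        then show "{f. (\<Sum>b\<in>A. (f b)\<^sup>2) \<le> R\<^sup>2 - (s - a)\<^sup>2} \<inter> space (?P A) = {}" by auto
      qed (use that dim in \<open>simp add: slice_area_def\<close>)
      moreover have "(s - a)\<^sup>2 \<noteq> R\<^sup>2"
        using elim by (auto simp: power2_eq_iff)
      ultimately have "emeasure (?P A) ({f. (\<Sum>b\<in>A. (f b)\<^sup>2) \<le> R\<^sup>2 - (s - a)\<^sup>2} \<inter> space (?P A)) = ennreal (slice_area (DIM('a) - 1) a R s)"
        by (cases "(s - a)\<^sup>2" "R\<^sup>2" rule: linorder_cases) auto
      then show ?case by (subst nn_integral_cmult) auto
    qed
  qed
  finally show ?thesis .
qed

text \<open>Admitting the reflected direction, by the substitution s to -s, lets every later
  statement about \<open>half_neg u\<close> serve the positive half-space too, with u = -e.\<close>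

lemma nn_integral_cball_slices':
  fixes u :: "'a::euclidean_space" and g :: "real \<Rightarrow> ennreal"
  assumes dim: "DIM('a) \<ge> 2" and u: "u \<in> Basis \<or> - u \<in> Basis" and R: "R > 0"
    and g [measurable]: "g \<in> borel_measurable borel"
  shows "(\<integral>\<^sup>+x. g (x \<bullet> u) * indicator (cball (a *\<^sub>R u) R) x \<partial>lborel)
    = (\<integral>\<^sup>+s. g s * ennreal (slice_area (DIM('a) - 1) a R s) \<partial>lborel)"
proof (cases "u \<in> Basis")
  case False
  with u have u': "- u \<in> Basis" by simp
  have "(\<integral>\<^sup>+x. g (x \<bullet> u) * indicator (cball (a *\<^sub>R u) R) x \<partial>lborel)
    = (\<integral>\<^sup>+x. g (- (x \<bullet> (- u))) * indicator (cball ((- a) *\<^sub>R (- u)) R) x \<partial>lborel)" by simp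
  also have "\<dots> = (\<integral>\<^sup>+s. g (- s) * ennreal (slice_area (DIM('a) - 1) (- a) R s) \<partial>lborel)"
    by (rule nn_integral_cball_slices[OF dim u' R]) measurable
  also have "\<dots> = (\<integral>\<^sup>+s. g s * ennreal (slice_area (DIM('a) - 1) a R s) \<partial>lborel)"
    by (subst nn_integral_real_affine[of _ "-1" 0]) (auto simp: slice_area_def power2_commute)
  finally show ?thesis .
qed (use assms in \<open>simp add: nn_integral_cball_slices\<close>)

lemma nn_integral_cap_weight:
  assumes "n \<ge> 1" "-1 < c"
  shows "(\<integral>\<^sup>+t. indicator {..<c} t * ennreal (cap_weight n t) \<partial>lborel) = ennreal (cap_vol n c)"
proof -
  have "(cap_weight n has_integral cap_vol n c) {-1..c}"
    unfolding cap_vol_def by (intro integrable_integral integrable_continuous_real continuous_cap_weight)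
  from nn_integral_has_integral_lebesgue[OF _ this]
  have "ennreal (cap_vol n c) = (\<integral>\<^sup>+t. indicator {-1..c} t * ennreal (cap_weight n t) \<partial>lborel)"
    by (simp add: cap_weight_nonneg ennreal_mult' ennreal_indicator mult_ac)
  also have "\<dots> = (\<integral>\<^sup>+t. indicator {..<c} t * ennreal (cap_weight n t) \<partial>lborel)"
  proof (rule nn_integral_cong_AE)
    have "AE s in lborel. s \<notin> {c}"
      by (intro AE_not_in countable_imp_null_set_lborel) auto
    then show "AE t in lborel. indicator {-1..c} t * ennreal (cap_weight n t) = indicator {..<c} t * ennreal (cap_weight n t)"
    proof eventually_elim
      case (elim t)
      \<comment> \<open>Below -1 the truncated weight is 0^n, which is 0 because n \<ge> 1.\<close>
      have "cap_weight n t = 0" if "t < -1"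
      proof -
        have "1 \<le> t\<^sup>2" using that abs_square_le_1[of t] abs_square_less_1[of t] by linarith
        then show ?thesis using assms(1) by (simp add: cap_weight_def max_def)
      qed
      then show ?case using elim by (auto simp: indicator_def not_le)
    qed
  qed
  finally show ?thesis ..
qed

lemma slice_area_affine:
  assumes "R > 0"
  shows "slice_area n a R (a + R * t) = unit_ball_vol n * R ^ n * cap_weight n t"
proof -
  have "max 0 (R\<^sup>2 - (R * t)\<^sup>2) = R\<^sup>2 * max 0 (1 - t\<^sup>2)"
    using assms by (simp add: max_mult_distrib_left power_mult_distrib algebra_simps)
  then show ?thesis using assms
    by (simp add: slice_area_def cap_weight_def real_sqrt_mult power_mult_distrib)
qed

text \<open>The substitution s = a + R t rescales to the unit ball: it contributes one factor R
  besides the R^n of the slices, and turns the condition s < 0 into t < -a/R.\<close>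

lemma emeasure_cap:
  fixes u :: "'a::euclidean_space"
  assumes dim: "DIM('a) \<ge> 2" and u: "u \<in> Basis \<or> - u \<in> Basis" and R: "\<bar>a\<bar> < R"
  shows "emeasure lborel (cball (a *\<^sub>R u) R \<inter> half_neg u)
    = ennreal (unit_ball_vol (real (DIM('a) - 1)) * R ^ DIM('a) * cap_vol (DIM('a) - 1) (- a / R))"
proof -
  define n where "n = DIM('a) - 1"
  have n: "n \<ge> 1" "DIM('a) = Suc n" using dim by (auto simp: n_def)
  have R0: "R > 0" using R by linarith
  have c: "-1 < - a / R" using R R0 by (simp add: field_simps)
  have "half_neg u \<in> sets borel" unfolding half_neg_def by measurable
  then have "emeasure lborel (cball (a *\<^sub>R u) R \<inter> half_neg u)
     = (\<integral>\<^sup>+x. indicator (cball (a *\<^sub>R u) R \<inter> half_neg u) x \<partial>lborel)" by simp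
  also have "\<dots> = (\<integral>\<^sup>+x. indicator {..<0} (x \<bullet> u) * indicator (cball (a *\<^sub>R u) R) x \<partial>lborel)"
    by (intro nn_integral_cong) (auto simp: half_neg_def indicator_def)
  also have "\<dots> = (\<integral>\<^sup>+s. indicator {..<0} s * ennreal (slice_area n a R s) \<partial>lborel)"
    unfolding n_def by (rule nn_integral_cball_slices'[OF dim u R0]) auto
  also have "\<dots> = ennreal R * (\<integral>\<^sup>+t. indicator {..<0} (a + R * t) * ennreal (slice_area n a R (a + R * t)) \<partial>lborel)"
    using R0 by (subst nn_integral_real_affine[of _ R a]) auto
  also have "\<dots> = ennreal R * (\<integral>\<^sup>+t. ennreal (unit_ball_vol n * R ^ n) * (indicator {..<- a / R} t * ennreal (cap_weight n t)) \<partial>lborel)"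
  proof (rule arg_cong[where f = "\<lambda>x. ennreal R * x"], rule nn_integral_cong)
    fix t :: real
    have "a + R * t < 0 \<longleftrightarrow> t < - a / R" using pos_less_divide_eq[OF R0, of t "- a"] by (auto simp: mult.commute)
    then show "indicator {..<0} (a + R * t) * ennreal (slice_area n a R (a + R * t)) = ennreal (unit_ball_vol n * R ^ n) * (indicator {..<- a / R} t * ennreal (cap_weight n t))"
      using R0 by (simp add: slice_area_affine ennreal_mult cap_weight_nonneg indicator_def)
  qed
  also have "\<dots> = ennreal (unit_ball_vol n * R ^ Suc n * cap_vol n (- a / R))"
  proof -
    have [measurable]: "cap_weight n \<in> borel_measurable borel"
      by (intro borel_measurable_continuous_onI continuous_cap_weight)
    have m: "(\<integral>\<^sup>+t. ennreal (unit_ball_vol n * R ^ n) * (indicator {..<- a / R} t * ennreal (cap_weight n t)) \<partial>lborel)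
       = ennreal (unit_ball_vol n * R ^ n) * (\<integral>\<^sup>+t. indicator {..<- a / R} t * ennreal (cap_weight n t) \<partial>lborel)"
      by (rule nn_integral_cmult) measurable
    have "ennreal R * (ennreal (unit_ball_vol n * R ^ n) * ennreal (cap_vol n (- a / R)))
        = ennreal (R * (unit_ball_vol n * R ^ n * cap_vol n (- a / R)))"
      using R0 cap_vol_pos[OF c, of n] by (simp only: ennreal_mult' unit_ball_vol_nonneg
        mult_nonneg_nonneg zero_le_power less_imp_le of_nat_0_le_iff)
    then show ?thesis unfolding m nn_integral_cap_weight[OF n(1) c] by (simp add: mult_ac)
  qed
  finally show ?thesis unfolding n n_def[symmetric] by (simp add: n)
qed

section \<open>A continuously differentiable step function\<close>

definition sq_pos :: "real \<Rightarrow> real"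
  where "sq_pos s = (max 0 s)\<^sup>2"

lemma sq_pos_deriv: "(sq_pos has_real_derivative 2 * max 0 s) (at s)"
proof (cases s "0::real" rule: linorder_cases)
  case less
  have "((\<lambda>_. 0) has_real_derivative 0) (at s)" by simp
  then have "(sq_pos has_real_derivative 0) (at s)"
    by (rule has_field_derivative_transform_within_open[of _ _ _ "{..<0}"])
       (use less in \<open>auto simp: sq_pos_def\<close>)
  then show ?thesis using less by simp
next
  case greater
  have "((\<lambda>s. s\<^sup>2) has_real_derivative 2 * s) (at s)" by (auto intro!: derivative_eq_intros)
  then have "(sq_pos has_real_derivative 2 * s) (at s)"
    by (rule has_field_derivative_transform_within_open[of _ _ _ "{0<..}"])
       (use greater in \<open>auto simp: sq_pos_def\<close>)
  then show ?thesis using greater by simp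
next
  case equal
  have "((\<lambda>h. max 0 h * (max 0 h / h)) \<longlongrightarrow> 0) (at (0::real))"
  proof (rule Lim_null_comparison[where g = "\<lambda>h. \<bar>h\<bar>"])
    show "\<forall>\<^sub>F h in at (0::real). norm (max 0 h * (max 0 h / h)) \<le> \<bar>h\<bar>"
      by (intro always_eventually) (auto simp: max_def)
    show "((\<lambda>h::real. \<bar>h\<bar>) \<longlongrightarrow> 0) (at 0)" by (intro tendsto_rabs_zero tendsto_ident_at)
  qed
  then show ?thesis using equal by (simp add: DERIV_def sq_pos_def power2_eq_square)
qed

text \<open>Transition from 0 on s \<le> 0 to 1 on s \<ge> 1. Squares of positive parts suffice
  because test fields are only required to be continuously differentiable; the denominator is
  positive since s and 1 - s are never both nonpositive.\<close>

definition step :: "real \<Rightarrow> real"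
  where "step s = sq_pos s / (sq_pos s + sq_pos (1 - s))"

definition step' :: "real \<Rightarrow> real"
  where "step' s = (2 * max 0 s * sq_pos (1 - s) + sq_pos s * (2 * max 0 (1 - s))) / (sq_pos s + sq_pos (1 - s))\<^sup>2"

lemma sq_pos_sum_pos: "0 < sq_pos s + sq_pos (1 - s)"
  by (cases "s > 0") (auto simp: sq_pos_def max_def intro: add_pos_nonneg)

lemma step_deriv: "(step has_real_derivative step' s) (at s)"
proof -
  have 1: "((\<lambda>s. sq_pos (1 - s)) has_real_derivative - (2 * max 0 (1 - s))) (at s)"
  proof -
    have "((\<lambda>s. 1 - s) has_real_derivative - 1) (at s)" by (auto intro!: derivative_eq_intros)
    from DERIV_chain2[OF sq_pos_deriv this] show ?thesis by simp
  qed
  have "(step has_real_derivative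
      (2 * max 0 s * (sq_pos s + sq_pos (1 - s)) - sq_pos s * (2 * max 0 s + - (2 * max 0 (1 - s))))
       / ((sq_pos s + sq_pos (1 - s)) * (sq_pos s + sq_pos (1 - s)))) (at s)"
    unfolding step_def[abs_def] using sq_pos_sum_pos[of s]
    by (intro DERIV_divide DERIV_add sq_pos_deriv 1) auto
  then show ?thesis by (simp add: step'_def power2_eq_square algebra_simps)
qed

lemma continuous_sq_pos: "continuous_on A sq_pos"
  unfolding sq_pos_def by (intro continuous_intros)

lemma continuous_step': "continuous_on UNIV step'"
  unfolding step'_def using sq_pos_sum_pos
  by (intro continuous_intros continuous_on_compose2[OF continuous_sq_pos[of UNIV]])
     (auto simp: less_imp_neq[OF sq_pos_sum_pos, symmetric])

lemma step_measurable [measurable]: "step \<in> borel_measurable borel" "step' \<in> borel_measurable borel"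
  by (intro borel_measurable_continuous_onI continuous_step' DERIV_continuous_on[OF DERIV_subset[OF step_deriv]] subset_UNIV)+

lemma step_eq_0: "s \<le> 0 \<Longrightarrow> step s = 0" and step_eq_1: "1 \<le> s \<Longrightarrow> step s = 1"
  by (auto simp: step_def sq_pos_def)

lemma step_bounds: "0 \<le> step s" "step s \<le> 1"
  using sq_pos_sum_pos[of s] by (auto simp: step_def sq_pos_def)

lemma step'_nonneg: "0 \<le> step' s"
  by (auto simp: step'_def sq_pos_def intro!: divide_nonneg_nonneg add_nonneg_nonneg mult_nonneg_nonneg)

lemma step'_eq_0: "s \<le> 0 \<or> 1 \<le> s \<Longrightarrow> step' s = 0"
  by (auto simp: step'_def sq_pos_def)

text \<open>Being nonnegative, of mass 1 and supported in [0,1], \<open>step'\<close> can be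
  rescaled to an approximate delta at the hyperplane.\<close>

lemma has_bochner_integral_step': "has_bochner_integral lborel step' 1"
proof -
  have "has_bochner_integral lborel (\<lambda>x. step' x * indicator {0..1} x) (step 1 - step 0)"
    by (rule has_bochner_integral_FTC_Icc_real)
       (auto intro: step_deriv continuous_at_imp_continuous_on continuous_on_interior continuous_on_eq_continuous_at[THEN iffD1, OF open_UNIV continuous_step', rule_format])
  moreover have "step' x * indicator {0..1} x = step' x" for x
    using step'_eq_0[of x] by (cases "x \<le> 0 \<or> 1 \<le> x") (auto simp: indicator_def)
  ultimately show ?thesis by (simp add: step_eq_0 step_eq_1)
qed

section \<open>Test fields and integration by parts\<close>

lemma has_bochner_integral_directional_derivative:
  fixes g :: "'a::euclidean_space \<Rightarrow> real"
  assumes lip: "L-lipschitz_on UNIV g" and bdd: "bounded {x. g x \<noteq> 0}"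
    and der: "AE x in lborel. (g has_derivative g' x) (at x)"
    and meas [measurable]: "(\<lambda>x. g' x b) \<in> borel_measurable lborel"
  shows "has_bochner_integral lborel (\<lambda>x. g' x b) 0"
proof -
  have cont: "continuous_on UNIV g" using lip by (rule lipschitz_on_continuous_on)
  then have [measurable]: "g \<in> borel_measurable borel" by (rule borel_measurable_continuous_onI)
  obtain B where B: "\<And>x. g x \<noteq> 0 \<Longrightarrow> norm x \<le> B" using bdd unfolding bounded_iff by auto
  have "integrable lborel (\<lambda>x. indicator (cball 0 B) x *\<^sub>R g x)"
    by (intro borel_integrable_compact compact_cball continuous_on_subset[OF cont]) auto
  moreover have "indicator (cball 0 B) x *\<^sub>R g x = g x" for x
    using B[of x] by (auto simp: indicator_def)
  ultimately have int: "integrable lborel g" by (simp only:)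
  have int_shift: "integrable lborel (\<lambda>x. g (x + t))" "(\<integral>x. g (x + t) \<partial>lborel) = integral\<^sup>L lborel g" for t
  proof -
    have "integrable (distr lborel borel ((+) t)) g" "integral\<^sup>L (distr lborel borel ((+) t)) g = integral\<^sup>L lborel g"
      unfolding lborel_distr_plus using int by auto
    then show "integrable lborel (\<lambda>x. g (x + t))" "(\<integral>x. g (x + t) \<partial>lborel) = integral\<^sup>L lborel g"
      by (simp_all add: integrable_distr_eq integral_distr add.commute)
  qed
  define h where "h k = 1 / real (Suc k)" for k
  have h: "h k > 0" "h k \<le> 1" for k by (auto simp: h_def)
  define q where "q k x = (g (x + h k *\<^sub>R b) - g x) / h k" for k x
  have q_meas [measurable]: "q k \<in> borel_measurable lborel" for k
    unfolding q_def by measurable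
  have q_int: "integral\<^sup>L lborel (q k) = 0" for k
    unfolding q_def using int int_shift by simp
  \<comment> \<open>Since h k \<le> 1, the shifts have length at most norm b, so every difference
    quotient vanishes outside the ball of radius B + norm b.\<close>
  let ?w = "\<lambda>x. (L * norm b) * indicator (cball 0 (B + norm b)) x :: real"
  have w: "integrable lborel ?w" by (intro integrable_mult_right integrable_real_indicator emeasure_bounded_finite bounded_cball) simp
  have lim: "AE x in lborel. (\<lambda>k. q k x) \<longlonglongrightarrow> g' x b" using der
  proof eventually_elim
    case (elim x)
    have "((\<lambda>t. x + t *\<^sub>R b) has_derivative (\<lambda>t. t *\<^sub>R b)) (at 0)"
      by (auto intro!: derivative_eq_intros)
    from diff_chain_at[OF this, of g "g' x"] elim
    have "((\<lambda>t. g (x + t *\<^sub>R b)) has_derivative (\<lambda>t. g' x (t *\<^sub>R b))) (at 0)" by (simp add: o_def)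
    moreover have "g' x (t *\<^sub>R b) = t * g' x b" for t
      using linear_scale[OF has_derivative_linear[OF elim]] by simp
    ultimately have "((\<lambda>t. g (x + t *\<^sub>R b)) has_real_derivative g' x b) (at 0)"
      by (simp add: has_field_derivative_def mult_commute_abs)
    then have "((\<lambda>t. (g (x + t *\<^sub>R b) - g x) / t) \<longlongrightarrow> g' x b) (at 0)" by (simp add: DERIV_def)
    moreover have "filterlim h (at 0) sequentially"
      using h LIMSEQ_inverse_real_of_nat
      by (auto simp: filterlim_at h_def[abs_def] inverse_eq_divide intro!: always_eventually)
    ultimately show ?case unfolding q_def by (rule filterlim_compose)
  qed
  have bound: "norm (q k x) \<le> ?w x" for k x
  proof (cases "x \<in> cball 0 (B + norm b)")
    case True
    have "norm (g (x + h k *\<^sub>R b) - g x) \<le> L * norm (h k *\<^sub>R b)"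
      using lipschitz_on_normD[OF lip, of "x + h k *\<^sub>R b" x] by simp
    then have "\<bar>g (x + h k *\<^sub>R b) - g x\<bar> \<le> (L * norm b) * h k" using h[of k] by (simp add: mult_ac)
    then show ?thesis using True h[of k] by (simp add: q_def pos_divide_le_eq)
  next
    case False
    then have x: "norm x > B + norm b" by simp
    have "norm (h k *\<^sub>R b) \<le> norm b" using h[of k] by (simp add: mult_left_le_one_le)
    then have "norm (x + h k *\<^sub>R b) > B" using x norm_triangle_ineq4[of "x + h k *\<^sub>R b" "h k *\<^sub>R b"] by simp
    then have "g (x + h k *\<^sub>R b) = 0" using B by force
    moreover have "g x = 0" using B[of x] x norm_ge_zero[of b] by linarith
    ultimately show ?thesis using False by (simp add: q_def)
  qed
  have "integrable lborel (\<lambda>x. g' x b)"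
    by (rule integrable_dominated_convergence[OF meas q_meas w lim]) (use bound in auto)
  moreover have "(\<lambda>k. integral\<^sup>L lborel (q k)) \<longlonglongrightarrow> (\<integral>x. g' x b \<partial>lborel)"
    by (rule integral_dominated_convergence[OF meas q_meas w lim]) (use bound in auto)
  then have "(\<integral>x. g' x b \<partial>lborel) = 0" unfolding q_int by (simp add: LIMSEQ_const_iff)
  ultimately show ?thesis by (simp add: has_bochner_integral_iff)
qed

lemma test_field_has_derivative:
  "test_field A T \<Longrightarrow> (T has_derivative frechet_derivative T (at x)) (at x)"
  by (simp add: test_field_def frechet_derivative_works)

lemma test_field_continuous: "test_field A T \<Longrightarrow> continuous_on UNIV T"
  by (intro continuous_at_imp_continuous_on ballI) (rule has_derivative_continuous[OF test_field_has_derivative])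

lemma test_field_outside:
  assumes "test_field A T" "x \<notin> A" shows "T x = 0" "frechet_derivative T (at x) = (\<lambda>v. 0)"
proof -
  have x: "x \<in> - closure {x. T x \<noteq> 0}" using assms unfolding test_field_def by blast
  have out: "T y = 0" if "y \<in> - closure {x. T x \<noteq> 0}" for y
    using that subsetD[OF closure_subset, of y "{x. T x \<noteq> 0}"] by blast
  show "T x = 0" by (rule out[OF x])
  have "((\<lambda>x. 0) has_derivative (\<lambda>v. 0)) (at x)" by simp
  then have "(T has_derivative (\<lambda>v. 0)) (at x)"
    by (rule has_derivative_transform_within_open[OF _ open_Compl[OF closed_closure] x])
       (rule out[symmetric])
  then show "frechet_derivative T (at x) = (\<lambda>v. 0)"
    by (rule frechet_derivative_at[symmetric])
qed

lemma divergence_outside: "test_field A T \<Longrightarrow> x \<notin> A \<Longrightarrow> divergence T x = 0"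
  by (simp add: divergence_def test_field_outside)

lemma test_field_support: "test_field A T \<Longrightarrow> test_field (closure {x. T x \<noteq> 0}) T"
  by (auto simp: test_field_def)

lemma continuous_divergence: "test_field A T \<Longrightarrow> continuous_on UNIV (divergence T)"
  unfolding divergence_def by (intro continuous_intros) (auto simp: test_field_def)

lemma divergence_measurable:
  "test_field A T \<Longrightarrow> divergence T \<in> borel_measurable borel"
  by (intro borel_measurable_continuous_onI continuous_divergence)

lemma integrable_divergence:
  assumes T: "test_field A T" and [measurable]: "E \<in> sets borel"
  shows "integrable lborel (\<lambda>x. indicator E x * divergence T x)"
proof -
  let ?S = "closure {x. T x \<noteq> 0}"
  note [measurable] = divergence_measurable[OF T]
  have "integrable lborel (\<lambda>x. indicator ?S x *\<^sub>R divergence T x)"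
    using T continuous_divergence[OF T]
    by (intro borel_integrable_compact) (auto simp: test_field_def intro: continuous_on_subset)
  then show ?thesis
    by (rule Bochner_Integration.integrable_bound)
       (use divergence_outside[OF test_field_support[OF T]] in \<open>auto simp: indicator_def\<close>)
qed

text \<open>The derivative is continuous and vanishes off a compact set, hence is bounded. The
  operator norm is controlled by the sum F of the norms on basis vectors, whose continuity is
  immediate.\<close>

lemma test_field_lipschitz:
  fixes T :: "'a::euclidean_space \<Rightarrow> 'a"
  assumes T: "test_field A T"
  obtains L where "L-lipschitz_on UNIV T"
proof -
  let ?S = "closure {x. T x \<noteq> 0}" and ?D = "\<lambda>x. frechet_derivative T (at x)"
  define F where "F x = (\<Sum>b\<in>Basis. norm (?D x b))" for x
  have "continuous_on UNIV F" unfolding F_def using T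
    by (intro continuous_intros) (auto simp: test_field_def)
  then have "bounded (F ` ?S)"
    using T by (intro compact_imp_bounded compact_continuous_image) (auto simp: test_field_def intro: continuous_on_subset)
  then obtain M where M: "\<And>x. x \<in> ?S \<Longrightarrow> F x \<le> M" unfolding bounded_iff by (auto dest: abs_le_D1)
  have FM: "F x \<le> max M 0" for x
    using M[of x] test_field_outside(2)[OF test_field_support[OF T], of x] by (cases "x \<in> ?S") (auto simp: F_def)
  have on: "onorm (?D x) \<le> max M 0" for x
  proof (rule onorm_le)
    fix v
    have lin: "linear (?D x)" using test_field_has_derivative[OF T] has_derivative_linear by blast
    have "?D x (\<Sum>b\<in>Basis. (v \<bullet> b) *\<^sub>R b) = (\<Sum>b\<in>Basis. (v \<bullet> b) *\<^sub>R ?D x b)"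
      by (simp only: linear_sum[OF lin] linear_scale[OF lin])
    then have "?D x v = (\<Sum>b\<in>Basis. (v \<bullet> b) *\<^sub>R ?D x b)" by (simp only: euclidean_representation)
    also have "norm \<dots> \<le> (\<Sum>b\<in>Basis. norm v * norm (?D x b))"
      by (intro norm_sum[THEN order_trans] sum_mono) (auto intro!: mult_right_mono Basis_le_norm)
    also have "\<dots> = F x * norm v" by (simp add: F_def sum_distrib_left mult.commute[of _ "norm v"])
    also have "\<dots> \<le> max M 0 * norm v" using FM by (intro mult_right_mono) auto
    finally show "norm (?D x v) \<le> max M 0 * norm v" .
  qed
  have "(max M 0)-lipschitz_on UNIV T"
  proof (rule lipschitz_onI)
    fix x y show "dist (T x) (T y) \<le> max M 0 * dist x y"
      using differentiable_bound[OF convex_UNIV test_field_has_derivative[OF T] on] by (simp add: dist_norm)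
  qed auto
  then show ?thesis by (rule that)
qed

text \<open>Each product of \<psi> with a component of T is Lipschitz with bounded support, so its
  partial derivative integrates to 0; summing over the basis gives div (\<psi> T).\<close>

lemma test_field_integration_by_parts:
  fixes T :: "'a::euclidean_space \<Rightarrow> 'a"
  assumes T: "test_field A T" and \<psi>: "M-lipschitz_on UNIV \<psi>" "\<And>x. \<bar>\<psi> x\<bar> \<le> 1"
    and der: "AE x in lborel. (\<psi> has_derivative \<psi>' x) (at x)"
    and meas [measurable]: "\<And>v. (\<lambda>x. \<psi>' x v) \<in> borel_measurable lborel"
  shows "has_bochner_integral lborel (\<lambda>x. \<psi> x * divergence T x + (\<Sum>b\<in>Basis. \<psi>' x b * (T x \<bullet> b))) 0"
proof -
  let ?D = "\<lambda>x. frechet_derivative T (at x)"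
  have bound: "norm (T x) \<le> 1" for x using T by (simp add: test_field_def)
  have "compact (closure {x. T x \<noteq> 0})" using T by (simp add: test_field_def)
  then have bdd: "bounded (closure {x. T x \<noteq> 0})" by (rule compact_imp_bounded)
  obtain L where L: "L-lipschitz_on UNIV T" using test_field_lipschitz[OF T] by blast
  have [measurable]: "T \<in> borel_measurable borel" "\<psi> \<in> borel_measurable borel" "(\<lambda>x. ?D x v) \<in> borel_measurable borel" for v
    using test_field_continuous[OF T] lipschitz_on_continuous_on[OF \<psi>(1)] T
    by (auto intro: borel_measurable_continuous_onI simp: test_field_def)
  have "has_bochner_integral lborel (\<lambda>x. \<psi> x * (?D x b \<bullet> b) + \<psi>' x b * (T x \<bullet> b)) 0" if b: "b \<in> Basis" for b
  proof (rule has_bochner_integral_directional_derivative[where g = "\<lambda>x. \<psi> x * (T x \<bullet> b)" and L = "L + M"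
       and g' = "\<lambda>x v. \<psi> x * (?D x v \<bullet> b) + \<psi>' x v * (T x \<bullet> b)"])
    show "(L + M)-lipschitz_on UNIV (\<lambda>x. \<psi> x * (T x \<bullet> b))"
    proof (rule lipschitz_onI)
      fix x y
      have Tb: "\<bar>(T x - T y) \<bullet> b\<bar> \<le> L * norm (x - y)"
        using lipschitz_on_normD[OF L, of x y] Basis_le_norm[OF b, of "T x - T y"] by simp
      have T1: "\<bar>T y \<bullet> b\<bar> \<le> 1" using Basis_le_norm[OF b, of "T y"] bound[of y] by linarith
      have "\<psi> x * (T x \<bullet> b) - \<psi> y * (T y \<bullet> b) = \<psi> x * ((T x - T y) \<bullet> b) + (\<psi> x - \<psi> y) * (T y \<bullet> b)"
        by (simp add: inner_diff_left algebra_simps)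
      also have "\<bar>\<dots>\<bar> \<le> \<bar>\<psi> x\<bar> * \<bar>(T x - T y) \<bullet> b\<bar> + \<bar>\<psi> x - \<psi> y\<bar> * \<bar>T y \<bullet> b\<bar>"
        by (metis abs_mult abs_triangle_ineq)
      also have "\<dots> \<le> 1 * (L * norm (x - y)) + (M * norm (x - y)) * 1"
        using \<psi>(2)[of x] Tb T1 lipschitz_on_normD[OF \<psi>(1), of x y] by (intro add_mono mult_mono) auto
      finally show "dist (\<psi> x * (T x \<bullet> b)) (\<psi> y * (T y \<bullet> b)) \<le> (L + M) * dist x y"
        by (simp add: dist_norm algebra_simps)
    qed (use lipschitz_on_nonneg[OF L] lipschitz_on_nonneg[OF \<psi>(1)] in auto)
    have "{x. \<psi> x * (T x \<bullet> b) \<noteq> 0} \<subseteq> closure {x. T x \<noteq> 0}" by (auto intro: subsetD[OF closure_subset])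
    then show "bounded {x. \<psi> x * (T x \<bullet> b) \<noteq> 0}"
      by (rule bounded_subset[OF bdd])
    show "AE x in lborel. ((\<lambda>x. \<psi> x * (T x \<bullet> b)) has_derivative (\<lambda>v. \<psi> x * (?D x v \<bullet> b) + \<psi>' x v * (T x \<bullet> b))) (at x)"
      using der
    proof eventually_elim
      case (elim x)
      show ?case using has_derivative_mult[OF elim has_derivative_inner_left[OF test_field_has_derivative[OF T]]] .
    qed
  qed measurable
  then have "has_bochner_integral lborel (\<lambda>x. \<Sum>b\<in>Basis. \<psi> x * (?D x b \<bullet> b) + \<psi>' x b * (T x \<bullet> b)) (\<Sum>b\<in>(Basis::'a set). 0)"
    by (rule has_bochner_integral_sum)
  then show ?thesis by (simp add: divergence_def sum.distrib sum_distrib_left)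
qed

text \<open>The divergence vanishes off A, so only the trace of the set on A matters. This allows
  passing to a Borel set and to \<open>lborel\<close>.\<close>

lemma set_integral_divergence:
  assumes T: "test_field A T" and E: "E \<in> sets lebesgue" "F \<in> sets borel" "E \<inter> A = F \<inter> A"
  shows "(LINT x:E|lebesgue. divergence T x) = (\<integral>x. indicator F x * divergence T x \<partial>lborel)"
proof -
  note [measurable] = divergence_measurable[OF T] E(2)
  have "indicator E x *\<^sub>R divergence T x = indicator F x * divergence T x" for x
    using E(3) divergence_outside[OF T, of x] by (cases "x \<in> A") (auto simp: indicator_def)
  then have "(LINT x:E|lebesgue. divergence T x) = (\<integral>x. indicator F x * divergence T x \<partial>lebesgue)"
    unfolding set_lebesgue_integral_def by (simp only:)
  then show ?thesis by (simp add: integral_completion)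
qed

section \<open>Perimeter of a cap: upper bound\<close>

text \<open>Affine in the distance, so that the gradient has norm exactly 1/\<epsilon> on the shell;
  the price is a pair of kinks on two spheres, which are null sets.\<close>

definition radial_cutoff :: "'a::euclidean_space \<Rightarrow> real \<Rightarrow> real \<Rightarrow> 'a \<Rightarrow> real"
  where "radial_cutoff c R \<epsilon> x = max 0 (min 1 (1 - (dist x c - R) / \<epsilon>))"

definition radial_cutoff' :: "'a::euclidean_space \<Rightarrow> real \<Rightarrow> real \<Rightarrow> 'a \<Rightarrow> 'a \<Rightarrow> real"
  where "radial_cutoff' c R \<epsilon> x v = indicator {x. R < dist x c \<and> dist x c < R + \<epsilon>} x * (- (v \<bullet> sgn (x - c)) / \<epsilon>)"

lemma radial_cutoff_lipschitz:
  assumes "\<epsilon> > 0" shows "(1 / \<epsilon>)-lipschitz_on UNIV (radial_cutoff c R \<epsilon>)"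
proof (rule lipschitz_onI)
  fix x y :: 'a
  have clamp: "\<bar>max 0 (min 1 a) - max 0 (min 1 b)\<bar> \<le> \<bar>a - b\<bar>" for a b :: real by (auto simp: max_def min_def)
  have "dist (radial_cutoff c R \<epsilon> x) (radial_cutoff c R \<epsilon> y) \<le> \<bar>(dist y c - dist x c) / \<epsilon>\<bar>"
    unfolding radial_cutoff_def dist_real_def
    by (rule order_trans[OF clamp]) (simp add: diff_divide_distrib abs_minus_commute)
  also have "\<dots> = \<bar>dist y c - dist x c\<bar> / \<epsilon>" using assms by simp
  also have "\<dots> \<le> dist x y / \<epsilon>"
    using assms abs_dist_diff_le[of y c x] by (intro divide_right_mono) (auto simp: dist_commute)
  finally show "dist (radial_cutoff c R \<epsilon> x) (radial_cutoff c R \<epsilon> y) \<le> 1 / \<epsilon> * dist x y" by simp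
qed (use assms in auto)

lemma radial_cutoff_bound: "\<bar>radial_cutoff c R \<epsilon> x\<bar> \<le> 1"
  by (auto simp: radial_cutoff_def max_def min_def)

lemma radial_cutoff_deriv:
  assumes "0 < R" "0 < \<epsilon>" "dist x c \<noteq> R" "dist x c \<noteq> R + \<epsilon>"
  shows "(radial_cutoff c R \<epsilon> has_derivative radial_cutoff' c R \<epsilon> x) (at x)"
proof -
  consider "dist x c < R" | "R < dist x c" "dist x c < R + \<epsilon>" | "R + \<epsilon> < dist x c" using assms by linarith
  then show ?thesis
  proof cases
    case 1
    have "((\<lambda>_. 1) has_derivative (\<lambda>_. 0)) (at x)" by simp
    then have "(radial_cutoff c R \<epsilon> has_derivative (\<lambda>_. 0)) (at x)"
      by (rule has_derivative_transform_within_open[where s = "{x. dist x c < R}"])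
         (use 1 assms in \<open>auto simp: radial_cutoff_def divide_nonpos_pos intro!: open_Collect_less continuous_intros\<close>)
    then show ?thesis using 1 by (simp add: radial_cutoff'_def[abs_def])
  next
    case 2
    then have "x \<noteq> c" using assms by auto
    have "((\<lambda>x. x - c) has_derivative (\<lambda>v. v)) (at x)" by (auto intro!: derivative_eq_intros)
    from has_derivative_compose[OF this has_derivative_norm] \<open>x \<noteq> c\<close>
    have n: "((\<lambda>x. norm (x - c)) has_derivative (\<lambda>v. v \<bullet> sgn (x - c))) (at x)" by simp
    have "((\<lambda>x. 1 - (norm (x - c) - R) / \<epsilon>) has_derivative (\<lambda>v. - (v \<bullet> sgn (x - c)) / \<epsilon>)) (at x)"
      using assms by (auto intro!: derivative_eq_intros n)
    then have "(radial_cutoff c R \<epsilon> has_derivative (\<lambda>v. - (v \<bullet> sgn (x - c)) / \<epsilon>)) (at x)"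
      by (rule has_derivative_transform_within_open[where s = "{x. R < dist x c} \<inter> {x. dist x c < R + \<epsilon>}"])
         (use 2 assms in \<open>auto simp: radial_cutoff_def dist_norm max_def min_def field_simps intro!: open_Int open_Collect_less continuous_intros\<close>)
    then show ?thesis using 2 by (simp add: radial_cutoff'_def[abs_def])
  next
    case 3
    have "((\<lambda>_. 0) has_derivative (\<lambda>_. 0)) (at x)" by simp
    then have "(radial_cutoff c R \<epsilon> has_derivative (\<lambda>_. 0)) (at x)"
      by (rule has_derivative_transform_within_open[where s = "{x. R + \<epsilon> < dist x c}"])
         (use 3 assms in \<open>auto simp: radial_cutoff_def max_def min_def field_simps intro!: open_Collect_less continuous_intros\<close>)
    then show ?thesis using 3 by (simp add: radial_cutoff'_def[abs_def])
  qed
qed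

lemma sphere_null_set: "sphere (c::'a::euclidean_space) r \<in> null_sets lborel"
  using negligible_sphere[of c r] by (simp add: negligible_iff_null_sets null_sets_completion_iff)

text \<open>Integration by parts moves the derivative to the cut-off. Its gradient has norm
  1/\<epsilon> on the shell, while T has norm at most 1 and vanishes off A, so what remains is at
  most the volume of the shell within A divided by \<epsilon>.\<close>

lemma integral_cutoff_divergence_le:
  fixes T :: "'a::euclidean_space \<Rightarrow> 'a"
  assumes T: "test_field A T" and [measurable]: "A \<in> sets borel" and R: "0 < R" "0 < \<epsilon>"
  shows "(\<integral>x. radial_cutoff c R \<epsilon> x * divergence T x \<partial>lborel)
    \<le> (measure lborel (cball c (R + \<epsilon>) \<inter> A) - measure lborel (cball c R \<inter> A)) / \<epsilon>"
proof -
  let ?S = "{x. R < dist x c \<and> dist x c < R + \<epsilon>}"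
  have [measurable]: "divergence T \<in> borel_measurable borel" "T \<in> borel_measurable borel" "radial_cutoff c R \<epsilon> \<in> borel_measurable borel"
    using test_field_continuous[OF T] lipschitz_on_continuous_on[OF radial_cutoff_lipschitz[OF R(2), of c R]] divergence_measurable[OF T]
    by (auto intro: borel_measurable_continuous_onI)
  have S [measurable]: "?S \<in> sets borel" by measurable
  have m [measurable]: "(\<lambda>x. radial_cutoff' c R \<epsilon> x v) \<in> borel_measurable lborel" for v
    unfolding radial_cutoff'_def sgn_div_norm by measurable
  have ae: "AE x in lborel. (radial_cutoff c R \<epsilon> has_derivative radial_cutoff' c R \<epsilon> x) (at x)"
    using AE_not_in[OF sphere_null_set[of c R]] AE_not_in[OF sphere_null_set[of c "R + \<epsilon>"]]
    by eventually_elim (use R in \<open>auto intro!: radial_cutoff_deriv simp: dist_commute\<close>)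
  \<comment> \<open>F is the inner product of T with the gradient of the cut-off.\<close>
  define F where "F x = (\<Sum>b\<in>Basis. radial_cutoff' c R \<epsilon> x b * (T x \<bullet> b))" for x
  have F: "F x = indicator ?S x * (- (T x \<bullet> sgn (x - c)) / \<epsilon>)" for x
  proof -
    have "F x = (\<Sum>b\<in>Basis. (indicator ?S x * (- 1 / \<epsilon>)) * ((T x \<bullet> b) * (sgn (x - c) \<bullet> b)))"
      unfolding F_def radial_cutoff'_def by (intro sum.cong) (auto simp: inner_commute)
    also have "\<dots> = indicator ?S x * (- (T x \<bullet> sgn (x - c)) / \<epsilon>)"
      unfolding sum_distrib_left[symmetric] euclidean_inner[of "T x" "sgn (x - c)", symmetric] by simp
    finally show ?thesis .
  qed
  have *: "has_bochner_integral lborel (\<lambda>x. radial_cutoff c R \<epsilon> x * divergence T x + F x) 0"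
    unfolding F_def
    by (rule test_field_integration_by_parts[OF T radial_cutoff_lipschitz[OF R(2)] radial_cutoff_bound ae m])
  have int1: "integrable lborel (\<lambda>x. radial_cutoff c R \<epsilon> x * divergence T x)"
  proof (rule Bochner_Integration.integrable_bound[OF integrable_divergence[OF T, of UNIV]])
    show "AE x in lborel. norm (radial_cutoff c R \<epsilon> x * divergence T x) \<le> norm (indicator UNIV x * divergence T x)"
      using radial_cutoff_bound[of c R \<epsilon>] by (auto simp: abs_mult intro!: AE_I2 mult_left_le_one_le)
  qed auto
  have int2: "integrable lborel F"
    using Bochner_Integration.integrable_diff[OF _ int1, of "\<lambda>x. radial_cutoff c R \<epsilon> x * divergence T x + F x"] *
    by (simp add: has_bochner_integral_iff)
  have "(\<integral>x. radial_cutoff c R \<epsilon> x * divergence T x \<partial>lborel) = (\<integral>x. - F x \<partial>lborel)"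
    using * int1 int2 by (simp add: has_bochner_integral_iff)
  also have "\<dots> \<le> (\<integral>x. indicator (?S \<inter> A) x / \<epsilon> \<partial>lborel)"
  proof (rule integral_mono)
    have "bounded (?S \<inter> A)" by (rule bounded_subset[OF bounded_cball[of c "R + \<epsilon>"]]) (auto simp: dist_commute)
    then have "emeasure lborel (?S \<inter> A) < \<infinity>" by (rule emeasure_bounded_finite)
    then show "integrable lborel (\<lambda>x. indicator (?S \<inter> A) x / \<epsilon> :: real)"
      by (intro integrable_divide integrable_real_indicator) auto
    show "- F x \<le> indicator (?S \<inter> A) x / \<epsilon>" for x
    proof (cases "x \<in> A")
      case True
      have "T x \<bullet> sgn (x - c) \<le> norm (T x) * norm (sgn (x - c))" by (rule norm_cauchy_schwarz)
      also have "\<dots> \<le> 1 * 1" using T by (intro mult_mono) (auto simp: test_field_def norm_sgn)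
      finally show ?thesis using True R by (auto simp: F indicator_def divide_right_mono)
    qed (simp add: F test_field_outside[OF T])
  qed (use int2 in auto)
  also have "\<dots> = measure lborel (?S \<inter> A) / \<epsilon>" by simp
  also have "\<dots> \<le> (measure lborel (cball c (R + \<epsilon>) \<inter> A) - measure lborel (cball c R \<inter> A)) / \<epsilon>"
  proof (rule divide_right_mono)
    have fin: "E \<inter> A \<in> fmeasurable lborel" if "E \<in> sets borel" "bounded E" for E
      using that by (intro fmeasurableI emeasure_bounded_finite) (auto intro: bounded_subset)
    have b: "bounded ?S" by (rule bounded_subset[OF bounded_cball[of c "R + \<epsilon>"]]) (auto simp: dist_commute)
    have "measure lborel (?S \<inter> A) + measure lborel (cball c R \<inter> A) = measure lborel ((?S \<inter> A) \<union> (cball c R \<inter> A))"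
    proof -
      have "(?S \<inter> A) \<inter> (cball c R \<inter> A) = {}" by (auto simp: dist_commute)
      then show ?thesis using measure_Un3[OF fin[OF S b] fin[of "cball c R"]] by simp
    qed
    also have "\<dots> \<le> measure lborel (cball c (R + \<epsilon>) \<inter> A)"
      using fin[of "cball c (R + \<epsilon>)"] R by (intro measure_mono_fmeasurable) (auto simp: dist_commute)
    finally show "measure lborel (?S \<inter> A) \<le> measure lborel (cball c (R + \<epsilon>) \<inter> A) - measure lborel (cball c R \<inter> A)" by simp
  qed (use R in simp)
  finally show ?thesis .
qed

text \<open>Shrinking the shell turns the cut-off into the indicator of the ball, and the volume
  quotient into the derivative of the volume in the radius.\<close>

lemma integral_cball_divergence_le:
  fixes T :: "'a::euclidean_space \<Rightarrow> 'a"
  assumes T: "test_field A T" and A: "A \<in> sets borel" and R: "0 < R"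
    and der: "((\<lambda>\<rho>. measure lborel (cball c \<rho> \<inter> A)) has_real_derivative D) (at R)"
  shows "(\<integral>x. indicator (cball c R) x * divergence T x \<partial>lborel) \<le> D"
proof -
  define h where "h k = 1 / real (Suc k)" for k
  have h: "h k > 0" for k by (auto simp: h_def)
  have h0: "h \<longlonglongrightarrow> 0" unfolding h_def by (rule LIMSEQ_Suc[OF lim_1_over_n])
  have [measurable]: "divergence T \<in> borel_measurable borel" "cball c R \<in> sets borel"
    using divergence_measurable[OF T] by auto
  have [measurable]: "radial_cutoff c R (h k) \<in> borel_measurable borel" for k
    using lipschitz_on_continuous_on[OF radial_cutoff_lipschitz[OF h]] by (rule borel_measurable_continuous_onI)
  have "(\<lambda>k. \<integral>x. radial_cutoff c R (h k) x * divergence T x \<partial>lborel) \<longlonglongrightarrow> (\<integral>x. indicator (cball c R) x * divergence T x \<partial>lborel)"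
  proof (rule integral_dominated_convergence[where w = "\<lambda>x. \<bar>indicator UNIV x * divergence T x\<bar>"])
    show "AE x in lborel. (\<lambda>k. radial_cutoff c R (h k) x * divergence T x) \<longlonglongrightarrow> indicator (cball c R) x * divergence T x"
    proof (intro AE_I2 tendsto_mult tendsto_const)
      fix x
      have "\<forall>\<^sub>F k in sequentially. radial_cutoff c R (h k) x = indicator (cball c R) x"
      proof (cases "dist x c \<le> R")
        case True
        then show ?thesis using h by (auto simp: radial_cutoff_def dist_commute divide_nonpos_pos intro!: always_eventually)
      next
        case False
        have "\<forall>\<^sub>F k in sequentially. h k < dist x c - R" using order_tendstoD(2)[OF h0] False by simp
        then show ?thesis
        proof eventually_elim
          case (elim k)
          then have "1 \<le> (dist x c - R) / h k" using h[of k] by simp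
          then show ?case using False by (simp add: radial_cutoff_def dist_commute)
        qed
      qed
      then show "(\<lambda>k. radial_cutoff c R (h k) x) \<longlonglongrightarrow> indicator (cball c R) x" by (rule tendsto_eventually)
    qed
    show "integrable lborel (\<lambda>x. \<bar>indicator UNIV x * divergence T x\<bar>)"
      using integrable_divergence[OF T, of UNIV] by (intro integrable_abs) auto
    show "AE x in lborel. norm (radial_cutoff c R (h k) x * divergence T x) \<le> \<bar>indicator UNIV x * divergence T x\<bar>" for k
      using radial_cutoff_bound[of c R "h k"] by (auto simp: abs_mult intro!: AE_I2 mult_left_le_one_le)
  qed auto
  moreover have "(\<lambda>k. (measure lborel (cball c (R + h k) \<inter> A) - measure lborel (cball c R \<inter> A)) / h k) \<longlonglongrightarrow> D"
  proof -
    have 1: "((\<lambda>t. (measure lborel (cball c (R + t) \<inter> A) - measure lborel (cball c R \<inter> A)) / t) \<longlongrightarrow> D) (at 0)"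
      using der by (simp add: DERIV_def)
    have "filterlim h (at 0) sequentially"
      using h h0 by (auto simp: filterlim_at less_imp_neq[symmetric] intro!: always_eventually)
    from filterlim_compose[OF 1 this] show ?thesis .
  qed
  ultimately show ?thesis
    by (rule LIMSEQ_le) (use integral_cutoff_divergence_le[OF T A R h] in auto)
qed

lemma perimeter_le_derivative:
  fixes E :: "'a::euclidean_space set"
  assumes E: "E \<in> sets lebesgue" "E \<inter> A = cball c R \<inter> A" and A: "A \<in> sets borel" and R: "0 < R"
    and der: "((\<lambda>\<rho>. measure lborel (cball c \<rho> \<inter> A)) has_real_derivative D) (at R)"
  shows "perimeter E A \<le> ennreal D"
  unfolding perimeter_def
proof (rule SUP_least)
  fix T :: "'a \<Rightarrow> 'a" assume "T \<in> {T. test_field A T}"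
  then have T: "test_field A T" by simp
  have "(LINT x:E|lebesgue. divergence T x) \<le> D"
    unfolding set_integral_divergence[OF T E(1) borel_closed[OF closed_cball] E(2)]
    by (rule integral_cball_divergence_le[OF T A R der])
  then show "ennreal (LINT x:E|lebesgue. divergence T x) \<le> ennreal D" by (rule ennreal_leI)
qed

lemma half_neg_borel [measurable]: "half_neg u \<in> sets borel"
  unfolding half_neg_def by measurable

text \<open>The area of the spherical part of a cap of radius R and cosine c, without its flat base.
  The formula is the derivative of the cap volume in the radius with the centre kept fixed.\<close>

definition cap_area :: "nat \<Rightarrow> real \<Rightarrow> real \<Rightarrow> real"
  where "cap_area n R c = unit_ball_vol n * R ^ n * (real (Suc n) * cap_vol n c - c * cap_weight n c)"

text \<open>With the centre fixed, the cosine -a/\<rho> moves with the radius; its derivative a/R^2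
  = -c/R produces the term -c w(c) of \<open>cap_area\<close>.\<close>

lemma measure_cap_deriv:
  fixes u :: "'a::euclidean_space"
  assumes dim: "DIM('a) \<ge> 2" and u: "u \<in> Basis \<or> - u \<in> Basis" and R: "\<bar>a\<bar> < R"
  shows "((\<lambda>\<rho>. measure lborel (cball (a *\<^sub>R u) \<rho> \<inter> half_neg u)) has_real_derivative
    cap_area (DIM('a) - 1) R (- a / R)) (at R)"
proof -
  define n where "n = DIM('a) - 1"
  have n: "DIM('a) = Suc n" using dim by (auto simp: n_def)
  have R0: "R > 0" using R by linarith
  have c: "-1 < - a / R" using R R0 by (simp add: field_simps)
  have q: "((\<lambda>\<rho>. - a / \<rho>) has_real_derivative a / R\<^sup>2) (at R)"
    using R0 by (auto intro!: derivative_eq_intros simp: power2_eq_square)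
  have "((\<lambda>\<rho>. unit_ball_vol (real n) * (\<rho> ^ Suc n * cap_vol n (- a / \<rho>))) has_real_derivative
      unit_ball_vol (real n) * ((real (Suc n) * R ^ n) * cap_vol n (- a / R) + (cap_weight n (- a / R) * (a / R\<^sup>2)) * R ^ Suc n)) (at R)"
    using DERIV_pow[of "Suc n" R] by (intro DERIV_cmult DERIV_mult DERIV_chain2[OF cap_vol_deriv[OF c] q]) simp
  also have "unit_ball_vol (real n) * ((real (Suc n) * R ^ n) * cap_vol n (- a / R) + (cap_weight n (- a / R) * (a / R\<^sup>2)) * R ^ Suc n)
     = cap_area n R (- a / R)"
    using R0 by (simp add: cap_area_def power2_eq_square divide_simps) (simp add: algebra_simps)
  finally show ?thesis unfolding n_def[symmetric]
  proof (rule has_field_derivative_transform_within_open[where S = "{\<bar>a\<bar><..}"])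
    fix \<rho> assume "\<rho> \<in> {\<bar>a\<bar><..}"
    then have \<rho>: "\<bar>a\<bar> < \<rho>" by simp
    then have \<rho>0: "0 < \<rho>" "-1 < - a / \<rho>" by (auto simp: field_simps)
    show "unit_ball_vol (real n) * (\<rho> ^ Suc n * cap_vol n (- a / \<rho>)) = measure lborel (cball (a *\<^sub>R u) \<rho> \<inter> half_neg u)"
      using emeasure_cap[OF dim u \<rho>] cap_vol_pos[OF \<rho>0(2), of n] \<rho>0 unfolding n_def[symmetric] n
      by (simp add: measure_def mult_ac)
  qed (use R in auto)
qed

lemma test_field_zero: "test_field A (\<lambda>x. 0)"
  by (simp add: test_field_def frechet_derivative_const)

text \<open>Apply the upper bound to the zero field. The sign is needed because
  \<open>ennreal\<close> truncates negative values.\<close>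

lemma cap_area_nonneg:
  fixes u :: "'a::euclidean_space"
  assumes dim: "DIM('a) \<ge> 2" and u: "u \<in> Basis \<or> - u \<in> Basis" and R: "\<bar>a\<bar> < R"
  shows "0 \<le> cap_area (DIM('a) - 1) R (- a / R)"
  using integral_cball_divergence_le[OF test_field_zero half_neg_borel _ measure_cap_deriv[OF assms]] R
  by (simp add: divergence_def frechet_derivative_const)

lemma perimeter_cap_le:
  fixes u :: "'a::euclidean_space"
  assumes dim: "DIM('a) \<ge> 2" and u: "u \<in> Basis \<or> - u \<in> Basis" and R: "\<bar>a\<bar> < R"
    and E: "E \<in> sets lebesgue" "E \<inter> half_neg u = cball (a *\<^sub>R u) R \<inter> half_neg u"
  shows "perimeter E (half_neg u) \<le> ennreal (cap_area (DIM('a) - 1) R (- a / R))"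
  using R by (intro perimeter_le_derivative[OF E half_neg_borel _ measure_cap_deriv[OF dim u R]]) auto

section \<open>Cutting fields off near the hyperplane\<close>

text \<open>Minus the derivative in s of the cut-off step (-s/\<epsilon> - 1). The shift by 1 makes
  the cut-off vanish for s \<ge> -\<epsilon>, so the layer is -2\<epsilon> \<le> s \<le> -\<epsilon>
  and stays inside the open half-space.\<close>

definition layer_weight :: "real \<Rightarrow> real \<Rightarrow> real"
  where "layer_weight \<epsilon> s = step' (- s / \<epsilon> - 1) / \<epsilon>"

lemma layer_weight_nonneg: "0 < \<epsilon> \<Longrightarrow> 0 \<le> layer_weight \<epsilon> s"
  by (simp add: layer_weight_def step'_nonneg)

lemma layer_weight_measurable [measurable]: "layer_weight \<epsilon> \<in> borel_measurable borel"
  unfolding layer_weight_def[abs_def] by measurable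

lemma slice_area_le:
  assumes "R > 0" shows "slice_area n a R s \<le> unit_ball_vol n * R ^ n"
proof -
  have "sqrt (max 0 (R\<^sup>2 - (s - a)\<^sup>2)) \<le> sqrt (R\<^sup>2)" by (intro real_sqrt_le_mono) auto
  then have "sqrt (max 0 (R\<^sup>2 - (s - a)\<^sup>2)) ^ n \<le> R ^ n" using assms by (intro power_mono) auto
  then show ?thesis unfolding slice_area_def by (intro mult_left_mono) auto
qed

text \<open>Slicing and the substitution s = -\<epsilon> - \<epsilon> t turn the layer weight into
  the fixed kernel \<open>step'\<close>, leaving \<epsilon> only in the slice height.\<close>

lemma has_bochner_integral_layer:
  fixes u :: "'a::euclidean_space"
  assumes dim: "DIM('a) \<ge> 2" and u: "u \<in> Basis \<or> - u \<in> Basis" and R: "0 < R" and \<epsilon>: "0 < \<epsilon>"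
  shows "has_bochner_integral lborel (\<lambda>x. indicator (cball (a *\<^sub>R u) R) x * layer_weight \<epsilon> (x \<bullet> u))
    (\<integral>t. step' t * slice_area (DIM('a) - 1) a R (- \<epsilon> - \<epsilon> * t) \<partial>lborel)" (is "has_bochner_integral _ _ ?I")
proof -
  let ?S = "slice_area (DIM('a) - 1) a R"
  have [measurable]: "cball (a *\<^sub>R u) R \<in> sets borel" by simp
  have int: "integrable lborel (\<lambda>t. step' t * ?S (- \<epsilon> - \<epsilon> * t))"
  proof (rule Bochner_Integration.integrable_bound)
    show "integrable lborel (\<lambda>t. (unit_ball_vol (DIM('a) - 1) * R ^ (DIM('a) - 1)) * step' t)"
      using has_bochner_integral_step' by (intro integrable_mult_right) (auto simp: has_bochner_integral_iff)
    show "AE t in lborel. norm (step' t * ?S (- \<epsilon> - \<epsilon> * t)) \<le> norm ((unit_ball_vol (DIM('a) - 1) * R ^ (DIM('a) - 1)) * step' t)"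
      using slice_area_le[OF R, of "DIM('a) - 1" a] slice_area_nonneg[of "DIM('a) - 1" a R] step'_nonneg R
      by (auto simp: abs_mult mult.commute[of "step' _"] intro!: AE_I2 mult_right_mono)
  qed measurable
  have "(\<integral>\<^sup>+x. ennreal (indicator (cball (a *\<^sub>R u) R) x * layer_weight \<epsilon> (x \<bullet> u)) \<partial>lborel)
    = (\<integral>\<^sup>+x. ennreal (layer_weight \<epsilon> (x \<bullet> u)) * indicator (cball (a *\<^sub>R u) R) x \<partial>lborel)"
    by (intro nn_integral_cong) (auto simp: indicator_def)
  also have "\<dots> = (\<integral>\<^sup>+s. ennreal (layer_weight \<epsilon> s) * ennreal (?S s) \<partial>lborel)"
    by (rule nn_integral_cball_slices'[OF dim u R]) measurable
  also have "\<dots> = ennreal \<epsilon> * (\<integral>\<^sup>+t. ennreal (layer_weight \<epsilon> (- \<epsilon> + - \<epsilon> * t)) * ennreal (?S (- \<epsilon> + - \<epsilon> * t)) \<partial>lborel)"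
    using \<epsilon> by (subst nn_integral_real_affine[of _ "- \<epsilon>" "- \<epsilon>"]) auto
  also have "\<dots> = (\<integral>\<^sup>+t. ennreal \<epsilon> * (ennreal (layer_weight \<epsilon> (- \<epsilon> + - \<epsilon> * t)) * ennreal (?S (- \<epsilon> + - \<epsilon> * t))) \<partial>lborel)"
    by (rule nn_integral_cmult[symmetric]) measurable
  also have "\<dots> = (\<integral>\<^sup>+t. ennreal (step' t * ?S (- \<epsilon> - \<epsilon> * t)) \<partial>lborel)"
  proof (rule nn_integral_cong)
    fix t
    have "- (- \<epsilon> + - \<epsilon> * t) / \<epsilon> - 1 = t" using \<epsilon> by (simp add: field_simps)
    then have "layer_weight \<epsilon> (- \<epsilon> + - \<epsilon> * t) = step' t / \<epsilon>" unfolding layer_weight_def by (simp only:)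
    then show "ennreal \<epsilon> * (ennreal (layer_weight \<epsilon> (- \<epsilon> + - \<epsilon> * t)) * ennreal (?S (- \<epsilon> + - \<epsilon> * t))) = ennreal (step' t * ?S (- \<epsilon> - \<epsilon> * t))"
      using \<epsilon> step'_nonneg[of t] slice_area_nonneg by (simp add: ennreal_mult[symmetric])
  qed
  also have "\<dots> = ennreal ?I"
    using int by (intro nn_integral_eq_integral) (auto simp: step'_nonneg slice_area_nonneg)
  finally show ?thesis
    by (intro has_bochner_integral_nn_integral)
       (auto simp: \<epsilon> layer_weight_nonneg step'_nonneg slice_area_nonneg intro!: Bochner_Integration.integral_nonneg)
qed

text \<open>The kernel has mass 1 and the slices vary continuously with the height, so the layer
  concentrates on the slice at height 0, the flat base of the cap.\<close>

lemma layer_limit: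
  assumes R: "0 < R" and \<epsilon>: "\<epsilon> \<longlonglongrightarrow> 0"
  shows "(\<lambda>k. \<integral>t. step' t * slice_area n a R (- \<epsilon> k - \<epsilon> k * t) \<partial>lborel) \<longlonglongrightarrow> slice_area n a R 0"
proof -
  have "(\<lambda>k. \<integral>t. step' t * slice_area n a R (- \<epsilon> k - \<epsilon> k * t) \<partial>lborel) \<longlonglongrightarrow> (\<integral>t. step' t * slice_area n a R 0 \<partial>lborel)"
  proof (rule integral_dominated_convergence[where w = "\<lambda>t. (unit_ball_vol n * R ^ n) * step' t"])
    show "integrable lborel (\<lambda>t. (unit_ball_vol n * R ^ n) * step' t)"
      using has_bochner_integral_step' by (intro integrable_mult_right) (auto simp: has_bochner_integral_iff)
    show "AE t in lborel. norm (step' t * slice_area n a R (- \<epsilon> k - \<epsilon> k * t)) \<le> (unit_ball_vol n * R ^ n) * step' t" for k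
      using slice_area_le[OF R, of n a] slice_area_nonneg[of n a R] step'_nonneg
      by (auto simp: abs_mult mult.commute[of "step' _"] intro!: AE_I2 mult_right_mono)
    show "AE t in lborel. (\<lambda>k. step' t * slice_area n a R (- \<epsilon> k - \<epsilon> k * t)) \<longlonglongrightarrow> step' t * slice_area n a R 0"
    proof (intro AE_I2 tendsto_mult tendsto_const)
      fix t
      have "(\<lambda>k. - \<epsilon> k - \<epsilon> k * t) \<longlonglongrightarrow> - 0 - 0 * t" by (intro tendsto_intros \<epsilon>)
      moreover have "isCont (slice_area n a R) 0"
        using continuous_slice_area[of UNIV] by (simp add: continuous_on_eq_continuous_at)
      ultimately show "(\<lambda>k. slice_area n a R (- \<epsilon> k - \<epsilon> k * t)) \<longlonglongrightarrow> slice_area n a R 0"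
        by (intro isCont_tendsto_compose[where g = "slice_area n a R"]) auto
    qed
  qed measurable
  also have "(\<integral>t. step' t * slice_area n a R 0 \<partial>lborel) = slice_area n a R 0"
    using has_bochner_integral_step' by (simp add: has_bochner_integral_iff)
  finally show ?thesis .
qed

lemma layer_le:
  assumes R: "0 < R"
  shows "(\<integral>t. step' t * slice_area n a R (- \<epsilon> - \<epsilon> * t) \<partial>lborel) \<le> unit_ball_vol n * R ^ n"
proof -
  have int: "integrable lborel (\<lambda>t. step' t * (unit_ball_vol n * R ^ n))" "(\<integral>t. step' t * (unit_ball_vol n * R ^ n) \<partial>lborel) = unit_ball_vol n * R ^ n"
    using has_bochner_integral_step' by (auto simp: has_bochner_integral_iff)
  have "(\<integral>t. step' t * slice_area n a R (- \<epsilon> - \<epsilon> * t) \<partial>lborel) \<le> (\<integral>t. step' t * (unit_ball_vol n * R ^ n) \<partial>lborel)"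
    using slice_area_le[OF R] step'_nonneg slice_area_nonneg R
    by (intro integral_mono_AE' int AE_I2 mult_left_mono mult_nonneg_nonneg) auto
  then show ?thesis unfolding int .
qed

text \<open>Multiplication by the step moves the support into x \<bullet> u \<le> -\<epsilon>, as a
  test field for the open half-space requires; the product rule adds the layer term to the
  divergence.\<close>

lemma cutoff_field:
  fixes T :: "'a::euclidean_space \<Rightarrow> 'a" and u :: 'a
  assumes T: "test_field UNIV T" and \<epsilon>: "0 < \<epsilon>"
  defines "S \<equiv> (\<lambda>x. step (- (x \<bullet> u) / \<epsilon> - 1) *\<^sub>R T x)"
  shows "test_field (half_neg u) S"
    and "divergence S x = step (- (x \<bullet> u) / \<epsilon> - 1) * divergence T x - layer_weight \<epsilon> (x \<bullet> u) * (T x \<bullet> u)"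
proof -
  let ?D = "\<lambda>x. frechet_derivative T (at x)"
  let ?S' = "\<lambda>x v. step (- (x \<bullet> u) / \<epsilon> - 1) *\<^sub>R ?D x v + (- (v \<bullet> u) * layer_weight \<epsilon> (x \<bullet> u)) *\<^sub>R T x"
  have der: "(S has_derivative ?S' x) (at x)" for x
  proof -
    have "((\<lambda>x. - (x \<bullet> u) / \<epsilon> - 1) has_derivative (\<lambda>v. - (v \<bullet> u) / \<epsilon>)) (at x)"
      using \<epsilon> by (auto intro!: derivative_eq_intros)
    from has_derivative_compose[OF this step_deriv[unfolded has_field_derivative_def]]
    have "((\<lambda>x. step (- (x \<bullet> u) / \<epsilon> - 1)) has_derivative (\<lambda>v. - (v \<bullet> u) * layer_weight \<epsilon> (x \<bullet> u))) (at x)"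
      by (simp add: layer_weight_def mult.commute)
    from has_derivative_scaleR[OF this test_field_has_derivative[OF T]]
    show ?thesis by (simp add: S_def)
  qed
  have fd: "frechet_derivative S (at x) = ?S' x" for x
    using frechet_derivative_at[OF der[of x]] by simp
  have sc: "continuous_on UNIV (\<lambda>x. step (- (x \<bullet> u) / \<epsilon> - 1))"
    using \<epsilon> by (intro continuous_on_compose2[OF DERIV_continuous_on[OF DERIV_subset[OF step_deriv subset_UNIV], of UNIV]] continuous_intros) auto
  have lc: "continuous_on UNIV (\<lambda>x. layer_weight \<epsilon> (x \<bullet> u))"
    unfolding layer_weight_def using \<epsilon> by (intro continuous_intros continuous_on_compose2[OF continuous_step']) auto
  have supp: "{x. S x \<noteq> 0} \<subseteq> closure {x. T x \<noteq> 0} \<inter> {x. x \<bullet> u \<le> - \<epsilon>}"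
  proof
    fix x assume "x \<in> {x. S x \<noteq> 0}"
    then have x: "T x \<noteq> 0" "\<not> - (x \<bullet> u) / \<epsilon> - 1 \<le> 0" by (auto simp: S_def step_eq_0)
    then show "x \<in> closure {x. T x \<noteq> 0} \<inter> {x. x \<bullet> u \<le> - \<epsilon>}"
      using subsetD[OF closure_subset, of x "{x. T x \<noteq> 0}"] \<epsilon> by (auto simp: field_simps)
  qed
  have "closed {x. x \<bullet> u \<le> - \<epsilon>}" by (intro closed_Collect_le continuous_intros)
  with closure_minimal[OF supp] have supp': "closure {x. S x \<noteq> 0} \<subseteq> closure {x. T x \<noteq> 0} \<inter> {x. x \<bullet> u \<le> - \<epsilon>}" by auto
  have "compact (closure {x. T x \<noteq> 0})" using T by (simp add: test_field_def)
  then have "compact (closure {x. T x \<noteq> 0} \<inter> closure {x. S x \<noteq> 0})" by (rule compact_Int_closed) simp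
  moreover have "closure {x. T x \<noteq> 0} \<inter> closure {x. S x \<noteq> 0} = closure {x. S x \<noteq> 0}" using supp' by blast
  ultimately have cpt: "compact (closure {x. S x \<noteq> 0})" by simp
  have "norm (S x) \<le> 1" for x
  proof -
    have "norm (S x) = step (- (x \<bullet> u) / \<epsilon> - 1) * norm (T x)" using step_bounds by (simp add: S_def)
    also have "\<dots> \<le> 1 * 1" using T step_bounds by (intro mult_mono) (auto simp: test_field_def)
    finally show ?thesis by simp
  qed
  moreover have "continuous_on UNIV (\<lambda>x. ?S' x v)" for v
    using T by (intro continuous_intros sc lc test_field_continuous[OF T]) (auto simp: test_field_def)
  moreover have "closure {x. S x \<noteq> 0} \<subseteq> half_neg u" using supp' \<epsilon> by (auto simp: half_neg_def)
  ultimately show "test_field (half_neg u) S"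
    unfolding test_field_def fd using differentiableI[OF der] cpt by blast
  have "divergence S x = (\<Sum>b\<in>Basis. step (- (x \<bullet> u) / \<epsilon> - 1) * (?D x b \<bullet> b) - layer_weight \<epsilon> (x \<bullet> u) * ((T x \<bullet> b) * (u \<bullet> b)))"
    unfolding divergence_def fd by (intro sum.cong refl) (simp add: inner_diff_left inner_commute[of u] algebra_simps)
  then show "divergence S x = step (- (x \<bullet> u) / \<epsilon> - 1) * divergence T x - layer_weight \<epsilon> (x \<bullet> u) * (T x \<bullet> u)"
    unfolding euclidean_inner[of "T x" u] by (simp add: divergence_def sum_subtractf sum_distrib_left)
qed

section \<open>Perimeter of a cap: lower bound\<close>

lemma perimeter_upper:
  "test_field A T \<Longrightarrow> ennreal (LINT x:E|lebesgue. divergence T x) \<le> perimeter E A"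
  unfolding perimeter_def by (rule SUP_upper) simp

lemma cutoff_limit:
  fixes f :: "'a::euclidean_space \<Rightarrow> real"
  assumes f: "integrable lborel f" and h: "\<And>k. 0 < h k" "h \<longlonglongrightarrow> 0"
  shows "(\<lambda>k. \<integral>x. step (- (x \<bullet> u) / h k - 1) * f x \<partial>lborel) \<longlonglongrightarrow> (\<integral>x. indicator (half_neg u) x * f x \<partial>lborel)"
proof (rule integral_dominated_convergence[where w = "\<lambda>x. \<bar>f x\<bar>"])
  have [measurable]: "f \<in> borel_measurable lborel" using f by auto
  show "(\<lambda>x. indicator (half_neg u) x * f x) \<in> borel_measurable lborel" by measurable
  show "(\<lambda>x. step (- (x \<bullet> u) / h k - 1) * f x) \<in> borel_measurable lborel" for k by measurable
  show "integrable lborel (\<lambda>x. \<bar>f x\<bar>)" using f by (rule integrable_abs)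
  show "AE x in lborel. norm (step (- (x \<bullet> u) / h k - 1) * f x) \<le> \<bar>f x\<bar>" for k
    using step_bounds by (auto simp: abs_mult intro!: AE_I2 mult_left_le_one_le)
  show "AE x in lborel. (\<lambda>k. step (- (x \<bullet> u) / h k - 1) * f x) \<longlonglongrightarrow> indicator (half_neg u) x * f x"
  proof (intro AE_I2 tendsto_mult tendsto_const tendsto_eventually)
    fix x
    show "\<forall>\<^sub>F k in sequentially. step (- (x \<bullet> u) / h k - 1) = indicator (half_neg u) x"
    proof (cases "x \<bullet> u < 0")
      case True
      then have "\<forall>\<^sub>F k in sequentially. h k < - (x \<bullet> u) / 2" using order_tendstoD(2)[OF h(2)] by simp
      then show ?thesis
      proof eventually_elim
        case (elim k)
        then have "1 \<le> - (x \<bullet> u) / h k - 1" using h(1)[of k] by (simp add: field_simps)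
        then show ?case using True by (simp add: step_eq_1 half_neg_def)
      qed
    next
      case False
      then have "- (x \<bullet> u) / h k - 1 \<le> 0" for k
        using h(1)[of k] divide_nonneg_pos[of "x \<bullet> u" "h k"] by (simp add: order_trans[of "-1" 0])
      then show ?thesis using False by (simp add: step_eq_0 half_neg_def)
    qed
  qed
qed

text \<open>Testing the perimeter with the cut-off field splits the integral into a bulk term and a
  layer term. It is used in two directions: to bound a perimeter below by a chosen T, and to bound
  the flux of an arbitrary T by a perimeter already known.\<close>

lemma cutoff_field_integral:
  fixes T :: "'a::euclidean_space \<Rightarrow> 'a" and u :: 'a
  assumes dim: "DIM('a) \<ge> 2" and u: "u \<in> Basis \<or> - u \<in> Basis" and R: "0 < R" and \<epsilon>: "0 < \<epsilon>"
    and T: "test_field UNIV T"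
    and E: "E \<in> sets lebesgue" "E \<inter> half_neg u = cball (a *\<^sub>R u) R \<inter> half_neg u"
  shows "integrable lborel (\<lambda>x. indicator (cball (a *\<^sub>R u) R) x * (layer_weight \<epsilon> (x \<bullet> u) * (T x \<bullet> u)))"
    and "ennreal ((\<integral>x. step (- (x \<bullet> u) / \<epsilon> - 1) * (indicator (cball (a *\<^sub>R u) R) x * divergence T x) \<partial>lborel)
      - (\<integral>x. indicator (cball (a *\<^sub>R u) R) x * (layer_weight \<epsilon> (x \<bullet> u) * (T x \<bullet> u)) \<partial>lborel)) \<le> perimeter E (half_neg u)"
proof -
  let ?B = "cball (a *\<^sub>R u) R"
  define S where "S = (\<lambda>x. step (- (x \<bullet> u) / \<epsilon> - 1) *\<^sub>R T x)"
  note S = cutoff_field[OF T \<epsilon>, of u, folded S_def]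
  have [measurable]: "?B \<in> sets borel" "divergence T \<in> borel_measurable borel" "T \<in> borel_measurable borel"
    using divergence_measurable[OF T] test_field_continuous[OF T] by (auto intro: borel_measurable_continuous_onI)
  have nu: "norm u = 1" using u by (metis norm_Basis norm_minus_cancel)
  have Tu: "\<bar>T x \<bullet> u\<bar> \<le> 1" for x
  proof -
    have "\<bar>T x \<bullet> u\<bar> \<le> norm (T x)" using Cauchy_Schwarz_ineq2[of "T x" u] nu by simp
    also have "\<dots> \<le> 1" using T by (simp add: test_field_def)
    finally show ?thesis .
  qed
  have i1: "integrable lborel (\<lambda>x. step (- (x \<bullet> u) / \<epsilon> - 1) * (indicator ?B x * divergence T x))"
    by (rule Bochner_Integration.integrable_bound[OF integrable_divergence[OF T, of ?B]])
       (auto simp: abs_mult step_bounds intro!: AE_I2 mult_left_le_one_le)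
  show i2: "integrable lborel (\<lambda>x. indicator ?B x * (layer_weight \<epsilon> (x \<bullet> u) * (T x \<bullet> u)))"
  proof (rule Bochner_Integration.integrable_bound)
    show "integrable lborel (\<lambda>x. indicator ?B x * layer_weight \<epsilon> (x \<bullet> u))"
      using has_bochner_integral_layer[OF dim u R \<epsilon>] by (simp add: has_bochner_integral_iff)
    show "AE x in lborel. norm (indicator ?B x * (layer_weight \<epsilon> (x \<bullet> u) * (T x \<bullet> u))) \<le> norm (indicator ?B x * layer_weight \<epsilon> (x \<bullet> u))"
      using Tu by (auto simp: abs_mult intro!: AE_I2 mult_left_le mult_left_mono)
  qed measurable
  have "(LINT x:E|lebesgue. divergence S x) = (\<integral>x. indicator ?B x * divergence S x \<partial>lborel)"
    by (rule set_integral_divergence[OF S(1) E(1) _ E(2)]) simp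
  also have "\<dots> = (\<integral>x. step (- (x \<bullet> u) / \<epsilon> - 1) * (indicator ?B x * divergence T x)
       - indicator ?B x * (layer_weight \<epsilon> (x \<bullet> u) * (T x \<bullet> u)) \<partial>lborel)"
    by (intro Bochner_Integration.integral_cong refl) (simp add: S(2) algebra_simps)
  also have "\<dots> = (\<integral>x. step (- (x \<bullet> u) / \<epsilon> - 1) * (indicator ?B x * divergence T x) \<partial>lborel)
       - (\<integral>x. indicator ?B x * (layer_weight \<epsilon> (x \<bullet> u) * (T x \<bullet> u)) \<partial>lborel)"
    by (rule Bochner_Integration.integral_diff[OF i1 i2])
  finally show "ennreal ((\<integral>x. step (- (x \<bullet> u) / \<epsilon> - 1) * (indicator ?B x * divergence T x) \<partial>lborel)
      - (\<integral>x. indicator ?B x * (layer_weight \<epsilon> (x \<bullet> u) * (T x \<bullet> u)) \<partial>lborel)) \<le> perimeter E (half_neg u)"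
    using perimeter_upper[OF S(1), of E] by simp
qed

text \<open>Here T need not vanish on the hyperplane. The cut-off field is controlled by the cap
  area, and the layer by the volume of a whole disc of radius R; this crude bound suffices for
  finiteness of the perimeter.\<close>

lemma integral_cap_divergence_le:
  fixes T :: "'a::euclidean_space \<Rightarrow> 'a" and u :: 'a
  assumes dim: "DIM('a) \<ge> 2" and u: "u \<in> Basis \<or> - u \<in> Basis" and R: "\<bar>a\<bar> < R" and T: "test_field UNIV T"
  shows "(\<integral>x. indicator (cball (a *\<^sub>R u) R \<inter> half_neg u) x * divergence T x \<partial>lborel)
    \<le> cap_area (DIM('a) - 1) R (- a / R) + unit_ball_vol (real (DIM('a) - 1)) * R ^ (DIM('a) - 1)"
proof -
  let ?B = "cball (a *\<^sub>R u) R" and ?n = "DIM('a) - 1"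
  have R0: "0 < R" using R by linarith
  have nu: "norm u = 1" using u by (metis norm_Basis norm_minus_cancel)
  define h where "h k = 1 / real (Suc k)" for k
  have h: "h k > 0" for k by (auto simp: h_def)
  have h0: "h \<longlonglongrightarrow> 0" unfolding h_def by (rule LIMSEQ_Suc[OF lim_1_over_n])
  let ?E = "?B \<inter> half_neg u"
  have B: "?B \<in> sets borel" by simp
  have "(\<integral>x. step (- (x \<bullet> u) / h k - 1) * (indicator ?B x * divergence T x) \<partial>lborel)
      \<le> cap_area ?n R (- a / R) + unit_ball_vol (real ?n) * R ^ ?n" for k
  proof -
    note * = cutoff_field_integral[OF dim u R0 h T, of ?E a]
    have E: "?E \<in> sets lebesgue" using half_neg_borel[of u] by (intro sets.Int) auto
    have "ennreal ((\<integral>x. step (- (x \<bullet> u) / h k - 1) * (indicator ?B x * divergence T x) \<partial>lborel)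
      - (\<integral>x. indicator ?B x * (layer_weight (h k) (x \<bullet> u) * (T x \<bullet> u)) \<partial>lborel)) \<le> ennreal (cap_area ?n R (- a / R))"
      using *(2)[OF E] perimeter_cap_le[OF dim u R E] by (auto intro: order_trans)
    then have 1: "(\<integral>x. step (- (x \<bullet> u) / h k - 1) * (indicator ?B x * divergence T x) \<partial>lborel)
      - (\<integral>x. indicator ?B x * (layer_weight (h k) (x \<bullet> u) * (T x \<bullet> u)) \<partial>lborel) \<le> cap_area ?n R (- a / R)"
      using cap_area_nonneg[OF dim u R] by (simp add: ennreal_le_iff)
    have "(\<integral>x. indicator ?B x * (layer_weight (h k) (x \<bullet> u) * (T x \<bullet> u)) \<partial>lborel) \<le> (\<integral>x. indicator ?B x * layer_weight (h k) (x \<bullet> u) \<partial>lborel)"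
    proof (rule integral_mono)
      show "integrable lborel (\<lambda>x. indicator ?B x * layer_weight (h k) (x \<bullet> u))"
        using has_bochner_integral_layer[OF dim u R0 h] by (simp add: has_bochner_integral_iff)
      show "indicator ?B x * (layer_weight (h k) (x \<bullet> u) * (T x \<bullet> u)) \<le> indicator ?B x * layer_weight (h k) (x \<bullet> u)" for x
      proof -
        have "T x \<bullet> u \<le> norm (T x) * norm u" by (rule norm_cauchy_schwarz)
        also have "\<dots> \<le> 1" using T nu by (simp add: test_field_def)
        finally show ?thesis using layer_weight_nonneg[OF h] by (intro mult_left_mono mult_left_le) auto
      qed
    qed (use *(1)[OF E] in auto)
    also have "\<dots> \<le> unit_ball_vol (real ?n) * R ^ ?n"
      using has_bochner_integral_layer[OF dim u R0 h[of k], of a] layer_le[OF R0, of ?n a "h k"]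
      by (simp add: has_bochner_integral_iff)
    finally show ?thesis using 1 by linarith
  qed
  moreover have "indicator (half_neg u) x * (indicator ?B x * divergence T x) = indicator ?E x * divergence T x" for x
    by (simp split: split_indicator)
  then have "(\<lambda>k. \<integral>x. step (- (x \<bullet> u) / h k - 1) * (indicator ?B x * divergence T x) \<partial>lborel) \<longlonglongrightarrow> (\<integral>x. indicator ?E x * divergence T x \<partial>lborel)"
    using cutoff_limit[OF integrable_divergence[OF T B] h h0, of u] by (simp only:)
  ultimately show ?thesis by (intro LIMSEQ_le_const2) auto
qed

text \<open>The outward field (x - c)/\<rho> on the ball of radius R, cut off between R and \<rho>.
  Dividing by \<rho> instead of R keeps the norm at most 1 on the larger ball, and an argument
  quadratic in x - c avoids a singularity at the centre.\<close>

definition radial_field :: "'a::euclidean_space \<Rightarrow> real \<Rightarrow> real \<Rightarrow> 'a \<Rightarrow> 'a"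
  where "radial_field c R \<rho> x = (step ((\<rho>\<^sup>2 - (x - c) \<bullet> (x - c)) / (\<rho>\<^sup>2 - R\<^sup>2)) / \<rho>) *\<^sub>R (x - c)"

lemma radial_field:
  fixes c :: "'a::euclidean_space"
  assumes R: "0 < R" "R < \<rho>"
  shows "test_field UNIV (radial_field c R \<rho>)"
    and "x \<in> cball c R \<Longrightarrow> radial_field c R \<rho> x = (1 / \<rho>) *\<^sub>R (x - c)"
    and "x \<in> cball c R \<Longrightarrow> divergence (radial_field c R \<rho>) x = DIM('a) / \<rho>"
proof -
  let ?F = "radial_field c R \<rho>"
  define d where "d = \<rho>\<^sup>2 - R\<^sup>2"
  have d: "d > 0" using R by (simp add: d_def power_strict_mono)
  let ?g = "\<lambda>x. (\<rho>\<^sup>2 - (x - c) \<bullet> (x - c)) / d"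
  let ?F' = "\<lambda>x v. (step (?g x) / \<rho>) *\<^sub>R v + ((- (2 * (v \<bullet> (x - c))) / d * step' (?g x)) / \<rho>) *\<^sub>R (x - c)"
  have der: "(?F has_derivative ?F' x) (at x)" for x
  proof -
    have "(?g has_derivative (\<lambda>v. - (2 * (v \<bullet> (x - c))) / d)) (at x)"
      using d by (auto intro!: derivative_eq_intros simp: inner_commute)
    from has_derivative_compose[OF this step_deriv[unfolded has_field_derivative_def]]
    have "((\<lambda>x. step (?g x)) has_derivative (\<lambda>v. - (2 * (v \<bullet> (x - c))) / d * step' (?g x))) (at x)"
      by (simp add: mult.commute)
    then have 1: "((\<lambda>x. step (?g x) / \<rho>) has_derivative (\<lambda>v. (- (2 * (v \<bullet> (x - c))) / d * step' (?g x)) / \<rho>)) (at x)"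
      using R by (auto intro!: derivative_eq_intros)
    have 2: "((\<lambda>x. x - c) has_derivative (\<lambda>v. v)) (at x)" by (auto intro!: derivative_eq_intros)
    show ?thesis using has_derivative_scaleR[OF 1 2] unfolding radial_field_def d_def .
  qed
  have fd: "frechet_derivative ?F (at x) = ?F' x" for x
    using frechet_derivative_at[OF der[of x]] by simp
  have gc: "continuous_on UNIV ?g" using d by (intro continuous_intros) auto
  have sc: "continuous_on UNIV (\<lambda>x. step (?g x))"
    using gc by (intro continuous_on_compose2[OF DERIV_continuous_on[OF DERIV_subset[OF step_deriv subset_UNIV], of UNIV]]) auto
  have sc': "continuous_on UNIV (\<lambda>x. step' (?g x))"
    using gc by (intro continuous_on_compose2[OF continuous_step']) auto
  have zero: "step (?g x) = 0" if "norm (x - c) > \<rho>" for x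
  proof -
    have "\<rho>\<^sup>2 \<le> (norm (x - c))\<^sup>2" using that R by (intro power_mono) auto
    then have "?g x \<le> 0" using d by (simp add: power2_norm_eq_inner divide_nonpos_pos)
    then show ?thesis by (rule step_eq_0)
  qed
  have "{x. ?F x \<noteq> 0} \<subseteq> cball c \<rho>"
    using zero by (auto simp: radial_field_def d_def[symmetric] dist_norm norm_minus_commute intro: ccontr)
  then have "compact (closure {x. ?F x \<noteq> 0})"
    by (meson bounded_cball bounded_subset compact_closure)
  moreover have "norm (?F x) \<le> 1" for x
  proof (cases "norm (x - c) > \<rho>")
    case True
    then show ?thesis using zero[of x] by (simp add: radial_field_def d_def)
  next
    case False
    have "norm (?F x) = step (?g x) * (norm (x - c) / \<rho>)" using R step_bounds by (simp add: radial_field_def d_def)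
    also have "\<dots> \<le> 1 * 1" using False R step_bounds by (intro mult_mono) auto
    finally show ?thesis by simp
  qed
  moreover have "continuous_on UNIV (\<lambda>x. ?F' x v)" for v
    using R d by (intro continuous_intros sc sc') auto
  ultimately show "test_field UNIV ?F"
    unfolding test_field_def fd using differentiableI[OF der] by blast
  have one: "?g x \<ge> 1" if "x \<in> cball c R" for x
  proof -
    have "(norm (x - c))\<^sup>2 \<le> R\<^sup>2" using that by (intro power_mono) (auto simp: dist_norm norm_minus_commute)
    then show ?thesis using d by (simp add: power2_norm_eq_inner d_def)
  qed
  show "?F x = (1 / \<rho>) *\<^sub>R (x - c)" if "x \<in> cball c R"
    using step_eq_1[OF one[OF that]] by (simp add: radial_field_def d_def)
  show "divergence ?F x = DIM('a) / \<rho>" if "x \<in> cball c R"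
    unfolding divergence_def fd using step_eq_1[OF one[OF that]] step'_eq_0[OF disjI2[OF one[OF that]]]
    by (simp add: inner_Basis)
qed

text \<open>On the ball the radial field has divergence N/\<rho>, and on the layer its normal
  component is at most -a/\<rho>. Letting the layer shrink and then \<rho> tend to R leaves the two
  terms of the divergence theorem, which add up to the cap area.\<close>

lemma perimeter_cap_ge:
  fixes u :: "'a::euclidean_space"
  assumes dim: "DIM('a) \<ge> 2" and u: "u \<in> Basis \<or> - u \<in> Basis" and R: "\<bar>a\<bar> < R"
    and E: "E \<in> sets lebesgue" "E \<inter> half_neg u = cball (a *\<^sub>R u) R \<inter> half_neg u"
  shows "ennreal (cap_area (DIM('a) - 1) R (- a / R)) \<le> perimeter E (half_neg u)"
proof -
  let ?B = "cball (a *\<^sub>R u) R"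
  define n where "n = DIM('a) - 1"
  define w where "w = unit_ball_vol (real n)"
  have n: "DIM('a) = Suc n" using dim by (auto simp: n_def)
  have R0: "0 < R" using R by linarith
  have c: "-1 < - a / R" "\<bar>- a / R\<bar> \<le> 1" using R R0 by (auto simp: field_simps abs_le_iff abs_less_iff)
  have nu: "u \<bullet> u = 1" using u by (metis inner_same_Basis inner_minus_left inner_minus_right minus_minus)
  define h where "h k = 1 / real (Suc k)" for k
  have h: "h k > 0" for k by (auto simp: h_def)
  have h0: "h \<longlonglongrightarrow> 0" unfolding h_def by (rule LIMSEQ_Suc[OF lim_1_over_n])
  define J where "J k = (\<integral>t. step' t * slice_area n a R (- h k - h k * t) \<partial>lborel)" for k
  have J: "has_bochner_integral lborel (\<lambda>x. indicator ?B x * layer_weight (h k) (x \<bullet> u)) (J k)" for k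
    unfolding J_def n_def by (rule has_bochner_integral_layer[OF dim u R0 h])
  have Jlim: "J \<longlonglongrightarrow> slice_area n a R 0" unfolding J_def by (rule layer_limit[OF R0 h0])
  have B: "?B \<in> sets borel" by simp
  have vol: "(\<integral>x. indicator (half_neg u) x * indicator ?B x \<partial>lborel) = w * R ^ Suc n * cap_vol n (- a / R)"
  proof -
    have "indicator (half_neg u) x * indicator ?B x = (indicator (?B \<inter> half_neg u) x :: real)" for x
      by (simp split: split_indicator)
    then show ?thesis
      using emeasure_cap[OF dim u R] cap_vol_pos[OF c(1), of n] R0 unfolding n_def[symmetric] n w_def
      by (simp add: measure_def)
  qed
  have slice: "slice_area n a R 0 = w * R ^ n * cap_weight n (- a / R)"
    using slice_area_affine[OF R0, of n a "- a / R"] R0 by (simp add: w_def)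
  \<comment> \<open>The divergence theorem for x - a u on the cap: the flux is R times the area on
    the sphere and -a times the area on the flat base.\<close>
  have area: "real (Suc n) * (w * R ^ Suc n * cap_vol n (- a / R)) + a * slice_area n a R 0 = R * cap_area n R (- a / R)"
    unfolding slice cap_area_def w_def[symmetric] using R0 by (simp add: algebra_simps)
  have step1: "ennreal ((R * cap_area n R (- a / R)) / \<rho>) \<le> perimeter E (half_neg u)" if \<rho>: "R < \<rho>" for \<rho>
  proof -
    let ?T = "radial_field (a *\<^sub>R u) R \<rho>"
    note T = radial_field[OF R0 \<rho>, where c = "a *\<^sub>R u"]
    have bound: "ennreal (real (Suc n) / \<rho> * (\<integral>x. step (- (x \<bullet> u) / h k - 1) * indicator ?B x \<partial>lborel) + a / \<rho> * J k) \<le> perimeter E (half_neg u)" for k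
    proof -
      have "(\<integral>x. step (- (x \<bullet> u) / h k - 1) * (indicator ?B x * divergence ?T x) \<partial>lborel)
         = (\<integral>x. real (Suc n) / \<rho> * (step (- (x \<bullet> u) / h k - 1) * indicator ?B x) \<partial>lborel)"
        by (intro Bochner_Integration.integral_cong refl) (auto simp: indicator_def T(3) n simp del: mem_cball)
      then have 1: "(\<integral>x. step (- (x \<bullet> u) / h k - 1) * (indicator ?B x * divergence ?T x) \<partial>lborel)
         = real (Suc n) / \<rho> * (\<integral>x. step (- (x \<bullet> u) / h k - 1) * indicator ?B x \<partial>lborel)" by simp
      have "(\<integral>x. indicator ?B x * (layer_weight (h k) (x \<bullet> u) * (?T x \<bullet> u)) \<partial>lborel)
        \<le> (\<integral>x. - (a / \<rho>) * (indicator ?B x * layer_weight (h k) (x \<bullet> u)) \<partial>lborel)"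
      proof (rule integral_mono)
        show "integrable lborel (\<lambda>x. - (a / \<rho>) * (indicator ?B x * layer_weight (h k) (x \<bullet> u)))"
          using J by (intro integrable_mult_right) (auto simp: has_bochner_integral_iff)
        show "indicator ?B x * (layer_weight (h k) (x \<bullet> u) * (?T x \<bullet> u)) \<le> - (a / \<rho>) * (indicator ?B x * layer_weight (h k) (x \<bullet> u))" for x
        proof (cases "x \<in> ?B \<and> x \<bullet> u < 0")
          case True
          then have "?T x \<bullet> u = (x \<bullet> u - a) / \<rho>" by (simp add: T(2) inner_diff_left nu del: mem_cball)
          \<comment> \<open>Heights in the layer are negative, which is the favourable sign here, as
            the layer term enters with a minus.\<close>
          also have "\<dots> \<le> - a / \<rho>" using True \<rho> R0 by (intro divide_right_mono) auto
          finally show ?thesis using True mult_left_mono[OF _ layer_weight_nonneg[OF h[of k]], of "?T x \<bullet> u" "- a / \<rho>" "x \<bullet> u"]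
            by (simp add: mult.commute del: mem_cball)
        next
          case False
          moreover have "layer_weight (h k) (x \<bullet> u) = 0" if "\<not> x \<bullet> u < 0"
          proof -
            have "- (x \<bullet> u) / h k - 1 \<le> 0" using that h[of k] divide_nonneg_pos[of "x \<bullet> u" "h k"] by (simp add: order_trans[of "-1" 0])
            then show ?thesis by (simp add: layer_weight_def step'_eq_0)
          qed
          ultimately show ?thesis by (auto simp del: mem_cball)
        qed
      qed (rule cutoff_field_integral(1)[OF dim u R0 h T(1) E])
      also have "\<dots> = - (a / \<rho>) * J k" using J[of k] by (simp add: has_bochner_integral_iff)
      finally have "real (Suc n) / \<rho> * (\<integral>x. step (- (x \<bullet> u) / h k - 1) * indicator ?B x \<partial>lborel) + a / \<rho> * J k
        \<le> (\<integral>x. step (- (x \<bullet> u) / h k - 1) * (indicator ?B x * divergence ?T x) \<partial>lborel)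
          - (\<integral>x. indicator ?B x * (layer_weight (h k) (x \<bullet> u) * (?T x \<bullet> u)) \<partial>lborel)"
        unfolding 1 by simp
      then show ?thesis
        by (rule order_trans[OF ennreal_leI cutoff_field_integral(2)[OF dim u R0 h T(1) E]])
    qed
    have int: "integrable lborel (indicator ?B :: 'a \<Rightarrow> real)"
      by (intro integrable_real_indicator emeasure_bounded_finite bounded_cball) simp
    have "(\<lambda>k. ennreal (real (Suc n) / \<rho> * (\<integral>x. step (- (x \<bullet> u) / h k - 1) * indicator ?B x \<partial>lborel) + a / \<rho> * J k))
      \<longlonglongrightarrow> ennreal (real (Suc n) / \<rho> * (w * R ^ Suc n * cap_vol n (- a / R)) + a / \<rho> * slice_area n a R 0)"
      using cutoff_limit[OF int h h0, of u] Jlim unfolding vol by (intro tendsto_intros)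
    also have "real (Suc n) / \<rho> * (w * R ^ Suc n * cap_vol n (- a / R)) + a / \<rho> * slice_area n a R 0 = (R * cap_area n R (- a / R)) / \<rho>"
      unfolding area[symmetric] by (simp add: add_divide_distrib del: of_nat_Suc)
    finally show ?thesis by (rule LIMSEQ_le_const2) (use bound in auto)
  qed
  have "(\<lambda>k. ennreal ((R * cap_area n R (- a / R)) / (R + h k))) \<longlonglongrightarrow> ennreal ((R * cap_area n R (- a / R)) / (R + 0))"
    using R0 by (intro tendsto_intros h0) auto
  then have "(\<lambda>k. ennreal ((R * cap_area n R (- a / R)) / (R + h k))) \<longlonglongrightarrow> ennreal (cap_area n R (- a / R))"
    using R0 by simp
  then show ?thesis unfolding n_def by (rule LIMSEQ_le_const2) (use step1 h n_def in auto)
qed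

section \<open>Hausdorff measure of the contact sphere\<close>

text \<open>Stacking scaled copies of the points in a second direction inside the hyperplane and translated copies
  orthogonally to it turns a separated subset of the sphere into a separated set of full dimension, so that
  volumes can be compared.\<close>

lemma card_separated_subset_le:
  fixes e :: "'a::euclidean_space" and K :: nat
  assumes e: "e \<in> Basis" and r: "0 < r" and K: "0 < K" and fin: "finite P"
    and P: "P \<subseteq> sphere 0 r \<inter> interface e"
    and sep: "\<And>p q. p \<in> P \<Longrightarrow> q \<in> P \<Longrightarrow> p \<noteq> q \<Longrightarrow> 1 / real K \<le> dist p q"
  shows "real (card P) * (real K)\<^sup>2 \<le> (2 * (r + 3) * real K) ^ DIM('a)"
proof -
  define \<epsilon> where "\<epsilon> = 1 / real K"
  have \<epsilon>: "0 < \<epsilon>" "\<epsilon> \<le> 1" "real K * \<epsilon> = 1" using K by (auto simp: \<epsilon>_def)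
  define f :: "'a \<times> nat \<times> nat \<Rightarrow> 'a" where "f = (\<lambda>(p, j, i). (1 + real j * \<epsilon> / r) *\<^sub>R p + (real i * \<epsilon>) *\<^sub>R e)"
  define I where "I = P \<times> {..<K} \<times> {..<K}"
  have far: "\<epsilon> \<le> \<bar>real i * \<epsilon> - real j * \<epsilon>\<bar>" if "i \<noteq> j" for i j :: nat
  proof -
    have "1 * \<epsilon> \<le> \<bar>real i - real j\<bar> * \<epsilon>" using that \<epsilon> by (intro mult_right_mono) auto
    then show ?thesis using \<epsilon> by (simp add: abs_mult left_diff_distrib[symmetric])
  qed
  have norm_scaled: "norm ((1 + real j * \<epsilon> / r) *\<^sub>R p) = r + real j * \<epsilon>" if "p \<in> P" for p j
  proof -
    have "norm p = r" using that P by auto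
    moreover have "0 \<le> 1 + real j * \<epsilon> / r" using \<epsilon> r by simp
    ultimately show ?thesis using r by (simp add: field_simps)
  qed
  have dist_f: "\<epsilon> \<le> dist (f x) (f y)" if x: "x \<in> I" and y: "y \<in> I" and "x \<noteq> y" for x y
  proof -
    obtain p j i where xx: "x = (p, j, i)" by (metis prod_cases3)
    obtain q l k where yy: "y = (q, l, k)" by (metis prod_cases3)
    have pq: "p \<in> P" "q \<in> P" "p \<bullet> e = 0" "q \<bullet> e = 0" using x y P by (auto simp: I_def xx yy interface_def)
    show ?thesis
    proof (cases "i = k")
      case False
      have "(f x - f y) \<bullet> e = real i * \<epsilon> - real k * \<epsilon>"
        using pq e by (simp add: f_def xx yy inner_diff_left inner_add_left)
      then have "\<bar>real i * \<epsilon> - real k * \<epsilon>\<bar> \<le> norm (f x - f y)" using Basis_le_norm[OF e, of "f x - f y"] by simp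
      then show ?thesis using far[OF False] by (simp add: dist_norm)
    next
      case True
      then have d: "dist (f x) (f y) = norm ((1 + real j * \<epsilon> / r) *\<^sub>R p - (1 + real l * \<epsilon> / r) *\<^sub>R q)"
        by (simp add: f_def xx yy dist_norm)
      show ?thesis
      proof (cases "j = l")
        case False
        have "\<bar>real j * \<epsilon> - real l * \<epsilon>\<bar> \<le> dist (f x) (f y)"
          using norm_triangle_ineq3[of "(1 + real j * \<epsilon> / r) *\<^sub>R p" "(1 + real l * \<epsilon> / r) *\<^sub>R q"]
          unfolding d norm_scaled[OF pq(1)] norm_scaled[OF pq(2)] by simp
        then show ?thesis using far[OF False] by simp
      next
        case jl: True
        with True \<open>x \<noteq> y\<close> have "p \<noteq> q" by (auto simp: xx yy)
        have s: "1 \<le> 1 + real l * \<epsilon> / r" using \<epsilon> r by simp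
        have "dist (f x) (f y) = (1 + real l * \<epsilon> / r) * dist p q"
          using s unfolding d jl scaleR_right_diff_distrib[symmetric] by (simp add: dist_norm)
        moreover have "1 * dist p q \<le> (1 + real l * \<epsilon> / r) * dist p q" using s by (rule mult_right_mono) simp
        ultimately show ?thesis using sep[OF pq(1,2) \<open>p \<noteq> q\<close>] by (simp add: \<epsilon>_def)
      qed
    qed
  qed
  have inj: "inj_on f I"
    by (rule inj_onI, rule ccontr) (use dist_f \<epsilon> in fastforce)
  have finI: "finite I" using fin by (simp add: I_def)
  have disj: "disjoint_family_on (\<lambda>x. ball (f x) (\<epsilon> / 2)) I"
    unfolding disjoint_family_on_def
  proof (intro ballI impI)
    fix x y assume xy: "x \<in> I" "y \<in> I" "x \<noteq> y"
    show "ball (f x) (\<epsilon> / 2) \<inter> ball (f y) (\<epsilon> / 2) = {}"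
      using dist_f[OF xy] by (intro disjoint_ballI) simp
  qed
  \<comment> \<open>The radius allows r for the sphere, at most 1 each for the radial and the
    vertical stacking, and 1 for the balls of radius \<epsilon>/2.\<close>
  have sub: "(\<Union>x\<in>I. ball (f x) (\<epsilon> / 2)) \<subseteq> ball 0 (r + 3)"
  proof
    fix z assume "z \<in> (\<Union>x\<in>I. ball (f x) (\<epsilon> / 2))"
    then obtain p j i where x: "(p, j, i) \<in> I" and z: "dist (f (p, j, i)) z < \<epsilon> / 2" by auto
    have ji: "real j * \<epsilon> \<le> 1" "real i * \<epsilon> \<le> 1"
      using x \<epsilon> mult_right_mono[of "real j" "real K" \<epsilon>] mult_right_mono[of "real i" "real K" \<epsilon>] by (auto simp: I_def)
    have "norm (f (p, j, i)) \<le> norm ((1 + real j * \<epsilon> / r) *\<^sub>R p) + norm ((real i * \<epsilon>) *\<^sub>R e)"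
      unfolding f_def prod.case by (rule norm_triangle_ineq)
    also have "\<dots> = r + real j * \<epsilon> + real i * \<epsilon>"
      using norm_scaled[of p j] x \<epsilon> e by (simp add: I_def)
    finally have "norm (f (p, j, i)) \<le> r + 2" using ji by simp
    moreover have "norm z \<le> norm (f (p, j, i)) + dist (f (p, j, i)) z"
      using norm_triangle_ineq[of "f (p, j, i)" "z - f (p, j, i)"] by (simp add: dist_norm norm_minus_commute)
    ultimately show "z \<in> ball 0 (r + 3)" using z \<epsilon> by simp
  qed
  let ?\<omega> = "unit_ball_vol (real DIM('a))"
  have "real (card I) * (?\<omega> * (\<epsilon> / 2) ^ DIM('a)) = (\<Sum>x\<in>I. measure lborel (ball (f x) (\<epsilon> / 2)))"
    using \<epsilon> by (simp add: content_ball)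
  also have "\<dots> = measure lborel (\<Union>x\<in>I. ball (f x) (\<epsilon> / 2))"
    using disj finI by (intro measure_finite_Union[symmetric]) (auto intro!: less_imp_neq[OF emeasure_bounded_finite[unfolded infinity_ennreal_def]])
  also have "\<dots> \<le> measure lborel (ball (0::'a) (r + 3))"
    using sub finI by (intro measure_mono_fmeasurable fmeasurableI emeasure_bounded_finite bounded_ball) auto
  also have "\<dots> = ?\<omega> * (r + 3) ^ DIM('a)" using r by (simp add: content_ball)
  finally have "real (card I) * (\<epsilon> / 2) ^ DIM('a) \<le> (r + 3) ^ DIM('a)"
    by (simp add: mult.left_commute[of _ ?\<omega>])
  then have le: "real (card I) * (\<epsilon> / 2) ^ DIM('a) * (2 * real K) ^ DIM('a) \<le> (r + 3) ^ DIM('a) * (2 * real K) ^ DIM('a)"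
    by (intro mult_right_mono) auto
  have one: "(\<epsilon> / 2) ^ DIM('a) * (2 * real K) ^ DIM('a) = 1"
  proof -
    have "\<epsilon> / 2 * (2 * real K) = 1" using \<epsilon>(3) by (simp add: mult.commute)
    then show ?thesis by (metis power_mult_distrib power_one)
  qed
  have ci: "real (card I) = real (card P) * (real K)\<^sup>2" using fin by (simp add: I_def card_cartesian_product power2_eq_square)
  have eq: "(r + 3) ^ DIM('a) * (2 * real K) ^ DIM('a) = (2 * (r + 3) * real K) ^ DIM('a)"
    unfolding power_mult_distrib[symmetric] by (rule arg_cong[where f = "\<lambda>x. x ^ DIM('a)"]) simp
  have "real (card I) * 1 \<le> (2 * (r + 3) * real K) ^ DIM('a)"
    using le unfolding eq one[symmetric] by (simp only: mult.assoc)
  then show ?thesis by (simp add: ci)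
qed

lemma hausdorff_content_le_cover:
  fixes P :: "'a::euclidean_space set"
  assumes n: "1 \<le> n" and fin: "finite P" and cover: "A \<subseteq> (\<Union>p\<in>P. cball p \<epsilon>)" and \<epsilon>: "0 < \<epsilon>" "2 * \<epsilon> \<le> \<delta>"
  shows "hausdorff_content n \<delta> A \<le> ennreal (real (card P) * (unit_ball_vol (real n) * \<epsilon> ^ n))"
proof -
  obtain g where g: "bij_betw g {..<card P} P"
    using ex_bij_betw_nat_finite[OF fin] by (auto simp: atLeast0LessThan)
  \<comment> \<open>Padding by the empty set costs nothing: its diameter is 0 and n \<ge> 1.\<close>
  define U where "U i = (if i < card P then cball (g i) \<epsilon> else {})" for i
  have diam: "diameter (U i) \<le> (if i < card P then 2 * \<epsilon> else 0)" "0 \<le> diameter (U i)" "bounded (U i)" for i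
    using \<epsilon> by (auto simp: U_def diameter_cball diameter_ge_0)
  have "hausdorff_content n \<delta> A \<le> (\<Sum>i. ennreal (unit_ball_vol (real n) * (diameter (U i) / 2) ^ n))"
    unfolding hausdorff_content_def
  proof (rule INF_lower, rule CollectI, intro conjI allI)
    show "A \<subseteq> (\<Union>i. U i)"
    proof
      fix x assume "x \<in> A"
      then obtain p where "p \<in> P" "x \<in> cball p \<epsilon>" using cover by auto
      moreover obtain i where "i < card P" "g i = p"
        using g \<open>p \<in> P\<close> unfolding bij_betw_def by (metis imageE lessThan_iff)
      ultimately show "x \<in> (\<Union>i. U i)" by (auto simp: U_def)
    qed
    show "bounded (U i)" "diameter (U i) \<le> \<delta>" for i
      using diam[of i] \<epsilon> by (auto split: if_splits)
  qed
  also have "\<dots> = (\<Sum>i<card P. ennreal (unit_ball_vol (real n) * (diameter (U i) / 2) ^ n))"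
    by (rule suminf_finite) (use n in \<open>auto simp: U_def\<close>)
  also have "\<dots> \<le> (\<Sum>i<card P. ennreal (unit_ball_vol (real n) * \<epsilon> ^ n))"
    using diam \<epsilon> by (intro sum_mono ennreal_leI mult_left_mono power_mono) (auto simp: U_def diameter_cball diameter_ge_0 less_imp_le)
  also have "\<dots> = ennreal (real (card P) * (unit_ball_vol (real n) * \<epsilon> ^ n))"
    using \<epsilon> by (simp add: ennreal_mult ennreal_of_nat_eq_real_of_nat)
  finally show ?thesis .
qed

text \<open>A maximal 1/K-separated subset is a 1/K-net. By the volume comparison it has O(K^(n-1))
  points, so the balls of radius 1/K around them have total n-dimensional size O(1/K), which tends
  to 0.\<close>

lemma hausdorff_measure_sphere_hyperplane:
  fixes e :: "'a::euclidean_space"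
  assumes dim: "DIM('a) \<ge> 2" and e: "e \<in> Basis" and r: "0 < r" and A: "A \<subseteq> sphere 0 r \<inter> interface e"
  shows "hausdorff_measure (DIM('a) - 1) A = 0"
proof -
  define n where "n = DIM('a) - 1"
  have n: "DIM('a) = Suc n" "1 \<le> n" using dim by (auto simp: n_def)
  define D where "D = 2 * (r + 3)"
  define C where "C = D ^ Suc n * unit_ball_vol (real n)"
  have main: "hausdorff_content n \<delta> A \<le> ennreal (C / real K)" if K: "0 < K" "2 / real K \<le> \<delta>" for \<delta> and K :: nat
  proof -
    define sep where "sep P \<longleftrightarrow> finite P \<and> P \<subseteq> A \<and> (\<forall>p\<in>P. \<forall>q\<in>P. p \<noteq> q \<longrightarrow> 1 / real K \<le> dist p q)" for P
    have bound: "real (card P) * (real K)\<^sup>2 \<le> (D * real K) ^ Suc n" if "sep P" for P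
      using card_separated_subset_le[OF e r K(1), of P] that A unfolding sep_def n D_def by blast
    \<comment> \<open>A bound on the cardinalities, however crude, yields a separated set of
      greatest cardinality.\<close>
    have "card P < nat \<lceil>(D * real K) ^ Suc n\<rceil> + 1" if "sep P" for P
    proof -
      have "real (card P) * 1 \<le> real (card P) * (real K)\<^sup>2" using K by (intro mult_left_mono) auto
      with bound[OF that] show ?thesis by linarith
    qed
    moreover have "sep {}" by (simp add: sep_def)
    ultimately obtain P where P: "sep P" "\<And>Q. sep Q \<Longrightarrow> card Q \<le> card P"
      using ex_has_greatest_nat[of sep "{}" card] by metis
    have cover: "A \<subseteq> (\<Union>p\<in>P. cball p (1 / real K))"
    proof
      fix x assume "x \<in> A"
      show "x \<in> (\<Union>p\<in>P. cball p (1 / real K))"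
      proof (rule ccontr)
        assume x: "x \<notin> (\<Union>p\<in>P. cball p (1 / real K))"
        then have far: "1 / real K \<le> dist p x" if "p \<in> P" for p using that by force
        have "x \<notin> P" using x by auto
        moreover have "sep (insert x P)"
          using P(1) far \<open>x \<in> A\<close> unfolding sep_def by (auto simp: dist_commute)
        ultimately show False using P(2)[of "insert x P"] P(1) by (simp add: sep_def)
      qed
    qed
    have "hausdorff_content n \<delta> A \<le> ennreal (real (card P) * (unit_ball_vol (real n) * (1 / real K) ^ n))"
      using P(1) K by (intro hausdorff_content_le_cover[OF n(2) _ cover]) (auto simp: sep_def)
    also have "\<dots> \<le> ennreal (C / real K)"
    proof (rule ennreal_leI)
      \<comment> \<open>One factor K is cancelled; dividing the rest by K^(n+1) leaves the rate
        1/K.\<close>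
      have "real (card P) * real K * real K \<le> (D ^ Suc n * real K ^ n) * real K"
        using bound[OF P(1)] by (simp add: power_mult_distrib power2_eq_square mult_ac)
      then have "real (card P) * real K \<le> D ^ Suc n * real K ^ n" using K by simp
      then have "real (card P) * real K * (unit_ball_vol (real n) / (real K ^ n * real K))
         \<le> D ^ Suc n * real K ^ n * (unit_ball_vol (real n) / (real K ^ n * real K))"
        by (rule mult_right_mono) simp
      moreover have "real (card P) * real K * (unit_ball_vol (real n) / (real K ^ n * real K))
         = real (card P) * (unit_ball_vol (real n) * (1 / real K) ^ n)"
        using K by (simp add: power_one_over divide_simps)
      moreover have "D ^ Suc n * real K ^ n * (unit_ball_vol (real n) / (real K ^ n * real K)) = C / real K"
        using K by (simp add: C_def)
      ultimately show "real (card P) * (unit_ball_vol (real n) * (1 / real K) ^ n) \<le> C / real K" by simp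
    qed
    finally show ?thesis .
  qed
  have "hausdorff_content n \<delta> A = 0" if \<delta>: "0 < \<delta>" for \<delta>
  proof -
    have "(\<lambda>k. C / real k) \<longlonglongrightarrow> 0" by (rule lim_const_over_n)
    then have "(\<lambda>k. ennreal (C / real k)) \<longlonglongrightarrow> ennreal 0" by (rule tendsto_ennrealI)
    moreover have "\<forall>\<^sub>F k in sequentially. 2 / real k < \<delta>" using order_tendstoD(2)[OF lim_const_over_n \<delta>, of 2] .
    then have "\<forall>\<^sub>F k in sequentially. hausdorff_content n \<delta> A \<le> ennreal (C / real k)"
      using eventually_gt_at_top[of 0] by eventually_elim (rule main, auto)
    ultimately have "hausdorff_content n \<delta> A \<le> ennreal 0" by (rule tendsto_lowerbound[OF _ _ sequentially_bot])
    then show ?thesis by simp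
  qed
  then show ?thesis unfolding hausdorff_measure_def n_def[symmetric] by (intro SUP_eq_const) auto
qed

section \<open>Candidate sets\<close>

lemma gg_boundary_subset_frontier: "gg_boundary \<Omega> \<subseteq> frontier \<Omega>"
proof
  fix x assume x: "x \<in> gg_boundary \<Omega>"
  have "x \<in> closure \<Omega>"
  proof (rule ccontr)
    assume "x \<notin> closure \<Omega>"
    then obtain r where "r > 0" "\<Omega> \<inter> ball x r = {}"
      by (metis disjoint_iff dist_commute closure_approachable mem_ball)
    then show False using x by (force simp: gg_boundary_def)
  qed
  moreover have "x \<notin> interior \<Omega>"
  proof
    assume "x \<in> interior \<Omega>"
    then obtain r where "r > 0" "ball x r \<subseteq> \<Omega>" by (auto simp: mem_interior)
    then have "\<Omega> \<inter> ball x r = ball x r" by auto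
    then show False using x \<open>r > 0\<close> by (force simp: gg_boundary_def)
  qed
  ultimately show "x \<in> frontier \<Omega>" by (simp add: frontier_def)
qed

lemma half_neg_uminus: "half_neg (- e) = half_pos e"
  by (auto simp: half_neg_def half_pos_def)

lemma open_half_neg: "open (half_neg e)" and open_half_pos: "open (half_pos e)"
  unfolding half_neg_def half_pos_def by (intro open_Collect_less continuous_intros)+

lemma closed_candidate: "closed (candidate e \<alpha> \<beta> Rm Rp)"
  unfolding candidate_def
  by (intro closed_Un closed_Int closed_cball closed_Collect_le continuous_intros)

lemma candidate_half_neg:
  "candidate e \<alpha> \<beta> Rm Rp \<inter> half_neg e = cball ((- Rm * cos \<alpha>) *\<^sub>R e) Rm \<inter> half_neg e"
  by (auto simp: candidate_def half_neg_def)

lemma candidate_half_pos: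
  "candidate e \<alpha> \<beta> Rm Rp \<inter> half_pos e = cball ((- Rp * cos \<beta>) *\<^sub>R e) Rp \<inter> half_pos e"
  by (auto simp: candidate_def half_pos_def)

text \<open>On the positive side the reflected direction \<open>- e\<close> is used, which turns the angle \<open>\<beta>\<close> into \<open>pi - \<beta>\<close>.\<close>

lemma candidate_half_neg_uminus:
  "candidate e \<alpha> \<beta> Rm Rp \<inter> half_neg (- e) = cball ((- Rp * - cos \<beta>) *\<^sub>R - e) Rp \<inter> half_neg (- e)"
  unfolding half_neg_uminus candidate_half_pos by simp

lemma dist_center_interface:
  fixes e :: "'a::euclidean_space"
  assumes e: "e \<in> Basis" and x: "x \<in> interface e"
  shows "(dist ((- R * cos t) *\<^sub>R e) x)\<^sup>2 = (norm x)\<^sup>2 + R\<^sup>2 - (R * sin t)\<^sup>2"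
proof -
  have "(dist ((- R * cos t) *\<^sub>R e) x)\<^sup>2 = (norm x)\<^sup>2 + (R * cos t)\<^sup>2"
    unfolding dist_norm power2_norm_eq_inner
    using e x by (simp add: interface_def inner_diff_left inner_diff_right
        inner_add_left inner_add_right inner_commute[of e x] power2_eq_square algebra_simps)
  then show ?thesis by (simp add: power_mult_distrib cos_squared_eq algebra_simps)
qed

lemma interface_cball_iff:
  fixes e :: "'a::euclidean_space"
  assumes e: "e \<in> Basis" and x: "x \<in> interface e" and R: "0 < R" "0 \<le> sin t"
  shows "x \<in> cball ((- R * cos t) *\<^sub>R e) R \<longleftrightarrow> norm x \<le> R * sin t"
    and "x \<in> ball ((- R * cos t) *\<^sub>R e) R \<longleftrightarrow> norm x < R * sin t"
proof -
  note d = dist_center_interface[OF e x, of R t]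
  have sq: "a\<^sup>2 < b\<^sup>2 \<longleftrightarrow> a < b" if "0 \<le> a" "0 \<le> b" for a b :: real
    using power_mono_iff[of b a 2] that by (simp flip: not_le)
  have s: "0 \<le> R * sin t" using R by simp
  have "dist ((- R * cos t) *\<^sub>R e) x \<le> R \<longleftrightarrow> (dist ((- R * cos t) *\<^sub>R e) x)\<^sup>2 \<le> R\<^sup>2"
    using R by (intro power_mono_iff[symmetric]) auto
  also have "\<dots> \<longleftrightarrow> (norm x)\<^sup>2 \<le> (R * sin t)\<^sup>2" unfolding d by linarith
  also have "\<dots> \<longleftrightarrow> norm x \<le> R * sin t" using s by (intro power_mono_iff) auto
  finally show "x \<in> cball ((- R * cos t) *\<^sub>R e) R \<longleftrightarrow> norm x \<le> R * sin t" by (simp only: mem_cball)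
  have "dist ((- R * cos t) *\<^sub>R e) x < R \<longleftrightarrow> (dist ((- R * cos t) *\<^sub>R e) x)\<^sup>2 < R\<^sup>2"
    using R by (intro sq[symmetric]) auto
  also have "\<dots> \<longleftrightarrow> (norm x)\<^sup>2 < (R * sin t)\<^sup>2" unfolding d by linarith
  also have "\<dots> \<longleftrightarrow> norm x < R * sin t" using s by (intro sq) auto
  finally show "x \<in> ball ((- R * cos t) *\<^sub>R e) R \<longleftrightarrow> norm x < R * sin t" by (simp only: mem_ball)
qed

text \<open>Because the two bases have the same radius r, a point of the hyperplane of norm below r
  lies in both open balls. Their intersection is contained in the candidate, so such a point is
  interior.\<close>

lemma gg_boundary_candidate_interface:
  fixes e :: "'a::euclidean_space"
  assumes e: "e \<in> Basis" and R: "0 < Rm" "0 < Rp" and s: "0 \<le> sin \<alpha>" "0 \<le> sin \<beta>"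
    and r: "Rm * sin \<alpha> = r" "Rp * sin \<beta> = r"
  shows "gg_boundary (candidate e \<alpha> \<beta> Rm Rp) \<inter> interface e \<subseteq> sphere 0 r \<inter> interface e"
proof
  let ?\<Omega> = "candidate e \<alpha> \<beta> Rm Rp" and ?A = "ball ((- Rm * cos \<alpha>) *\<^sub>R e) Rm" and ?B = "ball ((- Rp * cos \<beta>) *\<^sub>R e) Rp"
  fix x assume "x \<in> gg_boundary ?\<Omega> \<inter> interface e"
  then have x: "x \<in> ?\<Omega>" "x \<notin> interior ?\<Omega>" "x \<in> interface e"
    using gg_boundary_subset_frontier[of ?\<Omega>] closed_candidate[of e \<alpha> \<beta> Rm Rp] by (auto simp: frontier_def)
  have "norm x \<le> r"
    using x(1) interface_cball_iff(1)[OF e x(3) R(1) s(1)] interface_cball_iff(1)[OF e x(3) R(2) s(2)] r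
    unfolding candidate_def by auto
  moreover have "\<not> norm x < r"
  proof
    assume "norm x < r"
    then have "x \<in> ?A \<inter> ?B"
      using interface_cball_iff(2)[OF e x(3) R(1) s(1)] interface_cball_iff(2)[OF e x(3) R(2) s(2)]
      unfolding r by blast
    moreover have "?A \<inter> ?B \<subseteq> ?\<Omega>" by (auto simp: candidate_def)
    ultimately have "x \<in> interior ?\<Omega>" by (meson interiorI open_Int open_ball)
    then show False using x by simp
  qed
  ultimately show "x \<in> sphere 0 r \<inter> interface e" using x by simp
qed

text \<open>Otherwise the cap would be clopen in the connected sphere.\<close>

lemma spherical_cap_not_closed:
  fixes e :: "'a::euclidean_space"
  assumes dim: "DIM('a) \<ge> 2" and cap: "spherical_cap e (half_neg e) \<Gamma>"
  shows "\<exists>x. x \<in> closure \<Gamma> - \<Gamma>"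
proof (rule ccontr)
  assume "\<nexists>x. x \<in> closure \<Gamma> - \<Gamma>"
  then have "closure \<Gamma> = \<Gamma>" using closure_subset[of \<Gamma>] by auto
  then have cl: "closed \<Gamma>" by (metis closed_closure)
  obtain c r where S: "sphere c r \<inter> half_neg e \<noteq> {}" "sphere c r \<inter> half_pos e \<noteq> {}" "\<Gamma> = sphere c r \<inter> half_neg e"
    using cap unfolding spherical_cap_def by auto
  have disj: "half_neg e \<inter> half_pos e = {}" by (auto simp: half_neg_def half_pos_def)
  have "connected (sphere c r)" using dim by (rule connected_sphere)
  moreover have "openin (top_of_set (sphere c r)) \<Gamma>" unfolding S(3) using open_half_neg by blast
  moreover have "closedin (top_of_set (sphere c r)) \<Gamma>" using cl S(3) by (auto intro: closed_subset)
  ultimately have "\<Gamma> = {} \<or> \<Gamma> = sphere c r" unfolding connected_clopen by blast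
  then show False using S disj by auto
qed

text \<open>The cap is contained in a closed subset of the sphere intersected with the frontier and
  the closed half-space. A limit point outside the cap must therefore lie on the hyperplane, where
  the sphere has norm R sin \<alpha>.\<close>

lemma frontier_candidate_closure:
  fixes e :: "'a::euclidean_space"
  assumes e: "e \<in> Basis" and R: "0 < Rm" and s: "0 \<le> sin \<alpha>"
    and x: "x \<in> closure (frontier (candidate e \<alpha> \<beta> Rm Rp) \<inter> half_neg e) - (frontier (candidate e \<alpha> \<beta> Rm Rp) \<inter> half_neg e)"
  shows "norm x = Rm * sin \<alpha>"
proof -
  let ?\<Omega> = "candidate e \<alpha> \<beta> Rm Rp" and ?c = "(- Rm * cos \<alpha>) *\<^sub>R e"
  have sub: "frontier ?\<Omega> \<inter> half_neg e \<subseteq> sphere ?c Rm \<inter> frontier ?\<Omega> \<inter> {x. x \<bullet> e \<le> 0}"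
  proof
    fix y assume y: "y \<in> frontier ?\<Omega> \<inter> half_neg e"
    then have "y \<in> ?\<Omega>" "y \<notin> interior ?\<Omega>" using closed_candidate[of e \<alpha> \<beta> Rm Rp] by (auto simp: frontier_def)
    moreover have "ball ?c Rm \<inter> half_neg e \<subseteq> ?\<Omega>" by (auto simp: candidate_def half_neg_def)
    then have "ball ?c Rm \<inter> half_neg e \<subseteq> interior ?\<Omega>" by (intro interior_maximal open_Int open_ball open_half_neg)
    moreover have "?\<Omega> \<inter> half_neg e = cball ?c Rm \<inter> half_neg e" by (rule candidate_half_neg)
    ultimately have "y \<in> cball ?c Rm" "y \<notin> ball ?c Rm" using y by blast+
    then show "y \<in> sphere ?c Rm \<inter> frontier ?\<Omega> \<inter> {x. x \<bullet> e \<le> 0}" using y by (auto simp: half_neg_def)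
  qed
  have "closed (sphere ?c Rm \<inter> frontier ?\<Omega> \<inter> {x. x \<bullet> e \<le> 0})"
    by (intro closed_Int closed_sphere frontier_closed closed_Collect_le continuous_intros)
  from closure_minimal[OF sub this] x have xs: "x \<in> sphere ?c Rm" "x \<in> frontier ?\<Omega>" "x \<bullet> e \<le> 0" by blast+
  then have "x \<in> interface e" using x by (auto simp: half_neg_def interface_def)
  from interface_cball_iff[OF e this R s] xs(1) show ?thesis by auto
qed

lemma frontier_candidate_closure':
  fixes e :: "'a::euclidean_space"
  assumes e: "e \<in> Basis" and R: "0 < Rp" and s: "0 \<le> sin \<beta>"
    and x: "x \<in> closure (frontier (candidate e \<alpha> \<beta> Rm Rp) \<inter> half_pos e) - (frontier (candidate e \<alpha> \<beta> Rm Rp) \<inter> half_pos e)"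
  shows "norm x = Rp * sin \<beta>"
proof -
  let ?\<Omega> = "candidate e \<alpha> \<beta> Rm Rp" and ?c = "(- Rp * cos \<beta>) *\<^sub>R e"
  have sub: "frontier ?\<Omega> \<inter> half_pos e \<subseteq> sphere ?c Rp \<inter> frontier ?\<Omega> \<inter> {x. x \<bullet> e \<ge> 0}"
  proof
    fix y assume y: "y \<in> frontier ?\<Omega> \<inter> half_pos e"
    then have "y \<in> ?\<Omega>" "y \<notin> interior ?\<Omega>" using closed_candidate[of e \<alpha> \<beta> Rm Rp] by (auto simp: frontier_def)
    moreover have "ball ?c Rp \<inter> half_pos e \<subseteq> ?\<Omega>" by (auto simp: candidate_def half_pos_def)
    then have "ball ?c Rp \<inter> half_pos e \<subseteq> interior ?\<Omega>" by (intro interior_maximal open_Int open_ball open_half_pos)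
    moreover have "?\<Omega> \<inter> half_pos e = cball ?c Rp \<inter> half_pos e" by (rule candidate_half_pos)
    ultimately have "y \<in> cball ?c Rp" "y \<notin> ball ?c Rp" using y by blast+
    then show "y \<in> sphere ?c Rp \<inter> frontier ?\<Omega> \<inter> {x. x \<bullet> e \<ge> 0}" using y by (auto simp: half_pos_def)
  qed
  have "closed (sphere ?c Rp \<inter> frontier ?\<Omega> \<inter> {x. x \<bullet> e \<ge> 0})"
    by (intro closed_Int closed_sphere frontier_closed closed_Collect_le continuous_intros)
  from closure_minimal[OF sub this] x have xs: "x \<in> sphere ?c Rp" "x \<in> frontier ?\<Omega>" "x \<bullet> e \<ge> 0" by blast+
  then have "x \<in> interface e" using x by (auto simp: half_pos_def interface_def)
  from interface_cball_iff[OF e this R s] xs(1) show ?thesis by auto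
qed

text \<open>The first conjunct of \<open>type_I\<close> lets the frontier replace the Gauss-Green
  boundary. A point of the common cap boundary has both norms, which gives the equality; if the
  common radius were 0, the candidate could meet the hyperplane only at the origin, contradicting
  the disc of positive radius.\<close>

lemma type_I_candidate:
  fixes e :: "'a::euclidean_space"
  assumes dim: "DIM('a) \<ge> 2" and e: "e \<in> Basis" and R: "0 < Rm" "0 < Rp" and s: "0 \<le> sin \<alpha>" "0 \<le> sin \<beta>"
    and I: "type_I e (candidate e \<alpha> \<beta> Rm Rp)"
  shows "Rm * sin \<alpha> = Rp * sin \<beta>" "0 < Rm * sin \<alpha>"
proof -
  let ?\<Omega> = "candidate e \<alpha> \<beta> Rm Rp"
  have fr: "frontier ?\<Omega> = gg_boundary ?\<Omega>"
    and cap: "spherical_cap e (half_neg e) (frontier ?\<Omega> \<inter> half_neg e)"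
    and eq: "closure (frontier ?\<Omega> \<inter> half_neg e) - (frontier ?\<Omega> \<inter> half_neg e)
      = closure (frontier ?\<Omega> \<inter> half_pos e) - (frontier ?\<Omega> \<inter> half_pos e)"
    and disc: "\<exists>c r. c \<in> interface e \<and> r > 0 \<and> closure ?\<Omega> \<inter> interface e = cball c r \<inter> interface e"
    using I unfolding type_I_def Let_def by (simp_all only:)
  obtain x where x: "x \<in> closure (frontier ?\<Omega> \<inter> half_neg e) - (frontier ?\<Omega> \<inter> half_neg e)"
    using spherical_cap_not_closed[OF dim cap] by blast
  show same: "Rm * sin \<alpha> = Rp * sin \<beta>"
    using frontier_candidate_closure[OF e R(1) s(1) x] frontier_candidate_closure'[OF e R(2) s(2) x[unfolded eq]] by simp
  show "0 < Rm * sin \<alpha>"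
  proof (rule ccontr)
    assume "\<not> 0 < Rm * sin \<alpha>"
    then have zero: "Rm * sin \<alpha> \<le> 0" "Rp * sin \<beta> \<le> 0" using same by auto
    obtain c r where c: "c \<in> interface e" "r > 0" "?\<Omega> \<inter> interface e = cball c r \<inter> interface e"
      using disc closed_candidate[of e \<alpha> \<beta> Rm Rp] by auto
    have triv: "y = 0" if "y \<in> ?\<Omega>" "y \<in> interface e" for y
    proof -
      have "norm y \<le> Rm * sin \<alpha> \<or> norm y \<le> Rp * sin \<beta>"
        using that(1) interface_cball_iff(1)[OF e that(2) R(1) s(1)] interface_cball_iff(1)[OF e that(2) R(2) s(2)]
        unfolding candidate_def by blast
      then have "norm y \<le> 0" using zero by linarith
      then show ?thesis by simp
    qed
    \<comment> \<open>A second basis direction, present since N \<ge> 2, produces a second point of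
      the disc.\<close>
    obtain b where b: "b \<in> Basis" "b \<noteq> e"
    proof -
      have "\<not> Basis \<subseteq> {e}"
      proof
        assume "Basis \<subseteq> {e}"
        then have "DIM('a) \<le> card {e}" by (intro card_mono) auto
        then show False using dim by simp
      qed
      then show ?thesis using that by auto
    qed
    have "c + r *\<^sub>R b \<in> cball c r \<inter> interface e" "c \<in> cball c r \<inter> interface e"
      using b e c by (auto simp: interface_def dist_norm inner_add_left inner_Basis)
    then have "c + r *\<^sub>R b = 0" "c = 0" unfolding c(3)[symmetric] using triv by blast+
    then show False using b c by auto
  qed
qed

section \<open>Perimeter and volume of the candidate sets\<close>

lemma cap_perimeter:
  fixes u :: "'a::euclidean_space"
  assumes dim: "DIM('a) \<ge> 2" and u: "u \<in> Basis \<or> - u \<in> Basis" and R: "0 < R" and c: "\<bar>c\<bar> < 1"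
    and E: "E \<in> sets lebesgue" "E \<inter> half_neg u = cball ((- R * c) *\<^sub>R u) R \<inter> half_neg u"
  shows "perimeter E (half_neg u) = ennreal (cap_area (DIM('a) - 1) R c)"
    and "0 \<le> cap_area (DIM('a) - 1) R c"
    and "emeasure lebesgue (E \<inter> half_neg u) = ennreal (unit_ball_vol (real (DIM('a) - 1)) * (R ^ DIM('a) * cap_vol (DIM('a) - 1) c))"
proof -
  have a: "\<bar>- R * c\<bar> < R" "- (- R * c) / R = c" using R c by (auto simp: abs_mult)
  show "perimeter E (half_neg u) = ennreal (cap_area (DIM('a) - 1) R c)"
    using perimeter_cap_le[OF dim u a(1) E] perimeter_cap_ge[OF dim u a(1) E] unfolding a(2) by (rule antisym)
  show "0 \<le> cap_area (DIM('a) - 1) R c" using cap_area_nonneg[OF dim u a(1)] unfolding a(2) .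
  have "cball ((- R * c) *\<^sub>R u) R \<inter> half_neg u \<in> sets borel" by (intro sets.Int half_neg_borel) simp
  then show "emeasure lebesgue (E \<inter> half_neg u) = ennreal (unit_ball_vol (real (DIM('a) - 1)) * (R ^ DIM('a) * cap_vol (DIM('a) - 1) c))"
    unfolding E(2) using emeasure_cap[OF dim u a(1)] unfolding a(2) by (simp add: mult.assoc)
qed

lemma interface_null_set:
  fixes e :: "'a::euclidean_space"
  assumes "e \<in> Basis" shows "interface e \<in> null_sets lborel"
proof -
  have "interface e = {x. e \<bullet> x = 0}" by (auto simp: interface_def inner_commute)
  moreover have "negligible {x. e \<bullet> x = 0}" using assms by (intro negligible_hyperplane) auto
  moreover have "interface e \<in> sets borel" unfolding interface_def by measurable
  ultimately show ?thesis by (simp add: negligible_iff_null_sets null_sets_completion_iff)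
qed

text \<open>Up to the null hyperplane, the integral over the candidate is the sum over its two caps,
  and each flux is bounded by cap area plus disc volume, uniformly in the test field. This makes the
  competitors admissible.\<close>

lemma finite_perimeter_candidate:
  fixes e :: "'a::euclidean_space"
  assumes dim: "DIM('a) \<ge> 2" and e: "e \<in> Basis" and R: "0 < Rm" "0 < Rp"
    and c: "\<bar>cos \<alpha>\<bar> < 1" "\<bar>cos \<beta>\<bar> < 1"
  shows "finite_perimeter (candidate e \<alpha> \<beta> Rm Rp)"
proof -
  let ?\<Omega> = "candidate e \<alpha> \<beta> Rm Rp" and ?n = "DIM('a) - 1"
  let ?cm = "(- Rm * cos \<alpha>) *\<^sub>R e" and ?cp = "(- Rp * - cos \<beta>) *\<^sub>R - e"
  define C where "C = cap_area ?n Rm (cos \<alpha>) + unit_ball_vol (real ?n) * Rm ^ ?n + (cap_area ?n Rp (- cos \<beta>) + unit_ball_vol (real ?n) * Rp ^ ?n)"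
  have am: "\<bar>- Rm * cos \<alpha>\<bar> < Rm" "- (- Rm * cos \<alpha>) / Rm = cos \<alpha>" using R c by (auto simp: abs_mult)
  have ap: "\<bar>- Rp * - cos \<beta>\<bar> < Rp" "- (- Rp * - cos \<beta>) / Rp = - cos \<beta>" using R c by (auto simp: abs_mult)
  have \<Omega>: "?\<Omega> \<in> sets borel" by (intro borel_closed closed_candidate)
  have "perimeter ?\<Omega> UNIV \<le> ennreal C" unfolding perimeter_def
  proof (rule SUP_least)
    fix T :: "'a \<Rightarrow> 'a" assume "T \<in> {T. test_field UNIV T}"
    then have T: "test_field UNIV T" by simp
    have b: "cball ?cm Rm \<inter> half_neg e \<in> sets borel" "cball ?cp Rp \<inter> half_neg (- e) \<in> sets borel"
      by (intro sets.Int half_neg_borel borel_closed closed_cball)+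
    have "(LINT x:?\<Omega>|lebesgue. divergence T x) = (\<integral>x. indicator ?\<Omega> x * divergence T x \<partial>lborel)"
      using \<Omega> by (intro set_integral_divergence[OF T]) auto
    also have "\<dots> = (\<integral>x. indicator (cball ?cm Rm \<inter> half_neg e) x * divergence T x + indicator (cball ?cp Rp \<inter> half_neg (- e)) x * divergence T x \<partial>lborel)"
    proof (rule integral_cong_AE)
      show "AE x in lborel. indicator ?\<Omega> x * divergence T x = indicator (cball ?cm Rm \<inter> half_neg e) x * divergence T x + indicator (cball ?cp Rp \<inter> half_neg (- e)) x * divergence T x"
        using AE_not_in[OF interface_null_set[OF e]]
      proof eventually_elim
        case (elim x)
        then consider "x \<in> half_neg e" "x \<notin> half_neg (- e)" | "x \<notin> half_neg e" "x \<in> half_neg (- e)"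
          by (fastforce simp: half_neg_def interface_def)
        then show ?case
          unfolding candidate_half_neg[where e = e and \<alpha> = \<alpha> and \<beta> = \<beta> and Rm = Rm and Rp = Rp, symmetric]
            candidate_half_neg_uminus[where e = e and \<alpha> = \<alpha> and \<beta> = \<beta> and Rm = Rm and Rp = Rp, symmetric]
          by cases (simp_all split: split_indicator)
      qed
      note [measurable] = b \<Omega> divergence_measurable[OF T]
      show "(\<lambda>x. indicator ?\<Omega> x * divergence T x) \<in> borel_measurable lborel" by measurable
      show "(\<lambda>x. indicator (cball ?cm Rm \<inter> half_neg e) x * divergence T x + indicator (cball ?cp Rp \<inter> half_neg (- e)) x * divergence T x) \<in> borel_measurable lborel"
        by measurable
    qed
    also have "\<dots> = (\<integral>x. indicator (cball ?cm Rm \<inter> half_neg e) x * divergence T x \<partial>lborel) + (\<integral>x. indicator (cball ?cp Rp \<inter> half_neg (- e)) x * divergence T x \<partial>lborel)"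
      by (intro Bochner_Integration.integral_add integrable_divergence[OF T] b)
    also have "\<dots> \<le> C" unfolding C_def
      using integral_cap_divergence_le[OF dim _ am(1) T, of e] integral_cap_divergence_le[OF dim _ ap(1) T, of "- e"] e
      unfolding am(2) ap(2) by (intro add_mono) auto
    finally show "ennreal (LINT x:?\<Omega>|lebesgue. divergence T x) \<le> ennreal C" by (rule ennreal_leI)
  qed
  then have "perimeter ?\<Omega> UNIV < \<infinity>" by (auto simp: le_less_trans)
  then show ?thesis using \<Omega> by (simp add: finite_perimeter_def)
qed

text \<open>With V the common volume without the ball constant, the area is proportional to (n+1)
  V/R - c r^n, where r is the base radius. The tangent inequality at the original cosine adds (c' -
  c) r^n, which replaces c by c' in front of r^n; hence the factor c' of the competitor.\<close>

lemma cap_area_diff_le: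
  assumes c: "\<bar>c\<bar> < 1" "\<bar>c'\<bar> < 1" and R: "0 < R" "0 < R'"
    and vol: "R ^ Suc n * cap_vol n c = R' ^ Suc n * cap_vol n c'"
  shows "cap_area n R' c' - cap_area n R c
    \<le> unit_ball_vol n * c' * (R ^ n * cap_weight n c - R' ^ n * cap_weight n c')"
proof -
  define V where "V = R ^ Suc n * cap_vol n c"
  have 1: "cap_area n R c = unit_ball_vol n * (real (Suc n) * V / R - c * (R ^ n * cap_weight n c))"
    using R by (simp add: cap_area_def V_def field_simps)
  have 2: "cap_area n R' c' = unit_ball_vol n * (real (Suc n) * V / R' - c' * (R' ^ n * cap_weight n c'))"
    using R unfolding V_def vol by (simp add: cap_area_def field_simps)
  have "real (Suc n) * V / R' - real (Suc n) * V / R \<le> (c' - c) * (R ^ n * cap_weight n c)"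
    using cap_radius_tangent[OF c R vol] unfolding V_def[symmetric] by (simp add: algebra_simps add_divide_distrib)
  then have "(real (Suc n) * V / R' - c' * (R' ^ n * cap_weight n c')) - (real (Suc n) * V / R - c * (R ^ n * cap_weight n c))
     \<le> c' * (R ^ n * cap_weight n c - R' ^ n * cap_weight n c')"
    unfolding left_diff_distrib right_diff_distrib by linarith
  then have "unit_ball_vol n * ((real (Suc n) * V / R' - c' * (R' ^ n * cap_weight n c')) - (real (Suc n) * V / R - c * (R ^ n * cap_weight n c)))
     \<le> unit_ball_vol n * (c' * (R ^ n * cap_weight n c - R' ^ n * cap_weight n c'))"
    by (rule mult_left_mono) simp
  then show ?thesis unfolding 1 2 by (simp only: right_diff_distrib mult.assoc)
qed

section \<open>Comparison of energies\<close>

text \<open>The Hausdorff term is kept as it is: it will be shown to vanish for competitors and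
  dropped by nonnegativity for the minimizer.\<close>

lemma candidate_energy:
  fixes e :: "'a::euclidean_space"
  assumes dim: "DIM('a) \<ge> 2" and e: "e \<in> Basis" and R: "0 < Rm" "0 < Rp"
    and c: "\<bar>cos \<alpha>\<bar> < 1" "\<bar>cos \<beta>\<bar> < 1" and \<rho>: "0 < \<rho>m" "0 < \<rho>p"
  defines "\<Omega> \<equiv> candidate e \<alpha> \<beta> Rm Rp" and "n \<equiv> DIM('a) - 1"
  shows "energy e \<rho>m \<rho>p \<gamma> \<Omega> = ennreal (\<rho>m * cap_area n Rm (cos \<alpha>) + \<rho>p * cap_area n Rp (- cos \<beta>))
      + ennreal \<gamma> * hausdorff_measure n (gg_boundary \<Omega> \<inter> interface e)"
    and "0 \<le> \<rho>m * cap_area n Rm (cos \<alpha>) + \<rho>p * cap_area n Rp (- cos \<beta>)"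
    and "emeasure lebesgue (\<Omega> \<inter> half_neg e) = ennreal (unit_ball_vol (real n) * (Rm ^ Suc n * cap_vol n (cos \<alpha>)))"
    and "emeasure lebesgue (\<Omega> \<inter> half_pos e) = ennreal (unit_ball_vol (real n) * (Rp ^ Suc n * cap_vol n (- cos \<beta>)))"
proof -
  have n: "DIM('a) = Suc n" using dim by (auto simp: n_def)
  have \<Omega>: "\<Omega> \<in> sets lebesgue" unfolding \<Omega>_def using closed_candidate[of e \<alpha> \<beta> Rm Rp] by auto
  have m: "perimeter \<Omega> (half_neg e) = ennreal (cap_area n Rm (cos \<alpha>))" "0 \<le> cap_area n Rm (cos \<alpha>)"
    "emeasure lebesgue (\<Omega> \<inter> half_neg e) = ennreal (unit_ball_vol (real n) * (Rm ^ Suc n * cap_vol n (cos \<alpha>)))"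
    using cap_perimeter[OF dim _ R(1) c(1) \<Omega>, of e] e unfolding n_def[symmetric] n
    by (simp_all add: \<Omega>_def candidate_half_neg)
  have p: "perimeter \<Omega> (half_neg (- e)) = ennreal (cap_area n Rp (- cos \<beta>))" "0 \<le> cap_area n Rp (- cos \<beta>)"
    "emeasure lebesgue (\<Omega> \<inter> half_neg (- e)) = ennreal (unit_ball_vol (real n) * (Rp ^ Suc n * cap_vol n (- cos \<beta>)))"
  proof -
    have "- e \<in> Basis \<or> - (- e) \<in> Basis" "\<bar>- cos \<beta>\<bar> < 1" using e c(2) by simp_all
    moreover have "\<Omega> \<inter> half_neg (- e) = cball ((- Rp * - cos \<beta>) *\<^sub>R - e) Rp \<inter> half_neg (- e)"
      unfolding \<Omega>_def by (rule candidate_half_neg_uminus)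
    ultimately have "perimeter \<Omega> (half_neg (- e)) = ennreal (cap_area (DIM('a) - 1) Rp (- cos \<beta>))
        \<and> 0 \<le> cap_area (DIM('a) - 1) Rp (- cos \<beta>)
        \<and> emeasure lebesgue (\<Omega> \<inter> half_neg (- e))
          = ennreal (unit_ball_vol (real (DIM('a) - 1)) * (Rp ^ DIM('a) * cap_vol (DIM('a) - 1) (- cos \<beta>)))"
      by (intro conjI cap_perimeter[OF dim _ R(2) _ \<Omega>])
    then
    show "perimeter \<Omega> (half_neg (- e)) = ennreal (cap_area n Rp (- cos \<beta>))" "0 \<le> cap_area n Rp (- cos \<beta>)"
      "emeasure lebesgue (\<Omega> \<inter> half_neg (- e)) = ennreal (unit_ball_vol (real n) * (Rp ^ Suc n * cap_vol n (- cos \<beta>)))"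
      by (simp_all add: n)
  qed
  note p = p[unfolded half_neg_uminus]
  show "energy e \<rho>m \<rho>p \<gamma> \<Omega> = ennreal (\<rho>m * cap_area n Rm (cos \<alpha>) + \<rho>p * cap_area n Rp (- cos \<beta>))
      + ennreal \<gamma> * hausdorff_measure n (gg_boundary \<Omega> \<inter> interface e)"
    unfolding energy_def n_def[symmetric] using m p \<rho> by (simp add: ennreal_mult)
  show "0 \<le> \<rho>m * cap_area n Rm (cos \<alpha>) + \<rho>p * cap_area n Rp (- cos \<beta>)" using m p \<rho> by simp
  show "emeasure lebesgue (\<Omega> \<inter> half_neg e) = ennreal (unit_ball_vol (real n) * (Rm ^ Suc n * cap_vol n (cos \<alpha>)))"
    by (rule m(3))
  show "emeasure lebesgue (\<Omega> \<inter> half_pos e) = ennreal (unit_ball_vol (real n) * (Rp ^ Suc n * cap_vol n (- cos \<beta>)))"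
    by (rule p(3))
qed

theorem theorem4p4:
  fixes e :: "'a::euclidean_space"
    and \<rho>m \<rho>p \<gamma> Vm Vp \<alpha> \<beta> Rm Rp :: real
    and \<Omega> :: "'a set"
  assumes "DIM('a) \<ge> 2" and "e \<in> Basis"
    and "Vm > 0" and "Vp > 0" and "\<rho>m > 0" and "\<rho>p > 0" and "\<gamma> \<ge> 0"
    and "0 \<le> \<alpha>" and "\<alpha> < pi" and "0 < \<beta>" and "\<beta> \<le> pi" and "Rm > 0" and "Rp > 0"
    and "\<Omega> = candidate e \<alpha> \<beta> Rm Rp"
    and "minimizer e \<rho>m \<rho>p \<gamma> Vm Vp \<Omega>"
    and "type_I e \<Omega>"
  shows "\<rho>m * cos \<alpha> = \<rho>p * cos \<beta>"
proof -
  note dim = assms(1) and e = assms(2) and \<rho> = assms(5,6) and R = assms(12,13)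
  define n where "n = DIM('a) - 1"
  have n: "DIM('a) = Suc n" "1 \<le> n" using dim by (auto simp: n_def)
  have sin0: "0 \<le> sin \<alpha>" "0 \<le> sin \<beta>" using assms by (auto intro!: sin_ge_zero)
  define r where "r = Rm * sin \<alpha>"
  have r: "Rm * sin \<alpha> = r" "Rp * sin \<beta> = r" "0 < r"
    using type_I_candidate[OF dim e R sin0 assms(16)[unfolded assms(14)]] by (simp_all add: r_def)
  have sin: "0 < sin \<alpha>" "0 < sin \<beta>" using r R by (metis zero_less_mult_pos)+
  have cos: "\<bar>cos t\<bar> < 1" if "0 < sin t" for t :: real
  proof -
    have "(cos t)\<^sup>2 < 1" using that by (simp add: cos_squared_eq)
    then show ?thesis by (simp add: abs_square_less_1)
  qed
  \<comment> \<open>The sign in \<open>cp\<close> comes from viewing the positive cap along -e; the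
    claim becomes \<rho>m cm + \<rho>p cp = 0.\<close>
  define cm cp where "cm = cos \<alpha>" and "cp = - cos \<beta>"
  have c: "\<bar>cm\<bar> < 1" "\<bar>cp\<bar> < 1" using cos sin by (simp_all add: cm_def cp_def)
  \<comment> \<open>R sin t is the base radius, so slice weight and volume are rewritten in terms of
    base radius and cosine, the parameters of the comparison.\<close>
  have base: "R ^ n * cap_weight n (cos t) = (R * sin t) ^ n" "R ^ Suc n * cap_vol n (cos t) = cap_ratio n (cos t) * (R * sin t) ^ Suc n"
    if "0 < sin t" for R t :: real
  proof -
    have "sqrt (1 - (cos t)\<^sup>2) = sin t" using that by (simp add: sin_squared_eq[symmetric])
    then show "R ^ n * cap_weight n (cos t) = (R * sin t) ^ n" "R ^ Suc n * cap_vol n (cos t) = cap_ratio n (cos t) * (R * sin t) ^ Suc n"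
      using cos[OF that] that by (simp_all add: cap_weight_eq cap_ratio_def power_mult_distrib)
  qed
  have base': "R ^ n * cap_weight n (- cos t) = (R * sin t) ^ n" "R ^ Suc n * cap_vol n (- cos t) = cap_ratio n (- cos t) * (R * sin t) ^ Suc n"
    if "0 < sin t" for R t :: real
    using base[of "pi - t" R] that by simp_all
  have compare: "0 \<le> (\<rho>m * cm' + \<rho>p * cp') * (r ^ n - r' ^ n)"
    if c': "\<bar>cm'\<bar> < 1" "\<bar>cp'\<bar> < 1" and r': "0 < r'"
      and vm: "cap_ratio n cm' * r' ^ Suc n = cap_ratio n cm * r ^ Suc n"
      and vp: "cap_ratio n cp' * r' ^ Suc n = cap_ratio n cp * r ^ Suc n" for cm' cp' r'
  proof -
    \<comment> \<open>The competitor is recovered from its two cosines and its base radius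
      \<open>r'\<close>; dividing by the sines gives both of its caps the same base.\<close>
    define \<alpha>' \<beta>' where "\<alpha>' = arccos cm'" and "\<beta>' = arccos (- cp')"
    have cos': "cos \<alpha>' = cm'" "cos \<beta>' = - cp'" using c' by (simp_all add: \<alpha>'_def \<beta>'_def abs_less_iff)
    have sin': "0 < sin \<alpha>'" "0 < sin \<beta>'"
      using c' by (simp_all add: \<alpha>'_def \<beta>'_def sin_arccos_abs abs_square_less_1)
    define Rm' Rp' where "Rm' = r' / sin \<alpha>'" and "Rp' = r' / sin \<beta>'"
    have R': "0 < Rm'" "0 < Rp'" "Rm' * sin \<alpha>' = r'" "Rp' * sin \<beta>' = r'"
      using r' sin' by (simp_all add: Rm'_def Rp'_def)
    define \<Omega>' where "\<Omega>' = candidate e \<alpha>' \<beta>' Rm' Rp'"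
    have volm: "Rm ^ Suc n * cap_vol n cm = Rm' ^ Suc n * cap_vol n cm'"
      using base(2)[OF sin(1), of Rm] base(2)[OF sin'(1), of Rm'] vm unfolding cos' R'(3) r(1) cm_def by simp
    have volp: "Rp ^ Suc n * cap_vol n cp = Rp' ^ Suc n * cap_vol n cp'"
      using base'(2)[OF sin(2), of Rp] base'(2)[OF sin'(2), of Rp'] vp unfolding cos' R'(4) r(2) cp_def by simp
    note E = candidate_energy[OF dim e R cos[OF sin(1)] cos[OF sin(2)] \<rho>, folded assms(14) n_def cm_def cp_def]
    note E' = candidate_energy[OF dim e R'(1,2) cos[OF sin'(1)] cos[OF sin'(2)] \<rho>, folded \<Omega>'_def n_def, unfolded cos' minus_minus]
    have "admissible e \<rho>m \<rho>p Vm Vp \<Omega>"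
      and min: "\<And>\<Omega>'. admissible e \<rho>m \<rho>p Vm Vp \<Omega>' \<Longrightarrow> energy e \<rho>m \<rho>p \<gamma> \<Omega> \<le> energy e \<rho>m \<rho>p \<gamma> \<Omega>'"
      using assms(15) by (auto simp: minimizer_def)
    then have "admissible e \<rho>m \<rho>p Vm Vp \<Omega>'"
      using finite_perimeter_candidate[OF dim e R'(1,2) cos[OF sin'(1)] cos[OF sin'(2)], folded \<Omega>'_def]
      unfolding admissible_def E(3,4) E'(3,4) volm volp by simp
    from min[OF this] have "energy e \<rho>m \<rho>p \<gamma> \<Omega> \<le> energy e \<rho>m \<rho>p \<gamma> \<Omega>'" .
    moreover have "hausdorff_measure n (gg_boundary \<Omega>' \<inter> interface e) = 0"
      unfolding n_def \<Omega>'_def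
      by (rule hausdorff_measure_sphere_hyperplane[OF dim e r'])
         (rule gg_boundary_candidate_interface[OF e R'(1,2) less_imp_le[OF sin'(1)] less_imp_le[OF sin'(2)] R'(3,4)])
    ultimately have "ennreal (\<rho>m * cap_area n Rm cm + \<rho>p * cap_area n Rp cp)
        \<le> ennreal (\<rho>m * cap_area n Rm' cm' + \<rho>p * cap_area n Rp' cp')"
      unfolding E(1) E'(1) by (auto intro: order_trans[rotated])
    then have "0 \<le> \<rho>m * (cap_area n Rm' cm' - cap_area n Rm cm) + \<rho>p * (cap_area n Rp' cp' - cap_area n Rp cp)"
      using E'(2) by (simp add: ennreal_le_iff algebra_simps)
    also have "\<dots> \<le> \<rho>m * (unit_ball_vol n * cm' * (r ^ n - r' ^ n)) + \<rho>p * (unit_ball_vol n * cp' * (r ^ n - r' ^ n))"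
    proof (intro add_mono mult_left_mono)
      show "cap_area n Rm' cm' - cap_area n Rm cm \<le> unit_ball_vol n * cm' * (r ^ n - r' ^ n)"
        using cap_area_diff_le[OF c(1) c'(1) R(1) R'(1) volm] base(1)[OF sin(1), of Rm] base(1)[OF sin'(1), of Rm']
        unfolding cos' R'(3) r(1) cm_def by simp
      show "cap_area n Rp' cp' - cap_area n Rp cp \<le> unit_ball_vol n * cp' * (r ^ n - r' ^ n)"
        using cap_area_diff_le[OF c(2) c'(2) R(2) R'(2) volp] base'(1)[OF sin(2), of Rp] base'(1)[OF sin'(2), of Rp']
        unfolding cos' R'(4) r(2) cp_def by simp
    qed (use \<rho> in auto)
    also have "\<dots> = unit_ball_vol n * ((\<rho>m * cm' + \<rho>p * cp') * (r ^ n - r' ^ n))" by (simp add: algebra_simps)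
    finally show ?thesis by (metis linorder_not_less mult_pos_neg of_nat_0_le_iff unit_ball_vol_pos)
  qed
  define s where "s = \<rho>m * cm + \<rho>p * cp"
  have close: "s \<le> \<delta> * (\<rho>m + \<rho>p) \<and> - s \<le> \<delta> * (\<rho>m + \<rho>p)" if \<delta>: "0 < \<delta>" for \<delta>
  proof -
    obtain \<eta>1 where \<eta>1: "0 < \<eta>1" "\<eta>1 < r" "\<And>r'. \<bar>r' - r\<bar> < \<eta>1 \<Longrightarrow>
        \<exists>c'. \<bar>c'\<bar> < 1 \<and> \<bar>c' - cm\<bar> \<le> \<delta> \<and> cap_ratio n c' * r' ^ Suc n = cap_ratio n cm * r ^ Suc n"
      using cap_ratio_solve[OF c(1) \<delta> r(3), of n] by metis
    obtain \<eta>2 where \<eta>2: "0 < \<eta>2" "\<And>r'. \<bar>r' - r\<bar> < \<eta>2 \<Longrightarrow>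
        \<exists>c'. \<bar>c'\<bar> < 1 \<and> \<bar>c' - cp\<bar> \<le> \<delta> \<and> cap_ratio n c' * r' ^ Suc n = cap_ratio n cp * r ^ Suc n"
      using cap_ratio_solve[OF c(2) \<delta> r(3), of n] by metis
    \<comment> \<open>Halving makes \<eta> strictly smaller than both thresholds, so r - \<eta> and
      r + \<eta> are both available.\<close>
    define \<eta> where "\<eta> = min \<eta>1 \<eta>2 / 2"
    have \<eta>: "0 < \<eta>" "\<eta> < \<eta>1" "\<eta> < \<eta>2" using \<eta>1 \<eta>2 by (auto simp: \<eta>_def min_def field_simps)
    have near: "\<exists>t. \<bar>t - s\<bar> \<le> \<delta> * (\<rho>m + \<rho>p) \<and> 0 \<le> t * (r ^ n - r' ^ n)" if r': "\<bar>r' - r\<bar> = \<eta>" for r'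
    proof -
      obtain cm' where cm': "\<bar>cm'\<bar> < 1" "\<bar>cm' - cm\<bar> \<le> \<delta>" "cap_ratio n cm' * r' ^ Suc n = cap_ratio n cm * r ^ Suc n"
        using \<eta>1(3)[of r'] r' \<eta> by auto
      obtain cp' where cp': "\<bar>cp'\<bar> < 1" "\<bar>cp' - cp\<bar> \<le> \<delta>" "cap_ratio n cp' * r' ^ Suc n = cap_ratio n cp * r ^ Suc n"
        using \<eta>2(2)[of r'] r' \<eta> by auto
      have "0 < r'" using r' \<eta> \<eta>1(2) by linarith
      from compare[OF cm'(1) cp'(1) this cm'(3) cp'(3)] have "0 \<le> (\<rho>m * cm' + \<rho>p * cp') * (r ^ n - r' ^ n)" .
      moreover have "\<bar>(\<rho>m * cm' + \<rho>p * cp') - s\<bar> \<le> \<delta> * (\<rho>m + \<rho>p)"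
      proof -
        have "(\<rho>m * cm' + \<rho>p * cp') - s = \<rho>m * (cm' - cm) + \<rho>p * (cp' - cp)" by (simp add: s_def algebra_simps)
        also have "\<bar>\<dots>\<bar> \<le> \<bar>\<rho>m * (cm' - cm)\<bar> + \<bar>\<rho>p * (cp' - cp)\<bar>" by (rule abs_triangle_ineq)
        also have "\<dots> \<le> \<rho>m * \<delta> + \<rho>p * \<delta>"
          using \<rho> cm'(2) cp'(2) by (intro add_mono) (auto simp: abs_mult)
        finally show ?thesis by (simp add: algebra_simps)
      qed
      ultimately show ?thesis by blast
    qed
    obtain t1 where t1: "\<bar>t1 - s\<bar> \<le> \<delta> * (\<rho>m + \<rho>p)" "0 \<le> t1 * (r ^ n - (r - \<eta>) ^ n)" using near[of "r - \<eta>"] \<eta> by auto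
    obtain t2 where t2: "\<bar>t2 - s\<bar> \<le> \<delta> * (\<rho>m + \<rho>p)" "0 \<le> t2 * (r ^ n - (r + \<eta>) ^ n)" using near[of "r + \<eta>"] \<eta> by auto
    \<comment> \<open>The power difference is positive for the smaller base and negative for the
      larger one. So two numbers close to s have opposite weak signs, which confines s near
      0.\<close>
    have "(r - \<eta>) ^ n < r ^ n" "r ^ n < (r + \<eta>) ^ n"
      using \<eta> \<eta>1(2) r(3) n(2) by (auto intro!: power_strict_mono)
    then have "0 \<le> t1" "t2 \<le> 0" using t1(2) t2(2) by (auto simp: zero_le_mult_iff)
    then show ?thesis using t1(1) t2(1) by linarith
  qed
  have "s = 0"
  proof (rule ccontr)
    assume "s \<noteq> 0"
    \<comment> \<open>This \<delta> is chosen so that closeness reads \<bar>s\<bar> \<le>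
      \<bar>s\<bar>/2.\<close>
    have "\<bar>s\<bar> \<le> \<bar>s\<bar> / (2 * (\<rho>m + \<rho>p)) * (\<rho>m + \<rho>p)"
      using close[of "\<bar>s\<bar> / (2 * (\<rho>m + \<rho>p))"] \<open>s \<noteq> 0\<close> \<rho> by (auto simp: abs_le_iff)
    also have "\<dots> = \<bar>s\<bar> / 2" using \<rho> by (simp add: divide_simps)
    finally show False using \<open>s \<noteq> 0\<close> by simp
  qed
  then show ?thesis by (simp add: s_def cm_def cp_def)
qed

end
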